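(* Let $\mathfrak M_1$ be the Farey-Stern-Brocot AF $C^*$-algebra. Suppose we are given a short exact sequence $$0\to\mathfrak I\xrightarrow{\iota}\mathfrak M_1\xrightarrow{\sigma}\mathfrak M_1/\mathfrak I\to 0,$$ where $\mathfrak I$ is an ideal of $\mathfrak M_1$, $\iota$ is the identity (inclusion) map on $\mathfrak I\subseteq\mathfrak M_1$, and $\sigma\colon\mathfrak M_1\to\mathfrak M_1/\mathfrak I$ is the quotient map, with $K_0(\sigma)$ a homomorphism of $K_0(\mathfrak M_1)$ into $K_0(\mathfrak M_1/\mathfrak I)$ in the category of unital $\ell$-groups. Suppose we have an isomorphism $\theta\colon\mathfrak M_1/\mathfrak I\cong\mathfrak M_1$. Then $\theta\circ\sigma$ is an automorphism of $\mathfrak M_1$.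
   Context: A unital AF $C^*$-algebra is the norm closure of an ascending sequence of finite-dimensional $C^*$-algebras, all with the same unit. Ideals of $C^*$-algebras are closed and two-sided. For a unital AF algebra $\mathfrak U$, $K_0(\mathfrak U)$ denotes the Grothendieck group $K_0$ with its natural partial order and with the class of the unit of $\mathfrak U$ as distinguished order unit; by Elliott's classification it determines $\mathfrak U$ up to isomorphism among unital AF algebras. A unital $\ell$-group is an abelian group with a translation-invariant lattice order and a distinguished unit $u\ge 0$ such that every element $x\ge 0$ is dominated by an integer multiple of $u$; homomorphisms of unital $\ell$-groups preserve the group structure, the lattice structure and the unit. $(M_1,1)$ is the unital $\ell$-group (pointwise operations) of all continuous piecewise (affine) linear functions $f\colon[0,1]\to\mathbb R$ (finitely many pieces) where each piece is a linear polynomial with integer coefficients, with the constant function $1$ as distinguished unit. $\mathfrak M_1$ is the unital AF $C^*$-algebra defined (up to isomorphism) by $K_0(\mathfrak M_1)=(M_1,1)$. *)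

theory Defs
  imports
    "Jordan_Normal_Form.Matrix"
    "HOL-Analysis.Abstract_Metric_Spaces"
    "HOL-Algebra.QuotRing"
begin

section \<open>Unital C*-algebras on an explicit carrier\<close>

text \<open>Carriers are explicit because the quotient by an ideal has to be an object of the same
  kind as the algebra itself.\<close>

definition complex_ring :: "complex ring" where
  "complex_ring = \<lparr>carrier = UNIV, monoid.mult = (*), one = 1, ring.zero = 0, add = (+)\<rparr>"

record 'a cstar = "(complex, 'a) module" +
  star :: "'a \<Rightarrow> 'a"
  cnorm :: "'a \<Rightarrow> real"

text \<open>The value outside the carrier is immaterial; 0 is chosen because
  \<^locale>\<open>Metric_space\<close> asks for nonnegativity and symmetry on the whole type.\<close>

definition cdist :: "'a cstar \<Rightarrow> 'a \<Rightarrow> 'a \<Rightarrow> real" where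
  "cdist A x y =
    (if x \<in> carrier A \<and> y \<in> carrier A then cnorm A (x \<ominus>\<^bsub>A\<^esub> y) else 0)"

definition ctopology :: "'a cstar \<Rightarrow> 'a topology" where
  "ctopology A = Metric_space.mtopology (carrier A) (cdist A)"

locale cstar_algebra = ring A for A :: "'a cstar" (structure) +
  assumes complex_module: "Module.module complex_ring A"
    and smult_mult_left:
      "\<lbrakk>x \<in> carrier A; y \<in> carrier A\<rbrakk> \<Longrightarrow> (c \<odot> x) \<otimes> y = c \<odot> (x \<otimes> y)"
    and smult_mult_right:
      "\<lbrakk>x \<in> carrier A; y \<in> carrier A\<rbrakk> \<Longrightarrow> x \<otimes> (c \<odot> y) = c \<odot> (x \<otimes> y)"
    and star_closed: "x \<in> carrier A \<Longrightarrow> star A x \<in> carrier A"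
    and star_star: "x \<in> carrier A \<Longrightarrow> star A (star A x) = x"
    and star_add:
      "\<lbrakk>x \<in> carrier A; y \<in> carrier A\<rbrakk> \<Longrightarrow> star A (x \<oplus> y) = star A x \<oplus> star A y"
    and star_smult: "x \<in> carrier A \<Longrightarrow> star A (c \<odot> x) = cnj c \<odot> star A x"
    and star_mult:
      "\<lbrakk>x \<in> carrier A; y \<in> carrier A\<rbrakk> \<Longrightarrow> star A (x \<otimes> y) = star A y \<otimes> star A x"
    and cnorm_nonneg: "x \<in> carrier A \<Longrightarrow> 0 \<le> cnorm A x"
    and cnorm_eq_0: "x \<in> carrier A \<Longrightarrow> cnorm A x = 0 \<longleftrightarrow> x = \<zero>"
    and cnorm_smult: "x \<in> carrier A \<Longrightarrow> cnorm A (c \<odot> x) = cmod c * cnorm A x"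
    and cnorm_triangle:
      "\<lbrakk>x \<in> carrier A; y \<in> carrier A\<rbrakk> \<Longrightarrow> cnorm A (x \<oplus> y) \<le> cnorm A x + cnorm A y"
    and cnorm_mult:
      "\<lbrakk>x \<in> carrier A; y \<in> carrier A\<rbrakk> \<Longrightarrow> cnorm A (x \<otimes> y) \<le> cnorm A x * cnorm A y"
    and cstar_identity: "x \<in> carrier A \<Longrightarrow> cnorm A (star A x \<otimes> x) = (cnorm A x)\<^sup>2"
    and complete: "Metric_space.mcomplete (carrier A) (cdist A)"

definition cstar_hom :: "'a cstar \<Rightarrow> 'b cstar \<Rightarrow> ('a \<Rightarrow> 'b) set" where
  "cstar_hom A B =
    {h \<in> Ring.ring_hom A B. \<forall>x\<in>carrier A.
      h (star A x) = star B (h x) \<and> (\<forall>c. h (c \<odot>\<^bsub>A\<^esub> x) = c \<odot>\<^bsub>B\<^esub> h x)}"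

definition cstar_iso :: "'a cstar \<Rightarrow> 'b cstar \<Rightarrow> ('a \<Rightarrow> 'b) set" where
  "cstar_iso A B = {h \<in> cstar_hom A B. bij_betw h (carrier A) (carrier B)}"

abbreviation cstar_auto :: "'a cstar \<Rightarrow> ('a \<Rightarrow> 'a) set" where
  "cstar_auto A \<equiv> cstar_iso A A"

subsection \<open>Ideals, quotients and short exact sequences\<close>

definition cstar_ideal :: "'a set \<Rightarrow> 'a cstar \<Rightarrow> bool" where
  "cstar_ideal I A \<longleftrightarrow> ideal I A \<and> closedin (ctopology A) I"

text \<open>The ring part is the library's factor ring. Scalar multiplication and star are given by
  unions over representatives, in the manner of \<^const>\<open>rcoset_mult\<close>; the norm is the
  usual quotient norm.\<close>

definition cstar_quot :: "'a cstar \<Rightarrow> 'a set \<Rightarrow> 'a set cstar" where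
  "cstar_quot A I =
    \<lparr>carrier = carrier (A Quot I), monoid.mult = (\<otimes>\<^bsub>A Quot I\<^esub>), one = \<one>\<^bsub>A Quot I\<^esub>,
     ring.zero = \<zero>\<^bsub>A Quot I\<^esub>, add = (\<oplus>\<^bsub>A Quot I\<^esub>),
     smult = (\<lambda>c X. \<Union>x\<in>X. I +>\<^bsub>A\<^esub> (c \<odot>\<^bsub>A\<^esub> x)),
     star = (\<lambda>X. \<Union>x\<in>X. I +>\<^bsub>A\<^esub> star A x),
     cnorm = (\<lambda>X. INF x\<in>X. cnorm A x)\<rparr>"

definition quot_map :: "'a cstar \<Rightarrow> 'a set \<Rightarrow> 'a \<Rightarrow> 'a set" where
  "quot_map A I = (\<lambda>x. I +>\<^bsub>A\<^esub> x)"

text \<open>The sequence \<open>0 \<rightarrow> I \<rightarrow> A \<rightarrow> B \<rightarrow> 0\<close>, exact at \<open>I\<close>, \<open>A\<close> and \<open>B\<close>.\<close>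

definition short_exact ::
  "'i set \<Rightarrow> ('i \<Rightarrow> 'a) \<Rightarrow> 'a cstar \<Rightarrow> ('a \<Rightarrow> 'b) \<Rightarrow> 'b cstar \<Rightarrow> bool" where
  "short_exact I \<iota> A \<sigma> B \<longleftrightarrow>
    inj_on \<iota> I \<and> \<iota> ` I = a_kernel A B \<sigma> \<and> \<sigma> ` carrier A = carrier B"

subsection \<open>AF algebras\<close>

definition finite_dim :: "'a cstar \<Rightarrow> bool" where
  "finite_dim A \<longleftrightarrow> (\<exists>B. finite B \<and> B \<subseteq> carrier A \<and>
    (\<forall>x\<in>carrier A. \<exists>c. x = (\<Oplus>\<^bsub>A\<^esub>b\<in>B. c b \<odot>\<^bsub>A\<^esub> b)))"

text \<open>Replacing only the carrier makes each \<open>F n\<close> a C*-subalgebra with the unit of \<open>A\<close>.\<close>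

definition unital_AF :: "'a cstar \<Rightarrow> bool" where
  "unital_AF A \<longleftrightarrow> cstar_algebra A \<and>
    (\<exists>F :: nat \<Rightarrow> 'a set.
      (\<forall>n. F n \<subseteq> carrier A \<and> F n \<subseteq> F (Suc n) \<and>
        cstar_algebra (A\<lparr>carrier := F n\<rparr>) \<and> finite_dim (A\<lparr>carrier := F n\<rparr>)) \<and>
      ctopology A closure_of (\<Union>n. F n) = carrier A)"


section \<open>Unital partially ordered groups and unital l-groups\<close>

text \<open>As everywhere in HOL-Algebra, abelian groups are written multiplicatively.\<close>

record 'g pogroup = "'g monoid" +
  pg_le :: "'g \<Rightarrow> 'g \<Rightarrow> bool"
  pg_unit :: 'g

definition order_of :: "'g pogroup \<Rightarrow> 'g gorder" where
  "order_of G = \<lparr>carrier = carrier G, eq = (=), le = pg_le G\<rparr>"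

locale unital_l_group = comm_group G for G :: "'g pogroup" (structure) +
  assumes lattice_order: "Lattice.lattice (order_of G)"
    and le_translate:
      "\<lbrakk>x \<in> carrier G; y \<in> carrier G; z \<in> carrier G; pg_le G x y\<rbrakk>
        \<Longrightarrow> pg_le G (x \<otimes> z) (y \<otimes> z)"
    and unit_closed: "pg_unit G \<in> carrier G"
    and unit_nonneg: "pg_le G \<one> (pg_unit G)"
    and unit_dominates:
      "\<lbrakk>x \<in> carrier G; pg_le G \<one> x\<rbrakk> \<Longrightarrow> \<exists>n::nat. pg_le G x (pg_unit G [^] n)"

definition unital_l_hom :: "'g pogroup \<Rightarrow> 'h pogroup \<Rightarrow> ('g \<Rightarrow> 'h) set" where
  "unital_l_hom G H =
    {h \<in> hom G H. join_pres (order_of G) (order_of H) h \<and>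
      meet_pres (order_of G) (order_of H) h \<and> h (pg_unit G) = pg_unit H}"

definition unital_po_iso :: "'g pogroup \<Rightarrow> 'h pogroup \<Rightarrow> ('g \<Rightarrow> 'h) set" where
  "unital_po_iso G H =
    {h \<in> iso G H. (\<forall>x\<in>carrier G. \<forall>y\<in>carrier G. pg_le G x y \<longleftrightarrow> pg_le H (h x) (h y)) \<and>
      h (pg_unit G) = pg_unit H}"

subsection \<open>The unital l-group \<open>M\<^sub>1\<close>\<close>

definition pl_integral :: "(real \<Rightarrow> real) \<Rightarrow> bool" where
  "pl_integral f \<longleftrightarrow> (\<exists>(n::nat) t. t 0 = 0 \<and> t n = 1 \<and>
    (\<forall>i<n. t i < t (Suc i) \<and>
      (\<exists>a b :: int. \<forall>x\<in>{t i..t (Suc i)}. f x = of_int a * x + of_int b)))"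

text \<open>A function on the unit interval is an element of \<^term>\<open>extensional {0..1::real}\<close>.\<close>

definition M1 :: "(real \<Rightarrow> real) pogroup" where
  "M1 =
    \<lparr>carrier = {f \<in> extensional {0..1}. continuous_on {0..1} f \<and> pl_integral f},
     monoid.mult = (\<lambda>f g. \<lambda>x\<in>{0..1}. f x + g x),
     one = (\<lambda>x\<in>{0..1}. 0),
     pg_le = (\<lambda>f g. \<forall>x\<in>{0..1}. f x \<le> g x),
     pg_unit = (\<lambda>x\<in>{0..1}. 1)\<rparr>"


section \<open>The ordered group \<open>K\<^sub>0\<close> of a unital C*-algebra\<close>

definition amat :: "'a cstar \<Rightarrow> nat \<Rightarrow> nat \<Rightarrow> 'a mat set" where
  "amat A m n = {a \<in> carrier_mat m n. \<forall>i<m. \<forall>j<n. a $$ (i, j) \<in> carrier A}"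

definition amult :: "'a cstar \<Rightarrow> 'a mat \<Rightarrow> 'a mat \<Rightarrow> 'a mat" where
  "amult A a b = Matrix.mat (dim_row a) (dim_col b)
    (\<lambda>(i, j). \<Oplus>\<^bsub>A\<^esub>k\<in>{..<dim_col a}. a $$ (i, k) \<otimes>\<^bsub>A\<^esub> b $$ (k, j))"

definition aadj :: "'a cstar \<Rightarrow> 'a mat \<Rightarrow> 'a mat" where
  "aadj A a = map_mat (star A) (transpose_mat a)"

definition dsum :: "'a cstar \<Rightarrow> 'a mat \<Rightarrow> 'a mat \<Rightarrow> 'a mat" where
  "dsum A p q = four_block_mat
    p (Matrix.mat (dim_row p) (dim_col q) (\<lambda>_. \<zero>\<^bsub>A\<^esub>))
    (Matrix.mat (dim_row q) (dim_col p) (\<lambda>_. \<zero>\<^bsub>A\<^esub>)) q"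

definition projections :: "'a cstar \<Rightarrow> 'a mat set" where
  "projections A = {p. \<exists>n. p \<in> amat A n n \<and> aadj A p = p \<and> amult A p p = p}"

text \<open>Murray-von Neumann equivalence of projections over \<open>A\<close> of possibly different sizes.\<close>

definition mvn_equiv :: "'a cstar \<Rightarrow> 'a mat \<Rightarrow> 'a mat \<Rightarrow> bool" where
  "mvn_equiv A p q \<longleftrightarrow> (\<exists>v \<in> amat A (dim_row q) (dim_row p).
    p = amult A (aadj A v) v \<and> q = amult A v (aadj A v))"

text \<open>The Grothendieck construction: \<open>(p, q)\<close> stands for the formal difference
  \<open>[p] - [q]\<close>.\<close>

definition K0_rel :: "'a cstar \<Rightarrow> (('a mat \<times> 'a mat) \<times> ('a mat \<times> 'a mat)) set" where
  "K0_rel A = {((p, q), (p', q')).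
    p \<in> projections A \<and> q \<in> projections A \<and> p' \<in> projections A \<and> q' \<in> projections A \<and>
    (\<exists>r \<in> projections A.
      mvn_equiv A (dsum A (dsum A p q') r) (dsum A (dsum A p' q) r))}"

definition K0_class :: "'a cstar \<Rightarrow> 'a mat \<Rightarrow> 'a mat \<Rightarrow> ('a mat \<times> 'a mat) set" where
  "K0_class A p q = K0_rel A `` {(p, q)}"

definition K0_add ::
  "'a cstar \<Rightarrow> ('a mat \<times> 'a mat) set \<Rightarrow> ('a mat \<times> 'a mat) set \<Rightarrow> ('a mat \<times> 'a mat) set" where
  "K0_add A X Y = (\<Union>(p, q)\<in>X. \<Union>(p', q')\<in>Y. K0_class A (dsum A p p') (dsum A q q'))"

definition zero_proj :: "'a cstar \<Rightarrow> 'a mat" where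
  "zero_proj A = Matrix.mat 1 1 (\<lambda>_. \<zero>\<^bsub>A\<^esub>)"

definition unit_proj :: "'a cstar \<Rightarrow> 'a mat" where
  "unit_proj A = Matrix.mat 1 1 (\<lambda>_. \<one>\<^bsub>A\<^esub>)"

text \<open>The natural order has the classes \<open>[p]\<close> of projections as its positive cone.\<close>

definition K0 :: "'a cstar \<Rightarrow> ('a mat \<times> 'a mat) set pogroup" where
  "K0 A =
    \<lparr>carrier = (projections A \<times> projections A) // K0_rel A,
     monoid.mult = K0_add A,
     one = K0_class A (zero_proj A) (zero_proj A),
     pg_le = (\<lambda>X Y. \<exists>p \<in> projections A. Y = K0_add A X (K0_class A p (zero_proj A))),
     pg_unit = K0_class A (unit_proj A) (zero_proj A)\<rparr>"

definition K0_map ::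
  "'b cstar \<Rightarrow> ('a \<Rightarrow> 'b) \<Rightarrow> ('a mat \<times> 'a mat) set \<Rightarrow> ('b mat \<times> 'b mat) set" where
  "K0_map B h X = (\<Union>(p, q)\<in>X. K0_class B (map_mat h p) (map_mat h q))"


section \<open>The Farey-Stern-Brocot algebra\<close>

text \<open>The algebra is defined only up to isomorphism, by its \<open>K\<^sub>0\<close>.\<close>

definition farey_stern_brocot :: "'a cstar \<Rightarrow> bool" where
  "farey_stern_brocot A \<longleftrightarrow> unital_AF A \<and> unital_po_iso (K0 A) M1 \<noteq> {}"

end

theory Submission
  imports
    Defs
    "HOL-Computational_Algebra.Fundamental_Theorem_Algebra"
begin

text \<open>Read through \<open>K\<^sub>0(A) \<cong> M\<^sub>1 \<cong> K\<^sub>0(A/I)\<close>, the map \<open>K\<^sub>0(\<sigma>)\<close> is a unital l-endomorphism of \<open>M\<^sub>1\<close>. It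
  is onto, because projections over \<open>A/I\<close> lift to projections over \<open>A\<close>. A unital l-endomorphism of
  \<open>M\<^sub>1\<close> is the composition with the image \<open>\<eta>\<close> of the identity function; if it is onto, then \<open>\<eta>\<close> is
  one-to-one, and since the slopes of \<open>\<eta>\<close> are integers, \<open>\<eta>\<close> maps \<open>[0,1]\<close> onto itself, so that
  \<open>K\<^sub>0(\<sigma>)\<close> is one-to-one. Therefore every projection \<open>e \<in> I\<close> has class \<open>0\<close> in \<open>K\<^sub>0(A)\<close> and, as \<open>A\<close> is
  stably finite, \<open>e = 0\<close>. But a nonzero closed ideal of an AF algebra contains a nonzero projection,
  so \<open>I = 0\<close>.

  Both facts about \<open>I\<close> rest on the units \<open>e\<^sub>n\<close> of the finite-dimensional ideals \<open>I \<inter> F\<^sub>n\<close> of \<open>F\<^sub>n\<close>: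
  they are projections, central in \<open>F\<^sub>n\<close>, and form an approximate unit of \<open>I\<close>, since a self-adjoint
  \<open>h \<in> F\<^sub>n\<close> satisfies \<open>\<parallel>h(1 - e\<^sub>n)\<parallel> \<le> dist(h, I)\<close>. In place of spectral theory, polynomial relations of
  algebraic elements are factored over the complex numbers, and self-adjoint norms are recovered from
  \<open>\<parallel>h\<^sup>m\<parallel> = \<parallel>h\<parallel>\<^sup>m\<close> for powers \<open>m\<close> of 2.\<close>


section \<open>Matrices over a ring with involution\<close>

text \<open>That \<open>\<theta> \<circ> \<sigma>\<close> is a surjective star homomorphism is
  formal; the content is that \<open>\<sigma>\<close> is injective. The obstacle is that K_0 lives
  on matrices, while the C*-identity is given for A only and a C*-norm on matrices would require
  representations. Hence arguments about matrices use a complete submultiplicative norm with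
  isometric star, and whatever rests on the C*-identity is proved inside A and applied to the
  entries. To lift a projection, a self-adjoint preimage x is compressed to (1 - e) x (1 - e), where
  e is a diagonal matrix of units e_n: the coset stays the same, while the defect from idempotency
  becomes so small that Newton's iteration converges. Stable finiteness enters as follows: [e] = 0
  makes the block sum of e and some projection r equivalent to its subprojection 0 + r, and no
  projection is equivalent to a proper subprojection. Integrality of the slopes is decisive: with
  real slopes \<eta> could be x/2, and composition with it is onto without being one-to-one.\<close>

locale star_ring = ring R for R :: "'a cstar" (structure) +
  assumes star_closed [simp, intro]: "x \<in> carrier R \<Longrightarrow> star R x \<in> carrier R"
    and star_star [simp]: "x \<in> carrier R \<Longrightarrow> star R (star R x) = x"
    and star_add: "\<lbrakk>x \<in> carrier R; y \<in> carrier R\<rbrakk> \<Longrightarrow> star R (x \<oplus> y) = star R x \<oplus> star R y"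
    and star_mult: "\<lbrakk>x \<in> carrier R; y \<in> carrier R\<rbrakk> \<Longrightarrow> star R (x \<otimes> y) = star R y \<otimes> star R x"
begin

lemma star_zero [simp]: "star R \<zero> = \<zero>"
  using star_add[of \<zero> \<zero>] by (metis add.l_cancel_one' r_zero star_closed zero_closed)

lemma star_one [simp]: "star R \<one> = \<one>"
  using star_mult[of \<one> "star R \<one>"] by (metis l_one one_closed r_one star_closed star_star)

lemma star_minus: "x \<in> carrier R \<Longrightarrow> star R (\<ominus> x) = \<ominus> star R x"
  using star_add[of x "\<ominus> x"] by (metis a_inv_closed minus_equality r_neg r_neg2 star_closed star_zero add.m_comm)

lemma star_finsum:
  assumes "finite S" "f \<in> S \<rightarrow> carrier R"
  shows "star R (finsum R f S) = finsum R (\<lambda>k. star R (f k)) S"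
  using assms
proof (induction S rule: finite_induct)
  case (insert k S)
  then have "f k \<in> carrier R" "f \<in> S \<rightarrow> carrier R" "(\<lambda>k. star R (f k)) \<in> S \<rightarrow> carrier R" by auto
  then show ?case using insert by (simp add: finsum_insert star_add finsum_closed)
qed (simp add: finsum_empty)

lemma finsum_swap:
  assumes "finite S" "finite T" "\<And>i j. i \<in> S \<Longrightarrow> j \<in> T \<Longrightarrow> f i j \<in> carrier R"
  shows "(\<Oplus>i\<in>S. \<Oplus>j\<in>T. f i j) = (\<Oplus>j\<in>T. \<Oplus>i\<in>S. f i j)"
  using assms(1,3)
proof (induction S rule: finite_induct)
  case empty
  then show ?case by (simp add: finsum_empty finsum_zero)
next
  case (insert k S)
  have "(\<Oplus>j\<in>T. \<Oplus>i\<in>insert k S. f i j) = (\<Oplus>j\<in>T. f k j \<oplus> (\<Oplus>i\<in>S. f i j))"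
    using insert by (intro finsum_cong' refl) (auto intro!: finsum_insert finsum_closed)
  also have "\<dots> = (\<Oplus>j\<in>T. f k j) \<oplus> (\<Oplus>j\<in>T. \<Oplus>i\<in>S. f i j)"
    using insert by (intro finsum_addf) (auto intro!: finsum_closed)
  finally show ?case
    using insert by (simp add: finsum_insert finsum_closed Pi_iff)
qed

lemma finsum_split:
  fixes n m :: nat
  assumes "\<And>k. k < n + m \<Longrightarrow> f k \<in> carrier R"
  shows "(\<Oplus>k\<in>{..<n + m}. f k) = (\<Oplus>k\<in>{..<n}. f k) \<oplus> (\<Oplus>k\<in>{..<m}. f (n + k))"
  using assms
proof (induction m)
  case 0
  then show ?case by (simp add: finsum_empty finsum_closed Pi_iff)
next
  case (Suc m)
  have "(\<Oplus>k\<in>{..<n + Suc m}. f k) = f (n + m) \<oplus> (\<Oplus>k\<in>{..<n + m}. f k)"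
    using Suc.prems by (simp add: lessThan_Suc finsum_insert Pi_iff)
  also have "\<dots> = f (n + m) \<oplus> ((\<Oplus>k\<in>{..<n}. f k) \<oplus> (\<Oplus>k\<in>{..<m}. f (n + k)))"
    using Suc by simp
  also have "\<dots> = (\<Oplus>k\<in>{..<n}. f k) \<oplus> (f (n + m) \<oplus> (\<Oplus>k\<in>{..<m}. f (n + k)))"
    using Suc.prems by (intro add.m_lcomm finsum_closed) auto
  finally show ?case
    using Suc.prems by (simp add: lessThan_Suc finsum_insert Pi_iff)
qed

lemma finsum_eq_zero: "(\<And>k. k \<in> S \<Longrightarrow> f k = \<zero>) \<Longrightarrow> finsum R f S = \<zero>"
  using finsum_cong'[of S S "\<lambda>_. \<zero>" f] by (simp add: finsum_zero)

end

lemma amatD: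
  assumes "a \<in> amat R m n"
  shows "dim_row a = m" "dim_col a = n" "\<And>i j. i < m \<Longrightarrow> j < n \<Longrightarrow> a $$ (i, j) \<in> carrier R"
  using assms by (auto simp: amat_def)

lemma amatI:
  assumes "dim_row a = m" "dim_col a = n" "\<And>i j. i < m \<Longrightarrow> j < n \<Longrightarrow> a $$ (i, j) \<in> carrier R"
  shows "a \<in> amat R m n"
  using assms by (auto simp: amat_def)

lemma amult_dim [simp]: "dim_row (amult R a b) = dim_row a" "dim_col (amult R a b) = dim_col b"
  by (auto simp: amult_def)

lemma amult_index:
  "i < dim_row a \<Longrightarrow> j < dim_col b \<Longrightarrow>
    amult R a b $$ (i, j) = (\<Oplus>\<^bsub>R\<^esub>k\<in>{..<dim_col a}. a $$ (i, k) \<otimes>\<^bsub>R\<^esub> b $$ (k, j))"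
  by (simp add: amult_def)

lemma aadj_dim [simp]: "dim_row (aadj R a) = dim_col a" "dim_col (aadj R a) = dim_row a"
  by (auto simp: aadj_def)

lemma aadj_index: "i < dim_col a \<Longrightarrow> j < dim_row a \<Longrightarrow> aadj R a $$ (i, j) = star R (a $$ (j, i))"
  by (simp add: aadj_def)

lemma dsum_dim [simp]:
  "dim_row (dsum R a b) = dim_row a + dim_row b" "dim_col (dsum R a b) = dim_col a + dim_col b"
  by (auto simp: dsum_def)

lemma dsum_index:
  "i < dim_row a + dim_row b \<Longrightarrow> j < dim_col a + dim_col b \<Longrightarrow> dsum R a b $$ (i, j) =
    (if i < dim_row a then if j < dim_col a then a $$ (i, j) else \<zero>\<^bsub>R\<^esub>
     else if j < dim_col a then \<zero>\<^bsub>R\<^esub> else b $$ (i - dim_row a, j - dim_col a))"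
  by (auto simp: dsum_def)

text \<open>\<open>offsum A q p\<close> is the partial isometry that interchanges the summands of
  \<open>dsum A p q\<close>.\<close>

definition offsum :: "'a cstar \<Rightarrow> 'a mat \<Rightarrow> 'a mat \<Rightarrow> 'a mat" where
  "offsum A a b = four_block_mat
    (Matrix.mat (dim_row a) (dim_col b) (\<lambda>_. \<zero>\<^bsub>A\<^esub>)) a
    b (Matrix.mat (dim_row b) (dim_col a) (\<lambda>_. \<zero>\<^bsub>A\<^esub>))"

lemma offsum_dim [simp]:
  "dim_row (offsum R a b) = dim_row a + dim_row b" "dim_col (offsum R a b) = dim_col b + dim_col a"
  by (auto simp: offsum_def)

lemma offsum_index:
  "i < dim_row a + dim_row b \<Longrightarrow> j < dim_col b + dim_col a \<Longrightarrow> offsum R a b $$ (i, j) =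
    (if i < dim_row a then if j < dim_col b then \<zero>\<^bsub>R\<^esub> else a $$ (i, j - dim_col b)
     else if j < dim_col b then b $$ (i - dim_row a, j) else \<zero>\<^bsub>R\<^esub>)"
  by (auto simp: offsum_def)

lemma dsum_amat:
  assumes "a \<in> amat R m n" "b \<in> amat R m' n'" "\<zero>\<^bsub>R\<^esub> \<in> carrier R"
  shows "dsum R a b \<in> amat R (m + m') (n + n')"
  using assms by (intro amatI) (auto simp: dsum_index amatD)

lemma offsum_amat:
  assumes "a \<in> amat R m n'" "b \<in> amat R m' n" "\<zero>\<^bsub>R\<^esub> \<in> carrier R"
  shows "offsum R a b \<in> amat R (m + m') (n + n')"
  using assms by (intro amatI) (auto simp: offsum_index amatD)

text \<open>Associativity and, for 0 x 0 matrices, the unit laws hold as equations and not merely up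
  to equivalence; this is what allows block sums to be indexed by lists.\<close>

lemma dsum_assoc: "dsum R (dsum R a b) c = dsum R a (dsum R b c)"
proof (rule eq_matI)
  fix i j assume "i < dim_row (dsum R a (dsum R b c))" "j < dim_col (dsum R a (dsum R b c))"
  then have ij: "i < dim_row a + (dim_row b + dim_row c)" "j < dim_col a + (dim_col b + dim_col c)" by simp_all
  then show "dsum R (dsum R a b) c $$ (i, j) = dsum R a (dsum R b c) $$ (i, j)"
    by (cases "i < dim_row a"; cases "i < dim_row a + dim_row b"; cases "j < dim_col a";
        cases "j < dim_col a + dim_col b"; simp add: dsum_index diff_diff_add less_diff_conv2)
qed auto

lemma dsum_empty [simp]: "dsum R a (Matrix.mat 0 0 f) = a"
  by (rule eq_matI) (auto simp: dsum_index)

lemma dsum_empty_left: "dsum R (Matrix.mat 0 0 f) a = a"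
  by (rule eq_matI) (auto simp: dsum_index)

context star_ring begin

lemma amult_closed [intro]:
  assumes "a \<in> amat R m n" "b \<in> amat R n p"
  shows "amult R a b \<in> amat R m p"
  using assms by (intro amatI) (auto simp: amult_index amatD intro!: finsum_closed)

lemma aadj_closed [intro]: "a \<in> amat R m n \<Longrightarrow> aadj R a \<in> amat R n m"
  by (intro amatI) (auto simp: aadj_index amatD)

lemma aadj_aadj: "a \<in> amat R m n \<Longrightarrow> aadj R (aadj R a) = a"
  by (intro eq_matI) (auto simp: aadj_index amatD)

lemma amult_assoc:
  assumes "a \<in> amat R m n" "b \<in> amat R n p" "c \<in> amat R p q"
  shows "amult R (amult R a b) c = amult R a (amult R b c)"
proof (rule eq_matI)
  note [simp] = amatD[OF assms(1)] amatD[OF assms(2)] amatD[OF assms(3)]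
  fix i j assume "i < dim_row (amult R a (amult R b c))" "j < dim_col (amult R a (amult R b c))"
  then have ij: "i < m" "j < q" by simp_all
  have "amult R (amult R a b) c $$ (i, j) =
      (\<Oplus>k\<in>{..<p}. (\<Oplus>l\<in>{..<n}. a $$ (i, l) \<otimes> b $$ (l, k)) \<otimes> c $$ (k, j))"
    using ij by (simp add: amult_index, intro finsum_cong' refl) (auto simp: amult_index intro!: finsum_closed)
  also have "\<dots> = (\<Oplus>k\<in>{..<p}. (\<Oplus>l\<in>{..<n}. a $$ (i, l) \<otimes> b $$ (l, k) \<otimes> c $$ (k, j)))"
    using ij by (intro finsum_cong' refl finsum_ldistr) (auto intro!: finsum_closed)
  also have "\<dots> = (\<Oplus>l\<in>{..<n}. (\<Oplus>k\<in>{..<p}. a $$ (i, l) \<otimes> b $$ (l, k) \<otimes> c $$ (k, j)))"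
    using ij by (intro finsum_swap) auto
  also have "\<dots> = (\<Oplus>l\<in>{..<n}. (\<Oplus>k\<in>{..<p}. a $$ (i, l) \<otimes> (b $$ (l, k) \<otimes> c $$ (k, j))))"
    using ij by (intro finsum_cong' refl m_assoc) (auto intro!: finsum_closed)
  also have "\<dots> = (\<Oplus>l\<in>{..<n}. a $$ (i, l) \<otimes> (\<Oplus>k\<in>{..<p}. b $$ (l, k) \<otimes> c $$ (k, j)))"
    using ij by (intro finsum_cong' refl finsum_rdistr[symmetric]) (auto intro!: finsum_closed)
  also have "\<dots> = amult R a (amult R b c) $$ (i, j)"
    using ij by (simp add: amult_index, intro finsum_cong' refl) (auto simp: amult_index intro!: finsum_closed)
  finally show "amult R (amult R a b) c $$ (i, j) = amult R a (amult R b c) $$ (i, j)" .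
qed auto

lemma aadj_amult:
  assumes "a \<in> amat R m n" "b \<in> amat R n p"
  shows "aadj R (amult R a b) = amult R (aadj R b) (aadj R a)"
proof (rule eq_matI)
  note [simp] = amatD[OF assms(1)] amatD[OF assms(2)]
  fix i j assume "i < dim_row (amult R (aadj R b) (aadj R a))" "j < dim_col (amult R (aadj R b) (aadj R a))"
  then have ij: "i < p" "j < m" by simp_all
  have "aadj R (amult R a b) $$ (i, j) = star R (\<Oplus>k\<in>{..<n}. a $$ (j, k) \<otimes> b $$ (k, i))"
    using ij by (simp add: aadj_index amult_index)
  also have "\<dots> = (\<Oplus>k\<in>{..<n}. star R (a $$ (j, k) \<otimes> b $$ (k, i)))"
    using ij by (intro star_finsum) auto
  also have "\<dots> = amult R (aadj R b) (aadj R a) $$ (i, j)"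
    using ij by (simp add: amult_index, intro finsum_cong' refl) (auto simp: aadj_index star_mult)
  finally show "aadj R (amult R a b) $$ (i, j) = amult R (aadj R b) (aadj R a) $$ (i, j)" .
qed auto

lemma aadj_dsum: "aadj R (dsum R a b) = dsum R (aadj R a) (aadj R b)"
  by (rule eq_matI) (auto simp: aadj_index dsum_index)

lemma aadj_offsum: "aadj R (offsum R a b) = offsum R (aadj R b) (aadj R a)"
  by (rule eq_matI) (auto simp: aadj_index offsum_index)

lemma amult_dsum:
  assumes "a \<in> amat R m n" "b \<in> amat R m' n'" "c \<in> amat R n p" "d \<in> amat R n' p'"
  shows "amult R (dsum R a b) (dsum R c d) = dsum R (amult R a c) (amult R b d)"
proof (rule eq_matI)
  note [simp] = amatD[OF assms(1)] amatD[OF assms(2)] amatD[OF assms(3)] amatD[OF assms(4)]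
  fix i j assume "i < dim_row (dsum R (amult R a c) (amult R b d))" "j < dim_col (dsum R (amult R a c) (amult R b d))"
  then have ij: "i < m + m'" "j < p + p'" by simp_all
  let ?f = "\<lambda>k. dsum R a b $$ (i, k) \<otimes> dsum R c d $$ (k, j)"
  have "amult R (dsum R a b) (dsum R c d) $$ (i, j) = (\<Oplus>k\<in>{..<n + n'}. ?f k)"
    using ij by (simp add: amult_index)
  also have "\<dots> = (\<Oplus>k\<in>{..<n}. ?f k) \<oplus> (\<Oplus>k\<in>{..<n'}. ?f (n + k))"
    using ij by (intro finsum_split) (auto simp: dsum_index)
  also have "(\<Oplus>k\<in>{..<n}. ?f k) =
      (if i < m \<and> j < p then (\<Oplus>k\<in>{..<n}. a $$ (i, k) \<otimes> c $$ (k, j)) else \<zero>)"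
    using ij by (auto simp: dsum_index intro!: finsum_eq_zero finsum_cong')
  also have "(\<Oplus>k\<in>{..<n'}. ?f (n + k)) =
      (if m \<le> i \<and> p \<le> j then (\<Oplus>k\<in>{..<n'}. b $$ (i - m, k) \<otimes> d $$ (k, j - p)) else \<zero>)"
    using ij by (auto simp: dsum_index intro!: finsum_eq_zero finsum_cong')
  finally show "amult R (dsum R a b) (dsum R c d) $$ (i, j) = dsum R (amult R a c) (amult R b d) $$ (i, j)"
    using ij by (auto simp: dsum_index amult_index not_less intro!: r_zero l_zero finsum_closed)
qed (use assms in \<open>auto simp: amatD\<close>)

lemma amult_offsum:
  assumes "a \<in> amat R m n'" "b \<in> amat R m' n" "c \<in> amat R n p'" "d \<in> amat R n' p"
  shows "amult R (offsum R a b) (offsum R c d) = dsum R (amult R a d) (amult R b c)"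
proof (rule eq_matI)
  note [simp] = amatD[OF assms(1)] amatD[OF assms(2)] amatD[OF assms(3)] amatD[OF assms(4)]
  fix i j assume "i < dim_row (dsum R (amult R a d) (amult R b c))" "j < dim_col (dsum R (amult R a d) (amult R b c))"
  then have ij: "i < m + m'" "j < p + p'" by simp_all
  let ?f = "\<lambda>k. offsum R a b $$ (i, k) \<otimes> offsum R c d $$ (k, j)"
  have "amult R (offsum R a b) (offsum R c d) $$ (i, j) = (\<Oplus>k\<in>{..<n + n'}. ?f k)"
    using ij by (simp add: amult_index)
  also have "\<dots> = (\<Oplus>k\<in>{..<n}. ?f k) \<oplus> (\<Oplus>k\<in>{..<n'}. ?f (n + k))"
    using ij by (intro finsum_split) (auto simp: offsum_index)
  also have "(\<Oplus>k\<in>{..<n}. ?f k) =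
      (if m \<le> i \<and> p \<le> j then (\<Oplus>k\<in>{..<n}. b $$ (i - m, k) \<otimes> c $$ (k, j - p)) else \<zero>)"
    using ij by (auto simp: offsum_index intro!: finsum_eq_zero finsum_cong')
  also have "(\<Oplus>k\<in>{..<n'}. ?f (n + k)) =
      (if i < m \<and> j < p then (\<Oplus>k\<in>{..<n'}. a $$ (i, k) \<otimes> d $$ (k, j)) else \<zero>)"
    using ij by (auto simp: offsum_index intro!: finsum_eq_zero finsum_cong')
  finally show "amult R (offsum R a b) (offsum R c d) $$ (i, j) = dsum R (amult R a d) (amult R b c) $$ (i, j)"
    using ij by (auto simp: dsum_index amult_index not_less intro!: r_zero l_zero finsum_closed)
qed (use assms in \<open>auto simp: amatD\<close>)

section \<open>Murray-von Neumann equivalence and \<open>K\<^sub>0\<close>\<close>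

lemma projectionsD:
  assumes "p \<in> projections R"
  shows "p \<in> amat R (dim_row p) (dim_row p)" "aadj R p = p" "amult R p p = p"
  using assms by (auto simp: projections_def amat_def)

lemma projectionsI: "p \<in> amat R n n \<Longrightarrow> aadj R p = p \<Longrightarrow> amult R p p = p \<Longrightarrow> p \<in> projections R"
  by (auto simp: projections_def)

lemma dsum_projections:
  assumes "p \<in> projections R" "q \<in> projections R"
  shows "dsum R p q \<in> projections R"
proof (rule projectionsI)
  note p = projectionsD[OF assms(1)] and q = projectionsD[OF assms(2)]
  show "dsum R p q \<in> amat R (dim_row p + dim_row q) (dim_row p + dim_row q)"
    using p(1) q(1) by (intro dsum_amat) auto
  show "aadj R (dsum R p q) = dsum R p q" using p q by (simp add: aadj_dsum)
  show "amult R (dsum R p q) (dsum R p q) = dsum R p q"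
    using amult_dsum[OF p(1) q(1) p(1) q(1)] p q by simp
qed

lemma mvn_refl: "p \<in> projections R \<Longrightarrow> mvn_equiv R p p"
  using projectionsD[of p] unfolding mvn_equiv_def by (intro bexI[of _ p]) auto

lemma mvn_sym:
  assumes "mvn_equiv R p q"
  shows "mvn_equiv R q p"
proof -
  obtain v where "v \<in> amat R (dim_row q) (dim_row p)" "p = amult R (aadj R v) v" "q = amult R v (aadj R v)"
    using assms unfolding mvn_equiv_def by blast
  then show ?thesis unfolding mvn_equiv_def
    by (intro bexI[of _ "aadj R v"]) (auto simp: aadj_aadj)
qed

text \<open>The composite \<open>w v\<close> works because star v (star w w) v = star v (v star v) v
  = p p. Idempotency of \<open>p\<close> and \<open>r\<close> thus takes the place of v = v (star v)
  v, which would come from the C*-identity.\<close>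

lemma mvn_trans:
  assumes "mvn_equiv R p q" "mvn_equiv R q r" "p \<in> projections R" "r \<in> projections R"
  shows "mvn_equiv R p r"
proof -
  obtain v where v: "v \<in> amat R (dim_row q) (dim_row p)" "p = amult R (aadj R v) v" "q = amult R v (aadj R v)"
    using assms unfolding mvn_equiv_def by blast
  obtain w where w: "w \<in> amat R (dim_row r) (dim_row q)" "q = amult R (aadj R w) w" "r = amult R w (aadj R w)"
    using assms unfolding mvn_equiv_def by blast
  have v': "aadj R v \<in> amat R (dim_row p) (dim_row q)" and w': "aadj R w \<in> amat R (dim_row q) (dim_row r)"
    using v(1) w(1) by auto
  have q: "q \<in> amat R (dim_row q) (dim_row q)" using v(1,3) v' by (metis amult_closed)
  have p: "p \<in> amat R (dim_row p) (dim_row p)" using projectionsD assms(3) by blast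
  have r: "r \<in> amat R (dim_row r) (dim_row r)" using projectionsD assms(4) by blast
  have wv: "amult R w v \<in> amat R (dim_row r) (dim_row p)" using w v by blast
  have adj: "aadj R (amult R w v) = amult R (aadj R v) (aadj R w)" using aadj_amult w v by blast
  have v'v: "amult R (aadj R v) v \<in> amat R (dim_row p) (dim_row p)" using v(1) v' by blast
  have ww': "amult R w (aadj R w) \<in> amat R (dim_row r) (dim_row r)" using w(1) w' by blast
  have v'w': "amult R (aadj R v) (aadj R w) \<in> amat R (dim_row p) (dim_row r)" using v' w' by blast
  have "amult R (aadj R (amult R w v)) (amult R w v) = amult R (aadj R v) (amult R (amult R (aadj R w) w) v)"
    unfolding adj amult_assoc[OF v' w' wv] amult_assoc[OF w' w(1) v(1)] ..
  also have "\<dots> = amult R (aadj R v) (amult R (amult R v (aadj R v)) v)"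
    using w(2) v(3) by metis
  also have "\<dots> = amult R (amult R (aadj R v) v) (amult R (aadj R v) v)"
    unfolding amult_assoc[OF v(1) v' v(1)] amult_assoc[OF v' v(1) v'v] ..
  also have "\<dots> = p" using v(2) projectionsD(3)[OF assms(3)] by metis
  finally have 1: "p = amult R (aadj R (amult R w v)) (amult R w v)" ..
  have "amult R (amult R w v) (aadj R (amult R w v)) = amult R w (amult R (amult R v (aadj R v)) (aadj R w))"
    unfolding adj amult_assoc[OF w(1) v(1) v'w'] amult_assoc[OF v(1) v' w'] ..
  also have "\<dots> = amult R w (amult R (amult R (aadj R w) w) (aadj R w))"
    using w(2) v(3) by metis
  also have "\<dots> = amult R (amult R w (aadj R w)) (amult R w (aadj R w))"
    unfolding amult_assoc[OF w' w(1) w'] amult_assoc[OF w(1) w' ww'] ..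
  also have "\<dots> = r" using w(3) projectionsD(3)[OF assms(4)] by metis
  finally have 2: "r = amult R (amult R w v) (aadj R (amult R w v))" ..
  show ?thesis unfolding mvn_equiv_def using wv 1 2 by blast
qed

lemma mvn_dsum:
  assumes "mvn_equiv R p q" "mvn_equiv R p' q'"
  shows "mvn_equiv R (dsum R p p') (dsum R q q')"
proof -
  obtain v where v: "v \<in> amat R (dim_row q) (dim_row p)" "p = amult R (aadj R v) v" "q = amult R v (aadj R v)"
    using assms unfolding mvn_equiv_def by blast
  obtain w where w: "w \<in> amat R (dim_row q') (dim_row p')" "p' = amult R (aadj R w) w" "q' = amult R w (aadj R w)"
    using assms unfolding mvn_equiv_def by blast
  have v': "aadj R v \<in> amat R (dim_row p) (dim_row q)" and w': "aadj R w \<in> amat R (dim_row p') (dim_row q')"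
    using v(1) w(1) by auto
  show ?thesis unfolding mvn_equiv_def
  proof (intro bexI conjI)
    show "dsum R v w \<in> amat R (dim_row (dsum R q q')) (dim_row (dsum R p p'))"
      using dsum_amat[OF v(1) w(1)] by simp
    show "dsum R p p' = amult R (aadj R (dsum R v w)) (dsum R v w)"
      unfolding aadj_dsum amult_dsum[OF v' w' v(1) w(1)] using v w by simp
    show "dsum R q q' = amult R (dsum R v w) (aadj R (dsum R v w))"
      unfolding aadj_dsum amult_dsum[OF v(1) w(1) v' w'] using v w by simp
  qed
qed

lemma mvn_dsum_comm:
  assumes "p \<in> projections R" "q \<in> projections R"
  shows "mvn_equiv R (dsum R p q) (dsum R q p)"
proof -
  note p = projectionsD[OF assms(1)] and q = projectionsD[OF assms(2)]
  show ?thesis unfolding mvn_equiv_def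
  proof (intro bexI conjI)
    show "offsum R q p \<in> amat R (dim_row (dsum R q p)) (dim_row (dsum R p q))"
      using offsum_amat[OF q(1) p(1)] by simp
    show "dsum R p q = amult R (aadj R (offsum R q p)) (offsum R q p)"
      unfolding aadj_offsum p q using amult_offsum[OF p(1) q(1) q(1) p(1)] p q by simp
    show "dsum R q p = amult R (offsum R q p) (aadj R (offsum R q p))"
      unfolding aadj_offsum p q using amult_offsum[OF q(1) p(1) p(1) q(1)] p q by simp
  qed
qed

section \<open>Block sums of lists of projections, up to order\<close>

definition dsums :: "'a mat list \<Rightarrow> 'a mat" where
  "dsums ps = foldr (dsum R) ps (Matrix.mat 0 0 (\<lambda>_. \<zero>))"

lemma dsums_Nil: "dsums [] = Matrix.mat 0 0 (\<lambda>_. \<zero>)"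
  and dsums_Cons: "dsums (p # ps) = dsum R p (dsums ps)"
  by (auto simp: dsums_def)

lemma dsums_append: "dsums (ps @ qs) = dsum R (dsums ps) (dsums qs)"
  by (induction ps) (auto simp: dsums_Nil dsums_Cons dsum_assoc dsum_empty_left)

lemma empty_projection: "Matrix.mat 0 0 f \<in> projections R"
  by (rule projectionsI[of _ 0]) (auto intro!: amatI eq_matI)

lemma dsums_projections: "set ps \<subseteq> projections R \<Longrightarrow> dsums ps \<in> projections R"
  by (induction ps) (auto simp: dsums_Nil dsums_Cons dsum_projections empty_projection)

text \<open>Turns the rearrangements in the group laws of K_0 into equalities of multisets. In the
  induction the head of the first list is located in the second and moved past the prefix
  \<open>xs\<close> by one transposition.\<close>

lemma mvn_dsums_mset:
  assumes "mset ps = mset qs" "set ps \<subseteq> projections R"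
  shows "mvn_equiv R (dsums ps) (dsums qs)"
  using assms
proof (induction ps arbitrary: qs)
  case Nil
  then show ?case by (simp add: mvn_refl dsums_projections)
next
  case (Cons p ps)
  then have "p \<in> set qs" by (metis list.set_intros(1) set_mset_mset)
  then obtain xs ys where qs: "qs = xs @ p # ys" by (meson split_list)
  have sets: "set xs \<subseteq> projections R" "set ys \<subseteq> projections R" "p \<in> projections R" "set ps \<subseteq> projections R"
    using Cons.prems(2) mset_eq_setD[OF Cons.prems(1)] qs by auto
  have "mset ps = mset (xs @ ys)" using Cons.prems(1) qs by simp
  then have "mvn_equiv R (dsums ps) (dsums (xs @ ys))" using Cons.IH sets by blast
  then have 1: "mvn_equiv R (dsums (p # ps)) (dsum R (dsum R p (dsums xs)) (dsums ys))"
    using mvn_dsum[OF mvn_refl[OF sets(3)]] by (simp add: dsums_Cons dsums_append dsum_assoc)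
  have 2: "mvn_equiv R (dsum R (dsum R p (dsums xs)) (dsums ys)) (dsum R (dsum R (dsums xs) p) (dsums ys))"
    using sets by (intro mvn_dsum mvn_dsum_comm mvn_refl dsums_projections)
  have "dsums qs = dsum R (dsum R (dsums xs) p) (dsums ys)"
    by (simp add: qs dsums_append dsums_Cons dsum_assoc)
  then show ?case
    using mvn_trans[OF 1 2] sets
    by (simp add: dsums_Cons dsum_projections dsums_projections)
qed

lemma dsum3_eq_dsums: "dsum R (dsum R p q) r = dsums [p, q, r]"
  by (simp add: dsums_Cons dsums_Nil dsum_assoc)

lemma K0_rel_iff:
  "((p, q), (p', q')) \<in> K0_rel R \<longleftrightarrow>
    p \<in> projections R \<and> q \<in> projections R \<and> p' \<in> projections R \<and> q' \<in> projections R \<and>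
    (\<exists>r \<in> projections R. mvn_equiv R (dsums [p, q', r]) (dsums [p', q, r]))"
  by (simp add: K0_rel_def dsum3_eq_dsums)

lemma equiv_K0_rel: "equiv (projections R \<times> projections R) (K0_rel R)"
proof (rule equivI)
  show "K0_rel R \<subseteq> (projections R \<times> projections R) \<times> (projections R \<times> projections R)"
    by (auto simp: K0_rel_def)
  show "refl_on (projections R \<times> projections R) (K0_rel R)"
    by (rule refl_onI) (auto simp: K0_rel_iff empty_projection intro!: bexI[OF _ empty_projection[of "\<lambda>_. \<zero>"]] mvn_refl dsums_projections)
  show "sym (K0_rel R)"
    by (rule symI) (auto simp: K0_rel_iff, use mvn_sym in blast)
  show "trans (K0_rel R)"
  proof (rule transI, clarify)
    fix p q p' q' p'' q''
    assume A: "((p, q), (p', q')) \<in> K0_rel R" "((p', q'), (p'', q'')) \<in> K0_rel R"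
    then have P: "p \<in> projections R" "q \<in> projections R" "p' \<in> projections R" "q' \<in> projections R"
      "p'' \<in> projections R" "q'' \<in> projections R"
      by (auto simp: K0_rel_iff)
    obtain r where r: "r \<in> projections R" "mvn_equiv R (dsums [p, q', r]) (dsums [p', q, r])"
      using A(1) by (auto simp: K0_rel_iff)
    obtain s where s: "s \<in> projections R" "mvn_equiv R (dsums [p', q'', s]) (dsums [p'', q', s])"
      using A(2) by (auto simp: K0_rel_iff)
    \<comment> \<open>Adding the two given equivalences leaves q', p', r and s as surplus on both
      sides; that surplus is the stabilising summand.\<close>
    define t where "t = dsums [q', p', r, s]"
    have t: "t \<in> projections R" unfolding t_def using P r s by (intro dsums_projections) auto
    have exp: "dsums [x, y, t] = dsums [x, y, q', p', r, s]" for x y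
      by (simp add: t_def dsums_Cons dsums_Nil dsum_assoc)
    have app: "dsum R (dsums [a, b, c]) (dsums [d, e, f]) = dsums [a, b, c, d, e, f]" for a b c d e f
      by (simp add: dsums_Cons dsums_Nil dsum_assoc)
    have "mvn_equiv R (dsums [p, q'', q', p', r, s]) (dsums [p, q', r, p', q'', s])"
      using P r s by (intro mvn_dsums_mset) auto
    moreover have "mvn_equiv R (dsums [p, q', r, p', q'', s]) (dsums [p', q, r, p'', q', s])"
      using mvn_dsum[OF r(2) s(2)] by (simp only: app)
    moreover have "mvn_equiv R (dsums [p', q, r, p'', q', s]) (dsums [p'', q, q', p', r, s])"
      using P r s by (intro mvn_dsums_mset) auto
    moreover have "set [p, q'', q', p', r, s] \<subseteq> projections R" "set [p', q, r, p'', q', s] \<subseteq> projections R"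
      "set [p'', q, q', p', r, s] \<subseteq> projections R"
      using P r s by auto
    ultimately have "mvn_equiv R (dsums [p, q'', t]) (dsums [p'', q, t])"
      unfolding exp by (meson mvn_trans dsums_projections)
    then show "((p, q), (p'', q'')) \<in> K0_rel R" using P t by (auto simp: K0_rel_iff)
  qed
qed

lemma K0_class_eq_iff:
  assumes "p \<in> projections R" "q \<in> projections R" "p' \<in> projections R" "q' \<in> projections R"
  shows "K0_class R p q = K0_class R p' q' \<longleftrightarrow> ((p, q), (p', q')) \<in> K0_rel R"
  unfolding K0_class_def using eq_equiv_class_iff[OF equiv_K0_rel] assms by simp

lemma zero_proj_projection: "zero_proj R \<in> projections R"
  and unit_proj_projection: "unit_proj R \<in> projections R"
  by (rule projectionsI[of _ 1];
      auto simp: zero_proj_def unit_proj_def amult_index aadj_index lessThan_Suc finsum_insert finsum_empty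
        intro!: amatI eq_matI)+

lemma K0_class_in_carrier:
  "p \<in> projections R \<Longrightarrow> q \<in> projections R \<Longrightarrow> K0_class R p q \<in> carrier (K0 R)"
  unfolding K0_def K0_class_def by (auto intro: quotientI)

lemma K0_carrierE:
  assumes "X \<in> carrier (K0 R)"
  obtains p q where "p \<in> projections R" "q \<in> projections R" "X = K0_class R p q"
  using assms unfolding K0_def K0_class_def by (auto elim!: quotientE)

end

section \<open>Homomorphisms of rings with involution\<close>

locale star_hom = A: star_ring A + B: star_ring B for A :: "'a cstar" and B :: "'b cstar" +
  fixes h :: "'a \<Rightarrow> 'b"
  assumes h_hom: "h \<in> Ring.ring_hom A B"
    and h_star: "x \<in> carrier A \<Longrightarrow> h (star A x) = star B (h x)"
begin

lemma h_closed [simp, intro]: "x \<in> carrier A \<Longrightarrow> h x \<in> carrier B"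
  and h_mult: "\<lbrakk>x \<in> carrier A; y \<in> carrier A\<rbrakk> \<Longrightarrow> h (x \<otimes>\<^bsub>A\<^esub> y) = h x \<otimes>\<^bsub>B\<^esub> h y"
  and h_add: "\<lbrakk>x \<in> carrier A; y \<in> carrier A\<rbrakk> \<Longrightarrow> h (x \<oplus>\<^bsub>A\<^esub> y) = h x \<oplus>\<^bsub>B\<^esub> h y"
  and h_one [simp]: "h \<one>\<^bsub>A\<^esub> = \<one>\<^bsub>B\<^esub>"
  using h_hom by (auto simp: ring_hom_def)

lemma h_zero [simp]: "h \<zero>\<^bsub>A\<^esub> = \<zero>\<^bsub>B\<^esub>"
  using h_add[of "\<zero>\<^bsub>A\<^esub>" "\<zero>\<^bsub>A\<^esub>"] by (metis A.l_zero A.zero_closed B.add.l_cancel_one' h_closed)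

lemma h_finsum:
  assumes "finite S" "f \<in> S \<rightarrow> carrier A"
  shows "h (finsum A f S) = finsum B (\<lambda>k. h (f k)) S"
  using assms
proof (induction S rule: finite_induct)
  case (insert k S)
  then have "f k \<in> carrier A" "f \<in> S \<rightarrow> carrier A" "(\<lambda>k. h (f k)) \<in> S \<rightarrow> carrier B" by auto
  then show ?case using insert by (simp add: A.finsum_insert B.finsum_insert h_add A.finsum_closed)
qed (simp add: A.finsum_empty B.finsum_empty)

lemma map_mat_closed: "a \<in> amat A m n \<Longrightarrow> map_mat h a \<in> amat B m n"
  by (intro amatI) (auto simp: amatD)

lemma map_mat_amult:
  assumes "a \<in> amat A m n" "b \<in> amat A n p"
  shows "map_mat h (amult A a b) = amult B (map_mat h a) (map_mat h b)"
proof (rule eq_matI)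
  note [simp] = amatD[OF assms(1)] amatD[OF assms(2)]
  fix i j assume "i < dim_row (amult B (map_mat h a) (map_mat h b))" "j < dim_col (amult B (map_mat h a) (map_mat h b))"
  then have ij: "i < m" "j < p" by simp_all
  have "map_mat h (amult A a b) $$ (i, j) = h (\<Oplus>\<^bsub>A\<^esub>k\<in>{..<n}. a $$ (i, k) \<otimes>\<^bsub>A\<^esub> b $$ (k, j))"
    using ij by (simp add: amult_index)
  also have "\<dots> = (\<Oplus>\<^bsub>B\<^esub>k\<in>{..<n}. h (a $$ (i, k) \<otimes>\<^bsub>A\<^esub> b $$ (k, j)))"
    using ij by (intro h_finsum) auto
  also have "\<dots> = amult B (map_mat h a) (map_mat h b) $$ (i, j)"
    using ij by (simp add: amult_index, intro B.finsum_cong' refl) (auto simp: h_mult)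
  finally show "map_mat h (amult A a b) $$ (i, j) = amult B (map_mat h a) (map_mat h b) $$ (i, j)" .
qed auto

lemma map_mat_aadj: "a \<in> amat A m n \<Longrightarrow> map_mat h (aadj A a) = aadj B (map_mat h a)"
  by (intro eq_matI) (auto simp: aadj_index amatD h_star)

lemma map_mat_dsum: "map_mat h (dsum A a b) = dsum B (map_mat h a) (map_mat h b)"
  by (intro eq_matI) (auto simp: dsum_index)

lemma map_mat_projections:
  assumes "p \<in> projections A"
  shows "map_mat h p \<in> projections B"
proof -
  note p = A.projectionsD[OF assms]
  show ?thesis
    using map_mat_closed[OF p(1)] map_mat_amult[OF p(1) p(1)] map_mat_aadj[OF p(1)] p
    by (intro B.projectionsI) auto
qed

lemma map_mat_mvn:
  assumes "mvn_equiv A p q"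
  shows "mvn_equiv B (map_mat h p) (map_mat h q)"
proof -
  obtain v where v: "v \<in> amat A (dim_row q) (dim_row p)" "p = amult A (aadj A v) v" "q = amult A v (aadj A v)"
    using assms unfolding mvn_equiv_def by blast
  show ?thesis unfolding mvn_equiv_def
  proof (intro bexI conjI)
    show "map_mat h v \<in> amat B (dim_row (map_mat h q)) (dim_row (map_mat h p))"
      using map_mat_closed[OF v(1)] by simp
    show "map_mat h p = amult B (aadj B (map_mat h v)) (map_mat h v)"
      using map_mat_amult[OF A.aadj_closed[OF v(1)] v(1)] map_mat_aadj[OF v(1)] v(2) by simp
    show "map_mat h q = amult B (map_mat h v) (aadj B (map_mat h v))"
      using map_mat_amult[OF v(1) A.aadj_closed[OF v(1)]] map_mat_aadj[OF v(1)] v(3) by simp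
  qed
qed

lemma map_mat_K0_rel:
  assumes "((p, q), (p', q')) \<in> K0_rel A"
  shows "((map_mat h p, map_mat h q), (map_mat h p', map_mat h q')) \<in> K0_rel B"
proof -
  obtain r where "r \<in> projections A" "mvn_equiv A (dsum A (dsum A p q') r) (dsum A (dsum A p' q) r)"
    using assms by (auto simp: K0_rel_def)
  then have "map_mat h r \<in> projections B"
    "mvn_equiv B (dsum B (dsum B (map_mat h p) (map_mat h q')) (map_mat h r))
       (dsum B (dsum B (map_mat h p') (map_mat h q)) (map_mat h r))"
    using map_mat_mvn by (auto simp: map_mat_dsum[symmetric] map_mat_projections)
  then show ?thesis using assms map_mat_projections by (auto simp: K0_rel_def)
qed

text \<open>\<open>K0_map\<close> takes a union over all representatives of a class; the union
  collapses because related pairs have related images.\<close>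

lemma K0_map_class:
  assumes "p \<in> projections A" "q \<in> projections A"
  shows "K0_map B h (K0_class A p q) = K0_class B (map_mat h p) (map_mat h q)"
proof -
  have in_cl: "(p, q) \<in> K0_class A p q"
    unfolding K0_class_def using assms by (intro equiv_class_self[OF A.equiv_K0_rel]) auto
  have *: "K0_class B (map_mat h p') (map_mat h q') = K0_class B (map_mat h p) (map_mat h q)"
    if "(p', q') \<in> K0_class A p q" for p' q'
  proof -
    have rel: "((p, q), (p', q')) \<in> K0_rel A" using that by (simp add: K0_class_def)
    then have "p' \<in> projections A" "q' \<in> projections A" by (auto simp: K0_rel_def)
    then show ?thesis
      using B.K0_class_eq_iff map_mat_projections map_mat_K0_rel[OF rel] assms by metis
  qed
  have "K0_map B h (K0_class A p q) = (\<Union>x\<in>K0_class A p q. K0_class B (map_mat h p) (map_mat h q))"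
    unfolding K0_map_def by (intro SUP_cong refl) (clarsimp simp only: prod.case *)
  then show ?thesis using in_cl by blast
qed

end

section \<open>Complete normed algebras with involution\<close>

text \<open>The C*-identity is left out because it is not available for the entrywise norm on
  matrices.\<close>

locale normed_star_algebra = star_ring R for R :: "'a cstar" (structure) +
  assumes complex_module: "Module.module complex_ring R"
    and smult_mult_left:
      "\<lbrakk>x \<in> carrier R; y \<in> carrier R\<rbrakk> \<Longrightarrow> (c \<odot> x) \<otimes> y = c \<odot> (x \<otimes> y)"
    and smult_mult_right:
      "\<lbrakk>x \<in> carrier R; y \<in> carrier R\<rbrakk> \<Longrightarrow> x \<otimes> (c \<odot> y) = c \<odot> (x \<otimes> y)"
    and star_smult: "x \<in> carrier R \<Longrightarrow> star R (c \<odot> x) = cnj c \<odot> star R x"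
    and cnorm_nonneg: "x \<in> carrier R \<Longrightarrow> 0 \<le> cnorm R x"
    and cnorm_eq_0: "x \<in> carrier R \<Longrightarrow> cnorm R x = 0 \<longleftrightarrow> x = \<zero>"
    and cnorm_smult: "x \<in> carrier R \<Longrightarrow> cnorm R (c \<odot> x) = cmod c * cnorm R x"
    and cnorm_triangle:
      "\<lbrakk>x \<in> carrier R; y \<in> carrier R\<rbrakk> \<Longrightarrow> cnorm R (x \<oplus> y) \<le> cnorm R x + cnorm R y"
    and cnorm_mult:
      "\<lbrakk>x \<in> carrier R; y \<in> carrier R\<rbrakk> \<Longrightarrow> cnorm R (x \<otimes> y) \<le> cnorm R x * cnorm R y"
    and cnorm_star: "x \<in> carrier R \<Longrightarrow> cnorm R (star R x) = cnorm R x"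
begin

lemma smult_closed [simp, intro]: "x \<in> carrier R \<Longrightarrow> c \<odot> x \<in> carrier R"
  using module.smult_closed[OF complex_module] by (simp add: complex_ring_def)

lemma smult_l_distr: "x \<in> carrier R \<Longrightarrow> (c + d) \<odot> x = c \<odot> x \<oplus> d \<odot> x"
  using module.smult_l_distr[OF complex_module] by (simp add: complex_ring_def)

lemma smult_r_distr: "\<lbrakk>x \<in> carrier R; y \<in> carrier R\<rbrakk> \<Longrightarrow> c \<odot> (x \<oplus> y) = c \<odot> x \<oplus> c \<odot> y"
  using module.smult_r_distr[OF complex_module] by (simp add: complex_ring_def)

lemma smult_smult: "x \<in> carrier R \<Longrightarrow> c \<odot> (d \<odot> x) = (c * d) \<odot> x"
  using module.smult_assoc1[OF complex_module] by (simp add: complex_ring_def)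

lemma smult_one [simp]: "x \<in> carrier R \<Longrightarrow> 1 \<odot> x = x"
  using module.smult_one[OF complex_module] by (simp add: complex_ring_def)

lemma smult_zero_left [simp]: "x \<in> carrier R \<Longrightarrow> 0 \<odot> x = \<zero>"
  using smult_l_distr[of x 0 0] by (metis add.l_cancel_one' add_0 smult_closed)

lemma smult_zero_right [simp]: "c \<odot> \<zero> = \<zero>"
  using smult_smult[of \<one> c 0] by simp

lemma minus_eq_smult: "x \<in> carrier R \<Longrightarrow> \<ominus> x = (-1) \<odot> x"
  using smult_l_distr[of x "-1" 1] by (simp add: minus_equality)

lemma cnorm_zero [simp]: "cnorm R \<zero> = 0"
  using cnorm_eq_0 by blast

lemma cnorm_uminus [simp]: "x \<in> carrier R \<Longrightarrow> cnorm R (\<ominus> x) = cnorm R x"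
  by (simp add: minus_eq_smult cnorm_smult)

lemma cnorm_le_zeroD: "\<lbrakk>cnorm R x \<le> 0; x \<in> carrier R\<rbrakk> \<Longrightarrow> x = \<zero>"
  by (metis cnorm_eq_0 cnorm_nonneg order_antisym)

lemma minus_mult_left:
  "\<lbrakk>x \<in> carrier R; y \<in> carrier R; z \<in> carrier R\<rbrakk> \<Longrightarrow> (x \<ominus> y) \<otimes> z = x \<otimes> z \<ominus> y \<otimes> z"
  by (simp add: minus_eq l_distr l_minus)

lemma minus_mult_right:
  "\<lbrakk>x \<in> carrier R; y \<in> carrier R; z \<in> carrier R\<rbrakk> \<Longrightarrow> z \<otimes> (x \<ominus> y) = z \<otimes> x \<ominus> z \<otimes> y"
  by (simp add: minus_eq r_distr r_minus)

lemma star_diff: "\<lbrakk>x \<in> carrier R; y \<in> carrier R\<rbrakk> \<Longrightarrow> star R (x \<ominus> y) = star R x \<ominus> star R y"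
  by (simp add: minus_eq star_add star_minus)

lemma diff_split:
  "\<lbrakk>x \<in> carrier R; y \<in> carrier R; z \<in> carrier R\<rbrakk> \<Longrightarrow> x \<ominus> z = (x \<ominus> y) \<oplus> (y \<ominus> z)"
  by (simp add: minus_eq a_assoc r_neg1)

lemma diff_add_cancel: "\<lbrakk>x \<in> carrier R; y \<in> carrier R\<rbrakk> \<Longrightarrow> (x \<ominus> y) \<oplus> y = x"
  by (simp add: minus_eq a_assoc l_neg)

lemma minus_eq_zero_iff:
  assumes "x \<in> carrier R" "y \<in> carrier R"
  shows "x \<ominus> y = \<zero> \<longleftrightarrow> x = y"
proof
  assume "x \<ominus> y = \<zero>"
  then show "x = y" using diff_add_cancel[OF assms] assms by simp
qed (use assms in \<open>simp add: minus_eq r_neg\<close>)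

lemma minus_minus_swap: "\<lbrakk>x \<in> carrier R; y \<in> carrier R\<rbrakk> \<Longrightarrow> \<ominus> (x \<ominus> y) = y \<ominus> x"
  by (simp add: minus_eq minus_add a_comm)

lemma cnorm_diff_commute: "\<lbrakk>x \<in> carrier R; y \<in> carrier R\<rbrakk> \<Longrightarrow> cnorm R (x \<ominus> y) = cnorm R (y \<ominus> x)"
  by (metis cnorm_uminus minus_closed minus_minus_swap)

lemma cnorm_diff_triangle:
  assumes "x \<in> carrier R" "y \<in> carrier R" "z \<in> carrier R"
  shows "cnorm R (x \<ominus> z) \<le> cnorm R (x \<ominus> y) + cnorm R (y \<ominus> z)"
  using diff_split[OF assms] cnorm_triangle[of "x \<ominus> y" "y \<ominus> z"] assms by simp

lemma cnorm_le_diff_add: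
  assumes "x \<in> carrier R" "y \<in> carrier R"
  shows "cnorm R x \<le> cnorm R (x \<ominus> y) + cnorm R y"
  using diff_add_cancel[OF assms] cnorm_triangle[of "x \<ominus> y" y] assms by simp

lemma cnorm_diff_le:
  assumes "x \<in> carrier R" "y \<in> carrier R"
  shows "cnorm R (x \<ominus> y) \<le> cnorm R x + cnorm R y"
  using cnorm_triangle[of x "\<ominus> y"] assms by (simp add: minus_eq)

lemma eq_zeroI:
  assumes "x \<in> carrier R" "c < 1" "cnorm R x \<le> c * cnorm R x"
  shows "x = \<zero>"
proof -
  have "(1 - c) * cnorm R x \<le> 0" using assms(3) by (simp add: algebra_simps)
  then have "cnorm R x \<le> 0" using assms(2) by (simp add: mult_le_0_iff)
  then show ?thesis using cnorm_le_zeroD assms(1) by blast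
qed

end

text \<open>The Bezout identity for X and a polynomial a + X r with a nonzero. Evaluated where a + X
  r vanishes, it makes -r/a an inverse of X.\<close>

lemma poly_unit_split:
  fixes a :: complex
  assumes "a \<noteq> 0"
  shows "1 = Polynomial.smult (1 / a) (pCons a r) + pCons 0 (Polynomial.smult (- 1 / a) r)"
  using assms by (simp add: one_pCons)

text \<open>Newton's iteration \<open>z \<mapsto> 3 z\<^sup>2 - 2 z\<^sup>3\<close> for the equation \<open>z\<^sup>2 = z\<close> stays in the coset of \<open>z\<close>
  modulo any ideal that contains \<open>z\<^sup>2 - z\<close>.\<close>

fun newton_poly :: "nat \<Rightarrow> complex poly" where
  "newton_poly 0 = [:0, 1:]"
| "newton_poly (Suc n) =
    Polynomial.smult 3 (newton_poly n * newton_poly n) +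
    Polynomial.smult (-2) (newton_poly n * newton_poly n * newton_poly n)"

text \<open>The increment is a multiple of the defect D, so the iteration does not leave the coset;
  the new defect has the factor D^2, so convergence is quadratic.\<close>

lemma newton_poly_defect:
  fixes P :: "complex poly"
  assumes "Q = Polynomial.smult 3 (P * P) + Polynomial.smult (-2) (P * P * P)" "D = P * P - P"
  shows "Q - P = (1 - (P + P)) * D" "Q * Q - Q = D * D * (Polynomial.smult 4 D - Polynomial.smult 3 1)"
proof -
  have s: "Polynomial.smult c X = [:c:] * X" for c and X :: "complex poly" by simp
  have n: "[:3:] = (3 :: complex poly)" "[:-2:] = (-2 :: complex poly)" "[:4:] = (4 :: complex poly)"
    by (simp_all add: numeral_poly)
  show "Q - P = (1 - (P + P)) * D" "Q * Q - Q = D * D * (Polynomial.smult 4 D - Polynomial.smult 3 1)"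
    unfolding assms s n by (simp_all add: algebra_simps)
qed

text \<open>Completeness is asked for in the form in which it is applied: increments of order 2^-n.
  This form passes from A to matrices entry by entry.\<close>

locale nstar_algebra = normed_star_algebra R for R :: "'a cstar" (structure) +
  assumes geometric_limit:
      "\<lbrakk>\<And>n. s n \<in> carrier R; \<And>n. cnorm R (s (Suc n) \<ominus> s n) \<le> C * (1/2) ^ n\<rbrakk>
        \<Longrightarrow> \<exists>l\<in>carrier R. (\<lambda>n. cnorm R (s n \<ominus> l)) \<longlonglongrightarrow> 0"
begin

subsection \<open>Polynomial functional calculus\<close>

definition ev :: "'a \<Rightarrow> complex poly \<Rightarrow> 'a" where
  "ev x p = fold_coeffs (\<lambda>a v. a \<odot> \<one> \<oplus> x \<otimes> v) p \<zero>"

lemma ev_0 [simp]: "ev x 0 = \<zero>"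
  by (simp add: ev_def)

lemma ev_pCons:
  assumes "x \<in> carrier R"
  shows "ev x (pCons a p) = a \<odot> \<one> \<oplus> x \<otimes> ev x p"
  using assms by (cases "p = 0 \<and> a = 0") (auto simp: ev_def)

lemma ev_closed [simp, intro]: "x \<in> carrier R \<Longrightarrow> ev x p \<in> carrier R"
  by (induction p) (auto simp: ev_pCons)

lemma ev_add: "x \<in> carrier R \<Longrightarrow> ev x (p + q) = ev x p \<oplus> ev x q"
proof (induction p q rule: poly_induct2)
  case (pCons a p b q)
  then show ?case
    by (simp add: ev_pCons smult_l_distr r_distr a_ac)
qed simp

lemma ev_smult: "x \<in> carrier R \<Longrightarrow> ev x (Polynomial.smult c p) = c \<odot> ev x p"
proof (induction p)
  case (pCons a p)
  then show ?case by (simp add: ev_pCons smult_r_distr smult_smult smult_mult_right)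
qed simp

lemma ev_pCons_0: "x \<in> carrier R \<Longrightarrow> ev x (pCons 0 p) = x \<otimes> ev x p"
  by (simp add: ev_pCons)

lemma ev_mult: "x \<in> carrier R \<Longrightarrow> ev x (p * q) = ev x p \<otimes> ev x q"
proof (induction p)
  case (pCons a p)
  have "ev x (pCons a p * q) = a \<odot> ev x q \<oplus> x \<otimes> (ev x p \<otimes> ev x q)"
    using pCons by (simp add: ev_add ev_smult ev_pCons_0)
  also have "\<dots> = ev x (pCons a p) \<otimes> ev x q"
    using pCons by (simp add: ev_pCons l_distr smult_mult_left m_assoc)
  finally show ?case .
qed simp

lemma ev_1 [simp]: "x \<in> carrier R \<Longrightarrow> ev x 1 = \<one>"
  by (simp add: ev_pCons one_pCons)

lemma ev_X [simp]: "x \<in> carrier R \<Longrightarrow> ev x [:0, 1:] = x"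
  by (simp add: ev_pCons)

lemma ev_minus: "x \<in> carrier R \<Longrightarrow> ev x (- p) = \<ominus> ev x p"
  using ev_smult[of x "-1" p] by (simp add: minus_eq_smult)

lemma ev_diff: "x \<in> carrier R \<Longrightarrow> ev x (p - q) = ev x p \<ominus> ev x q"
  using ev_add[of x p "- q"] by (simp add: minus_eq ev_minus)

lemma ev_commute: "x \<in> carrier R \<Longrightarrow> ev x p \<otimes> ev x q = ev x q \<otimes> ev x p"
  by (metis ev_mult mult.commute)

lemma ev_commute_X: "x \<in> carrier R \<Longrightarrow> ev x p \<otimes> x = x \<otimes> ev x p"
  using ev_commute[of x p "[:0,1:]"] by simp

text \<open>The witness has the conjugated coefficients of \<open>p\<close>.\<close>

lemma star_ev:
  assumes "x \<in> carrier R" "star R x = x"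
  shows "\<exists>q. star R (ev x p) = ev x q"
proof (induction p)
  case (pCons a p)
  then obtain q where "star R (ev x p) = ev x q" by blast
  then have "star R (ev x (pCons a p)) = ev x (pCons (cnj a) q)"
    using assms by (simp add: ev_pCons star_add star_smult star_mult ev_commute_X)
  then show ?case by blast
qed (auto intro: exI[of _ 0])

definition pw :: "'a \<Rightarrow> nat \<Rightarrow> 'a" where "pw x m = ev x ([:0, 1:] ^ m)"

lemma pw_closed [simp, intro]: "x \<in> carrier R \<Longrightarrow> pw x m \<in> carrier R"
  by (simp add: pw_def)

lemma pw_0 [simp]: "x \<in> carrier R \<Longrightarrow> pw x 0 = \<one>"
  by (simp add: pw_def)

lemma pw_Suc: "x \<in> carrier R \<Longrightarrow> pw x (Suc m) = x \<otimes> pw x m"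
  by (simp add: pw_def ev_pCons_0)

lemma pw_add: "x \<in> carrier R \<Longrightarrow> pw x (m + n) = pw x m \<otimes> pw x n"
  by (simp add: pw_def power_add ev_mult)

lemma star_pw: "x \<in> carrier R \<Longrightarrow> star R x = x \<Longrightarrow> star R (pw x m) = pw x m"
  by (induction m) (simp_all add: pw_Suc star_mult, simp add: pw_def ev_commute_X)

definition algebraic :: "'a \<Rightarrow> bool" where
  "algebraic x \<longleftrightarrow> (\<exists>p. p \<noteq> 0 \<and> ev x p = \<zero>)"

text \<open>Cancellability of \<open>c\<close> strips the factors X from an annihilating polynomial
  until its constant term is nonzero; then \<open>poly_unit_split\<close> solves for the
  inverse.\<close>

lemma algebraic_cancel_inverse:
  assumes "c \<in> carrier R" "algebraic c" "\<And>w. w \<in> carrier R \<Longrightarrow> c \<otimes> w = \<zero> \<Longrightarrow> w = \<zero>"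
  shows "\<exists>d\<in>carrier R. c \<otimes> d = \<one>"
proof -
  have "\<exists>a r. a \<noteq> 0 \<and> ev c (pCons a r) = \<zero>" if "p \<noteq> 0" "ev c p = \<zero>" for p
    using that
  proof (induction p)
    case (pCons a p)
    show ?case
    proof (cases "a = 0")
      case True
      then have "c \<otimes> ev c p = \<zero>" using pCons.prems(2) by (simp add: ev_pCons_0 assms(1))
      then have "ev c p = \<zero>" using assms(1,3) ev_closed by blast
      moreover have "p \<noteq> 0" using pCons.prems(1) True by simp
      ultimately show ?thesis using pCons.IH by blast
    qed (use pCons.prems in blast)
  qed simp
  then obtain a r where ar: "a \<noteq> 0" "ev c (pCons a r) = \<zero>"
    using assms(2) unfolding algebraic_def by blast
  have "\<one> = ev c (Polynomial.smult (1 / a) (pCons a r) + pCons 0 (Polynomial.smult (- 1 / a) r))"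
    unfolding poly_unit_split[OF ar(1), symmetric] using assms(1) by simp
  also have "\<dots> = c \<otimes> ev c (Polynomial.smult (- 1 / a) r)"
    unfolding ev_add[OF assms(1)] ev_smult[OF assms(1), of _ "pCons a r"] ar(2)
    using assms(1) by (simp add: ev_pCons_0)
  finally show ?thesis using assms(1) by (metis ev_closed)
qed

text \<open>The support projection of \<open>h\<close> as a polynomial in \<open>h\<close> without
  constant term. With \<open>proper\<close>, a factor X can be stripped as long as one remains: if h
  h p(h) = 0, then w = h p(h) satisfies star w w = 0, so w = 0. This ends with h (a + h r(h)) = 0
  for some nonzero a, and -h r(h) / a is the unit for \<open>h\<close>.\<close>

lemma support_projection:
  assumes h: "h \<in> carrier R" "star R h = h" "algebraic h"
    and proper: "\<And>w. w \<in> carrier R \<Longrightarrow> star R w \<otimes> w = \<zero> \<Longrightarrow> w = \<zero>"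
  obtains r where "star R (h \<otimes> ev h r) = h \<otimes> ev h r"
    "(h \<otimes> ev h r) \<otimes> (h \<otimes> ev h r) = h \<otimes> ev h r" "h \<otimes> (h \<otimes> ev h r) = h"
proof -
  have "\<exists>a r. a \<noteq> 0 \<and> h \<otimes> ev h (pCons a r) = \<zero>" if "p \<noteq> 0" "h \<otimes> ev h p = \<zero>" for p
    using that
  proof (induction p)
    case (pCons a p)
    show ?case
    proof (cases "a = 0")
      case True
      let ?w = "h \<otimes> ev h p"
      have "star R ?w \<otimes> ?w = star R (ev h p) \<otimes> (h \<otimes> ev h (pCons a p))"
        using h True by (simp add: star_mult m_assoc ev_pCons_0)
      also have "\<dots> = \<zero>" unfolding pCons.prems(2) using h(1) by simp
      finally have "star R ?w \<otimes> ?w = \<zero>" .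
      moreover have "?w \<in> carrier R" using h(1) by simp
      ultimately have "?w = \<zero>" by (rule proper[rotated])
      moreover have "p \<noteq> 0" using pCons.prems(1) True by auto
      ultimately show ?thesis using pCons.IH by blast
    qed (use pCons.prems in blast)
  qed simp
  moreover obtain p where "p \<noteq> 0" "h \<otimes> ev h p = \<zero>"
    using h unfolding algebraic_def by auto
  ultimately obtain a r where ar: "a \<noteq> 0" "h \<otimes> ev h (pCons a r) = \<zero>" by blast
  define r' where "r' = Polynomial.smult (- 1 / a) r"
  let ?e = "h \<otimes> ev h r'"
  have "\<one> = ev h (Polynomial.smult (1 / a) (pCons a r) + pCons 0 r')"
    unfolding r'_def poly_unit_split[OF ar(1), symmetric] using h(1) by simp
  also have "\<dots> = (1 / a) \<odot> ev h (pCons a r) \<oplus> ?e"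
    using h(1) by (simp only: ev_add ev_smult ev_pCons_0)
  finally have "h \<otimes> \<one> = h \<otimes> ((1 / a) \<odot> ev h (pCons a r) \<oplus> ?e)" by simp
  then have he: "h = h \<otimes> ?e"
    using h(1) ar(2) by (simp add: r_distr smult_mult_right)
  have e_right: "?e = ev h r' \<otimes> h" using h by (simp add: ev_commute_X)
  have ee: "?e \<otimes> ?e = ?e"
  proof -
    have "?e \<otimes> ?e = ev h r' \<otimes> (h \<otimes> ?e)" using h e_right by (simp add: m_assoc)
    then show ?thesis using he e_right by simp
  qed
  obtain q where q: "star R (ev h r') = ev h q" using star_ev[OF h(1,2)] by blast
  have se: "star R ?e = ev h q \<otimes> h" using h q by (simp add: star_mult)
  then have "star R ?e \<otimes> ?e = ev h q \<otimes> (h \<otimes> ?e)" using h by (simp add: m_assoc)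
  \<comment> \<open>A product star e e is self-adjoint; once it equals star e, e is self-adjoint
    too.\<close>
  then have 1: "star R ?e \<otimes> ?e = star R ?e" using he se by simp
  have ecl: "?e \<in> carrier R" using h by simp
  have "star R (star R ?e \<otimes> ?e) = star R ?e \<otimes> ?e"
    using ecl star_mult[of "star R ?e" ?e] by simp
  then have "star R ?e = ?e" using 1 ecl star_star by metis
  then show ?thesis using that ee he by metis
qed

lemma cnorm_mult_le:
  assumes "x \<in> carrier R" "y \<in> carrier R" "cnorm R x \<le> a" "cnorm R y \<le> b"
  shows "cnorm R (x \<otimes> y) \<le> a * b"
  using cnorm_mult[OF assms(1,2)] mult_mono[OF assms(3,4)] cnorm_nonneg assms by force

text \<open>An algebraic element \<open>c\<close> close to \<open>b\<close> is left cancellable because \<open>star b * c\<close> is close to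
  \<open>\<one>\<close>, so it has a right inverse \<open>d\<close> of controlled norm, and
  \<open>\<one> - b * star b = (\<one> - b * star b) * (c - b) * d\<close>.\<close>

lemma isometry_imp_unitary:
  assumes dense: "\<And>x \<epsilon>. x \<in> carrier R \<Longrightarrow> 0 < \<epsilon> \<Longrightarrow> \<exists>y\<in>carrier R. algebraic y \<and> cnorm R (x \<ominus> y) < \<epsilon>"
    and b: "b \<in> carrier R" "star R b \<otimes> b = \<one>"
  shows "b \<otimes> star R b = \<one>"
proof -
  define \<beta> where "\<beta> = cnorm R b"
  have \<beta>: "0 \<le> \<beta>" unfolding \<beta>_def using b cnorm_nonneg by blast
  \<comment> \<open>The distance from \<open>b\<close> to \<open>c\<close> must be small against the
    norm of star b: then star b c differs from the unit by at most 1/4. The \<open>+ 1\<close>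
    covers a vanishing norm.\<close>
  define \<epsilon> where "\<epsilon> = 1 / (4 * (\<beta> + 1))"
  have \<epsilon>: "0 < \<epsilon>" "\<epsilon> * \<beta> \<le> 1/4" using \<beta> by (auto simp: \<epsilon>_def field_simps)
  obtain c where c: "c \<in> carrier R" "algebraic c" "cnorm R (b \<ominus> c) < \<epsilon>"
    using dense[OF b(1) \<epsilon>(1)] by blast
  let ?b' = "star R b"
  have b': "?b' \<in> carrier R" "cnorm R ?b' = \<beta>" using b by (auto simp: cnorm_star \<beta>_def)
  have bc: "b \<ominus> c \<in> carrier R" using b c by simp
  \<comment> \<open>Splits w = star b b w into a part of norm at most |w| / 4 and a part that
    depends on c w only. It is used twice: with c w = 0 to cancel c, and with c d = 1 to bound
    d.\<close>
  have key: "w = ?b' \<otimes> ((b \<ominus> c) \<otimes> w) \<oplus> ?b' \<otimes> (c \<otimes> w)" if "w \<in> carrier R" for w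
  proof -
    have "?b' \<otimes> ((b \<ominus> c) \<otimes> w) \<oplus> ?b' \<otimes> (c \<otimes> w) = ?b' \<otimes> (((b \<ominus> c) \<oplus> c) \<otimes> w)"
      using b c b' that by (simp add: r_distr l_distr)
    also have "\<dots> = ?b' \<otimes> b \<otimes> w" using b(1) c b' that by (simp add: diff_add_cancel m_assoc)
    finally show ?thesis using b that by simp
  qed
  have small: "cnorm R (?b' \<otimes> ((b \<ominus> c) \<otimes> w)) \<le> 1/4 * cnorm R w" if "w \<in> carrier R" for w
  proof -
    have "cnorm R (?b' \<otimes> ((b \<ominus> c) \<otimes> w)) \<le> \<beta> * (\<epsilon> * cnorm R w)"
      using b' bc c that by (intro cnorm_mult_le) auto
    also have "\<dots> = (\<epsilon> * \<beta>) * cnorm R w" by simp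
    also have "\<dots> \<le> 1/4 * cnorm R w" using \<epsilon> cnorm_nonneg[OF that] by (intro mult_right_mono) auto
    finally show ?thesis .
  qed
  have "w = \<zero>" if w: "w \<in> carrier R" "c \<otimes> w = \<zero>" for w
  proof -
    have "w = ?b' \<otimes> ((b \<ominus> c) \<otimes> w)" using key[OF w(1)] w b' bc by simp
    then show ?thesis using small[OF w(1)] by (intro eq_zeroI[OF w(1), of "1/4"]) auto
  qed
  then obtain d where d: "d \<in> carrier R" "c \<otimes> d = \<one>"
    using algebraic_cancel_inverse[OF c(1,2)] by blast
  have "d = ?b' \<otimes> ((b \<ominus> c) \<otimes> d) \<oplus> ?b'" using key[OF d(1)] d b' by simp
  then have "cnorm R d \<le> cnorm R (?b' \<otimes> ((b \<ominus> c) \<otimes> d)) + \<beta>"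
    using cnorm_triangle[of "?b' \<otimes> ((b \<ominus> c) \<otimes> d)" ?b'] b' bc d by simp
  then have dn: "cnorm R d \<le> 2 * \<beta>" using small[OF d(1)] \<beta> by linarith
  let ?g = "\<one> \<ominus> b \<otimes> ?b'"
  have g: "?g \<in> carrier R" using b b' by simp
  have gb: "?g \<otimes> b = \<zero>"
    using b b' by (simp add: minus_mult_left m_assoc minus_eq_zero_iff)
  have "?g = ?g \<otimes> (c \<otimes> d)" using g d by simp
  also have "\<dots> = ?g \<otimes> ((c \<ominus> b) \<oplus> b) \<otimes> d" using g b c d by (simp add: diff_add_cancel m_assoc)
  also have "\<dots> = ?g \<otimes> (c \<ominus> b) \<otimes> d" using g b c d gb by (simp add: r_distr l_distr)
  finally have geq: "?g = ?g \<otimes> (c \<ominus> b) \<otimes> d" .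
  have "cnorm R (?g \<otimes> (c \<ominus> b) \<otimes> d) \<le> cnorm R ?g * \<epsilon> * (2 * \<beta>)"
    using g b c d dn cnorm_diff_commute[of b c] by (intro cnorm_mult_le) auto
  also have "\<dots> = 2 * (\<epsilon> * \<beta>) * cnorm R ?g" by simp
  also have "\<dots> \<le> 1/2 * cnorm R ?g" using \<epsilon> cnorm_nonneg[OF g] by (intro mult_right_mono) auto
  finally have "cnorm R ?g \<le> 1/2 * cnorm R ?g" using geq by simp
  then have "?g = \<zero>" using eq_zeroI[OF g, of "1/2"] by auto
  then show ?thesis using minus_eq_zero_iff b b' by simp
qed

subsection \<open>Lifting projections modulo a closed ideal\<close>

lemma ideal_minus_closed:
  assumes "ideal K R" "x \<in> K" "y \<in> K"
  shows "x \<ominus> y \<in> K"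
proof -
  interpret ideal K R by fact
  show ?thesis using assms by (simp add: minus_eq a_closed a_inv_closed)
qed

text \<open>Newton's iteration from \<open>z\<close>. The increments are (1 - 2 s_n) times the
  defect, so besides the decay of the defect \<delta> the boundedness of s_n has to be established
  along the way. The limit remains in the coset because \<open>K\<close> is closed.\<close>

lemma almost_idempotent_lift:
  assumes K: "ideal K R"
    and closed: "\<And>x. x \<in> carrier R \<Longrightarrow> (\<And>\<epsilon>. 0 < \<epsilon> \<Longrightarrow> \<exists>y\<in>K. cnorm R (x \<ominus> y) < \<epsilon>) \<Longrightarrow> x \<in> K"
    and z: "z \<in> carrier R" "star R z = z" "z \<otimes> z \<ominus> z \<in> K" "cnorm R (z \<otimes> z \<ominus> z) \<le> 1/8"
  obtains p where "p \<in> carrier R" "star R p = p" "p \<otimes> p = p" "p \<ominus> z \<in> K"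
proof -
  interpret K: ideal K R by fact
  define s where "s n = ev z (newton_poly n)" for n
  define D where "D n = newton_poly n * newton_poly n - newton_poly n" for n
  define \<delta> where "\<delta> n = cnorm R (ev z (D n))" for n
  have scl [simp]: "s n \<in> carrier R" for n using z by (simp add: s_def)
  have s0: "s 0 = z" using z by (simp add: s_def)
  have D: "newton_poly (Suc n) - newton_poly n = (1 - (newton_poly n + newton_poly n)) * D n"
    "D (Suc n) = D n * D n * (Polynomial.smult 4 (D n) - Polynomial.smult 3 1)" for n
    using newton_poly_defect[of "newton_poly (Suc n)" "newton_poly n" "D n"] by (auto simp: D_def)
  have evD: "ev z (D n) = s n \<otimes> s n \<ominus> s n" for n
    using z by (simp add: D_def s_def ev_diff ev_mult)
  have step: "s (Suc n) \<ominus> s n = (\<one> \<ominus> (s n \<oplus> s n)) \<otimes> ev z (D n)" for n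
    using arg_cong[OF D(1)[of n], of "ev z"] z by (simp only: s_def ev_diff ev_mult ev_add ev_1)
  have DK: "ev z (D n) \<in> K" for n
  proof (induction n)
    case 0 then show ?case using z(3) s0 by (simp add: evD)
  next
    case (Suc n)
    then show ?case using z(1) by (simp only: D(2) ev_mult m_assoc) (intro K.I_r_closed, auto)
  qed
  have \<delta>0: "0 \<le> \<delta> n" for n unfolding \<delta>_def using z cnorm_nonneg by simp
  have \<delta>: "\<delta> n \<le> 1/8 * (1/2) ^ n" for n
  proof (induction n)
    case 0 then show ?case using z(4) s0 by (simp add: \<delta>_def evD)
  next
    case (Suc n)
    have le: "\<delta> n \<le> 1/8" using Suc power_le_one[of "1/2::real" n] by linarith
    have "D (Suc n) = Polynomial.smult 4 (D n * D n * D n) + Polynomial.smult (-3) (D n * D n)"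
      unfolding D(2) by (simp add: right_diff_distrib)
    then have "ev z (D (Suc n)) = 4 \<odot> (ev z (D n) \<otimes> ev z (D n) \<otimes> ev z (D n)) \<oplus> (-3) \<odot> (ev z (D n) \<otimes> ev z (D n))"
      using z by (simp only: ev_add ev_smult ev_mult)
    then have "\<delta> (Suc n) \<le> 4 * cnorm R (ev z (D n) \<otimes> ev z (D n) \<otimes> ev z (D n)) + 3 * cnorm R (ev z (D n) \<otimes> ev z (D n))"
      unfolding \<delta>_def using z
        cnorm_triangle[of "4 \<odot> (ev z (D n) \<otimes> ev z (D n) \<otimes> ev z (D n))" "(-3) \<odot> (ev z (D n) \<otimes> ev z (D n))"]
      by (simp add: cnorm_smult)
    also have "\<dots> \<le> 4 * (\<delta> n * \<delta> n * \<delta> n) + 3 * (\<delta> n * \<delta> n)"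
      using z by (intro add_mono mult_left_mono cnorm_mult_le) (auto simp: \<delta>_def)
    \<comment> \<open>Origin of 1/8: for \<delta> \<le> 1/8 the factor 4 \<delta>^2 + 3 \<delta> is
      at most 7/16.\<close>
    also have "\<dots> \<le> \<delta> n * (1/2)"
    proof -
      have "\<delta> n * \<delta> n \<le> 1/8 * (1/8)" using le \<delta>0[of n] by (intro mult_mono) auto
      then have "4 * (\<delta> n * \<delta> n) + 3 * \<delta> n \<le> 1/2" using le by linarith
      then have "\<delta> n * (4 * (\<delta> n * \<delta> n) + 3 * \<delta> n) \<le> \<delta> n * (1/2)" using \<delta>0 by (intro mult_left_mono)
      then show ?thesis by (simp add: algebra_simps)
    qed
    finally show ?case using Suc by simp
  qed
  define c where "c n = cnorm R \<one> + 2 * cnorm R (s n)" for n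
  have c0: "0 \<le> c n" for n unfolding c_def using cnorm_nonneg[of \<one>] cnorm_nonneg[of "s n"] by simp
  have stepn: "cnorm R (s (Suc n) \<ominus> s n) \<le> c n * \<delta> n" for n
  proof -
    have "cnorm R (\<one> \<ominus> (s n \<oplus> s n)) \<le> c n"
      using cnorm_diff_le[of \<one> "s n \<oplus> s n"] cnorm_triangle[of "s n" "s n"] by (simp add: c_def)
    then show ?thesis unfolding step \<delta>_def using z by (intro cnorm_mult_le) auto
  qed
  \<comment> \<open>Gives a bound on \<open>c\<close> uniform in n, strengthened for the induction.
    A step multiplies \<open>c\<close> by at most 1 + q/4 with q = 2^-n, and (2 - q)(1 + q/4) \<le>
    2 - q/2.\<close>
  have cb: "c n \<le> c 0 * (2 - (1/2) ^ n)" for n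
  proof (induction n)
    case (Suc n)
    let ?q = "(1/2::real) ^ n"
    have q: "0 \<le> ?q" "?q \<le> 1" by (auto simp: power_le_one)
    have "cnorm R (s (Suc n)) \<le> c n * \<delta> n + cnorm R (s n)"
      using cnorm_le_diff_add[of "s (Suc n)" "s n"] stepn[of n] by simp
    then have "c (Suc n) \<le> c n + 2 * (c n * \<delta> n)" unfolding c_def by simp
    also have "\<dots> = c n * (1 + 2 * \<delta> n)" by (simp add: algebra_simps)
    also have "\<dots> \<le> (c 0 * (2 - ?q)) * (1 + ?q / 4)"
      using Suc \<delta>[of n] c0[of n] \<delta>0[of n] c0[of 0] q by (intro mult_mono) auto
    also have "\<dots> = c 0 * ((2 - ?q) * (1 + ?q / 4))" by simp
    also have "\<dots> \<le> c 0 * (2 - ?q / 2)"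
    proof (intro mult_left_mono c0)
      have "(2 - q) * (1 + q / 4) = 2 - q / 2 - q * q / 4" for q :: real by (simp add: field_simps)
      from this[of ?q] show "(2 - ?q) * (1 + ?q / 4) \<le> 2 - ?q / 2" using q by simp
    qed
    finally show ?case by simp
  qed simp
  have cb2: "c n \<le> 2 * c 0" for n
    using cb[of n] mult_left_mono[OF _ c0[of 0], of "2 - (1/2) ^ n" 2] by simp
  have "cnorm R (s (Suc n) \<ominus> s n) \<le> c 0 / 4 * (1/2) ^ n" for n
  proof -
    have "c n * \<delta> n \<le> (2 * c 0) * (1/8 * (1/2) ^ n)"
      using cb2 \<delta> c0[of n] \<delta>0[of n] c0[of 0] by (intro mult_mono) auto
    then show ?thesis using stepn[of n] by simp
  qed
  then obtain p where p: "p \<in> carrier R" "(\<lambda>n. cnorm R (s n \<ominus> p)) \<longlonglongrightarrow> 0"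
    using geometric_limit[of s] scl by blast
  have stars: "star R (s n) = s n" for n
  proof (induction n)
    case 0 then show ?case using z s0 by simp
  next
    case (Suc n)
    have "s (Suc n) = 3 \<odot> (s n \<otimes> s n) \<oplus> (-2) \<odot> (s n \<otimes> s n \<otimes> s n)"
      using z by (simp only: s_def newton_poly.simps ev_add ev_smult ev_mult)
    then show ?case using Suc by (simp add: star_add star_smult star_mult m_assoc)
  qed
  have 1: "star R p = p"
  proof -
    have "cnorm R (star R p \<ominus> p) \<le> cnorm R (s n \<ominus> p) + cnorm R (s n \<ominus> p)" for n
    proof -
      have "cnorm R (star R p \<ominus> s n) = cnorm R (s n \<ominus> p)"
        using cnorm_star[of "s n \<ominus> p"] p(1) stars[of n] cnorm_diff_commute[of "s n" "star R p"]
        by (simp add: star_diff)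
      then show ?thesis using cnorm_diff_triangle[of "star R p" "s n" p] p(1) by simp
    qed
    moreover have "(\<lambda>n. cnorm R (s n \<ominus> p) + cnorm R (s n \<ominus> p)) \<longlonglongrightarrow> 0"
      using tendsto_add[OF p(2) p(2)] by simp
    ultimately have "cnorm R (star R p \<ominus> p) \<le> 0"
      by (meson LIMSEQ_le_const)
    then have "star R p \<ominus> p = \<zero>" by (rule cnorm_le_zeroD) (use p(1) in simp)
    then show ?thesis using minus_eq_zero_iff p(1) by simp
  qed
  have 2: "p \<otimes> p = p"
  proof -
    let ?t = "\<lambda>n. cnorm R (s n \<ominus> p)"
    \<comment> \<open>The comparison runs along p p, s_n s_n, s_n, p; its middle step costs the
      defect of s_n.\<close>
    have "cnorm R (p \<otimes> p \<ominus> p) \<le> cnorm R p * ?t n + ?t n * (2 * c 0) + 1/8 * (1/2) ^ n + ?t n" for n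
    proof -
      have sn: "cnorm R (s n) \<le> 2 * c 0"
        using cb2[of n] cnorm_nonneg[of \<one>] cnorm_nonneg[of "s n"] unfolding c_def by simp
      have "p \<otimes> p \<ominus> s n \<otimes> s n = p \<otimes> (p \<ominus> s n) \<oplus> (p \<ominus> s n) \<otimes> s n"
        using p(1) diff_split[of "p \<otimes> p" "p \<otimes> s n" "s n \<otimes> s n"]
        by (simp add: minus_mult_left minus_mult_right)
      then have "cnorm R (p \<otimes> p \<ominus> s n \<otimes> s n) \<le> cnorm R p * ?t n + ?t n * (2 * c 0)"
        using p(1) sn cnorm_triangle[of "p \<otimes> (p \<ominus> s n)" "(p \<ominus> s n) \<otimes> s n"]
          cnorm_mult_le[of p "p \<ominus> s n" "cnorm R p" "?t n"] cnorm_mult_le[of "p \<ominus> s n" "s n" "?t n" "2 * c 0"]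
          cnorm_diff_commute[of p "s n"] by simp
      moreover have "cnorm R (s n \<otimes> s n \<ominus> s n) \<le> 1/8 * (1/2) ^ n"
        using \<delta>[of n] by (simp add: \<delta>_def evD)
      ultimately show ?thesis
        using p(1) cnorm_diff_triangle[of "p \<otimes> p" "s n \<otimes> s n" p] cnorm_diff_triangle[of "s n \<otimes> s n" "s n" p]
        by simp
    qed
    moreover have "(\<lambda>n. cnorm R p * ?t n + ?t n * (2 * c 0) + 1/8 * (1/2) ^ n + ?t n) \<longlonglongrightarrow>
        cnorm R p * 0 + 0 * (2 * c 0) + 1/8 * 0 + 0"
      by (intro tendsto_intros p(2) LIMSEQ_power_zero) auto
    ultimately have "cnorm R (p \<otimes> p \<ominus> p) \<le> cnorm R p * 0 + 0 * (2 * c 0) + 1/8 * 0 + 0"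
      by (meson LIMSEQ_le_const)
    then have "cnorm R (p \<otimes> p \<ominus> p) \<le> 0" by simp
    then have "p \<otimes> p \<ominus> p = \<zero>" by (rule cnorm_le_zeroD) (use p(1) in simp)
    then show ?thesis using minus_eq_zero_iff p(1) by simp
  qed
  have sK: "s n \<ominus> z \<in> K" for n
  proof (induction n)
    case 0 then show ?case using z s0 by (simp add: minus_eq_zero_iff[THEN iffD2])
  next
    case (Suc n)
    have "s (Suc n) \<ominus> s n \<in> K" unfolding step using DK[of n] by (intro K.I_l_closed) auto
    then show ?case using Suc diff_split[of "s (Suc n)" "s n" z] z(1) by simp
  qed
  have 3: "p \<ominus> z \<in> K"
  proof (rule closed)
    fix \<epsilon> :: real assume "0 < \<epsilon>"
    then obtain n where "cnorm R (s n \<ominus> p) < \<epsilon>"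
      using LIMSEQ_D[OF p(2), of \<epsilon>] by (metis abs_le_D1 diff_zero le_less_trans order_refl real_norm_def abs_ge_self)
    moreover have "(p \<ominus> z) \<ominus> (s n \<ominus> z) = p \<ominus> s n"
      using p(1) z(1) by (simp add: minus_eq minus_add a_assoc) (simp add: a_lcomm[of "\<ominus> z"] r_neg1 r_neg2 l_neg)
    ultimately show "\<exists>y\<in>K. cnorm R (p \<ominus> z \<ominus> y) < \<epsilon>"
      using sK cnorm_diff_commute[of p "s n"] p(1) by (intro bexI[of _ "s n \<ominus> z"]) auto
  qed (use p z in simp)
  show ?thesis using that p(1) 1 2 3 by blast
qed

text \<open>Compressing \<open>x\<close> by f = 1 - e keeps the coset, as e lies in
  \<open>K\<close>, and shrinks the defect: f kills x x - x up to \<epsilon>, and the price of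
  moving f past x is a commutator. The constant \<open>C\<close> must not depend on \<epsilon>,
  which is chosen after it.\<close>

theorem projection_lift:
  assumes K: "ideal K R"
    and closed: "\<And>x. x \<in> carrier R \<Longrightarrow> (\<And>\<epsilon>. 0 < \<epsilon> \<Longrightarrow> \<exists>y\<in>K. cnorm R (x \<ominus> y) < \<epsilon>) \<Longrightarrow> x \<in> K"
    and x: "x \<in> carrier R" "star R x = x" "x \<otimes> x \<ominus> x \<in> K"
    and quasi_central: "\<And>\<epsilon>. 0 < \<epsilon> \<Longrightarrow> \<exists>e\<in>K. star R e = e \<and> e \<otimes> e = e \<and> cnorm R (\<one> \<ominus> e) \<le> C \<and>
      cnorm R ((x \<otimes> x \<ominus> x) \<otimes> (\<one> \<ominus> e)) < \<epsilon> \<and> cnorm R (x \<otimes> e \<ominus> e \<otimes> x) < \<epsilon>"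
  obtains p where "p \<in> carrier R" "star R p = p" "p \<otimes> p = p" "p \<ominus> x \<in> K"
proof -
  interpret K: ideal K R by fact
  let ?d = "x \<otimes> x \<ominus> x"
  have C: "0 \<le> C"
  proof -
    obtain e where "e \<in> K" "cnorm R (\<one> \<ominus> e) \<le> C" using quasi_central[of 1] by auto
    then show ?thesis using cnorm_nonneg[of "\<one> \<ominus> e"] K.Icarr by fastforce
  qed
  have xn: "0 \<le> cnorm R x" using cnorm_nonneg x by blast
  \<comment> \<open>Makes the two error terms C \<epsilon> and C \<epsilon> |x| C add up to at most
    1/8, the threshold of \<open>almost_idempotent_lift\<close>.\<close>
  define \<epsilon> where "\<epsilon> = 1 / (8 * (C + C * cnorm R x * C + 1))"
  have pos: "0 < C + C * cnorm R x * C + 1" using C xn by (simp add: add_nonneg_pos)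
  then have \<epsilon>: "0 < \<epsilon>" by (simp add: \<epsilon>_def)
  obtain e where e: "e \<in> K" "star R e = e" "e \<otimes> e = e" "cnorm R (\<one> \<ominus> e) \<le> C"
    "cnorm R (?d \<otimes> (\<one> \<ominus> e)) < \<epsilon>" "cnorm R (x \<otimes> e \<ominus> e \<otimes> x) < \<epsilon>"
    using quasi_central[OF \<epsilon>] by blast
  have ec: "e \<in> carrier R" using e(1) K.Icarr by blast
  define f where "f = \<one> \<ominus> e"
  have f: "f \<in> carrier R" "star R f = f" "f \<otimes> f = f" "f \<otimes> e = \<zero>"
    using ec e by (auto simp: f_def star_diff minus_mult_left minus_mult_right minus_eq_zero_iff[THEN iffD2])
      (simp add: minus_eq)
  define z where "z = f \<otimes> x \<otimes> f"
  have zc: "z \<in> carrier R" using f x by (simp add: z_def)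
  have sz: "star R z = z" using f x by (simp add: z_def star_mult m_assoc)
  have zx: "z \<ominus> x \<in> K"
  proof -
    have 1: "f \<otimes> x = x \<ominus> e \<otimes> x" using x ec by (simp add: f_def minus_mult_left)
    have 2: "z = f \<otimes> x \<ominus> f \<otimes> x \<otimes> e" using x ec f by (simp add: z_def f_def[of] minus_mult_right)
    have "f \<otimes> x \<otimes> e \<in> K" using e x f by (simp add: K.I_l_closed)
    moreover have "e \<otimes> x \<in> K" using e x by (simp add: K.I_r_closed)
    moreover have "z \<ominus> x = \<ominus> (e \<otimes> x) \<ominus> f \<otimes> x \<otimes> e"
      unfolding 2 unfolding 1 using x ec f by (simp add: minus_eq a_ac r_neg1 r_neg2 r_neg l_neg)
    ultimately show ?thesis using ideal_minus_closed[OF K] by simp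
  qed
  have mid: "x \<otimes> f \<otimes> x = x \<otimes> x \<ominus> x \<otimes> e \<otimes> x"
    using x ec by (simp add: f_def minus_mult_left minus_mult_right)
  \<comment> \<open>The mixed term of z z is f x e x f. As f e = 0, f x e equals f (x e - e x), so
    this term is controlled by the commutator.\<close>
  have zz: "z \<otimes> z \<ominus> z = f \<otimes> (?d \<otimes> f) \<ominus> (f \<otimes> (x \<otimes> e \<ominus> e \<otimes> x)) \<otimes> (x \<otimes> f)"
  proof -
    have "z \<otimes> z = f \<otimes> x \<otimes> (f \<otimes> f) \<otimes> x \<otimes> f" unfolding z_def using f(1) x by (simp add: m_assoc)
    also have "\<dots> = f \<otimes> (x \<otimes> f \<otimes> x) \<otimes> f" using f x by (simp add: m_assoc)
    also have "\<dots> = f \<otimes> (x \<otimes> x) \<otimes> f \<ominus> f \<otimes> (x \<otimes> e \<otimes> x) \<otimes> f"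
      unfolding mid using f x ec by (simp add: minus_mult_left minus_mult_right)
    finally have 1: "z \<otimes> z = f \<otimes> (x \<otimes> x) \<otimes> f \<ominus> f \<otimes> (x \<otimes> e \<otimes> x) \<otimes> f" .
    have 2: "f \<otimes> (?d \<otimes> f) = f \<otimes> (x \<otimes> x) \<otimes> f \<ominus> z"
      using f x by (simp add: z_def minus_mult_left minus_mult_right m_assoc)
    have "f \<otimes> (x \<otimes> e \<ominus> e \<otimes> x) = f \<otimes> (x \<otimes> e) \<ominus> f \<otimes> e \<otimes> x"
      using f(1) x ec by (simp add: minus_mult_right m_assoc)
    also have "\<dots> = f \<otimes> (x \<otimes> e)" using f x ec by (simp add: minus_eq)
    finally have 3: "(f \<otimes> (x \<otimes> e \<ominus> e \<otimes> x)) \<otimes> (x \<otimes> f) = f \<otimes> (x \<otimes> e \<otimes> x) \<otimes> f"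
      using f x ec by (simp add: m_assoc)
    have sw: "a \<ominus> b \<ominus> c = a \<ominus> c \<ominus> b" if "a \<in> carrier R" "b \<in> carrier R" "c \<in> carrier R" for a b c
      using that by (simp add: minus_eq a_assoc) (simp add: a_comm)
    show ?thesis unfolding 1 2 3 using f x ec zc by (intro sw) auto
  qed
  have zzK: "z \<otimes> z \<ominus> z \<in> K"
  proof -
    have "f \<otimes> (?d \<otimes> f) \<in> K" using x(3) f by (intro K.I_l_closed K.I_r_closed) auto
    moreover have "x \<otimes> e \<ominus> e \<otimes> x \<in> K"
      using e(1) x by (intro ideal_minus_closed[OF K] K.I_l_closed K.I_r_closed) auto
    then have "(f \<otimes> (x \<otimes> e \<ominus> e \<otimes> x)) \<otimes> (x \<otimes> f) \<in> K"
      using f x by (intro K.I_l_closed K.I_r_closed) auto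
    ultimately show ?thesis unfolding zz by (rule ideal_minus_closed[OF K])
  qed
  have "cnorm R (z \<otimes> z \<ominus> z) \<le> 1/8"
  proof -
    have fC: "cnorm R f \<le> C" using e by (simp add: f_def)
    have df: "cnorm R (?d \<otimes> f) \<le> \<epsilon>" using e by (simp add: f_def)
    have "cnorm R (f \<otimes> (?d \<otimes> f)) \<le> C * \<epsilon>"
      using f x fC df by (intro cnorm_mult_le) auto
    moreover have "cnorm R ((f \<otimes> (x \<otimes> e \<ominus> e \<otimes> x)) \<otimes> (x \<otimes> f)) \<le> (C * \<epsilon>) * (cnorm R x * C)"
      using f x ec e fC by (intro cnorm_mult_le) auto
    ultimately have "cnorm R (z \<otimes> z \<ominus> z) \<le> C * \<epsilon> + (C * \<epsilon>) * (cnorm R x * C)"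
      unfolding zz using f x ec
        cnorm_diff_le[of "f \<otimes> (?d \<otimes> f)" "(f \<otimes> (x \<otimes> e \<ominus> e \<otimes> x)) \<otimes> (x \<otimes> f)"] by simp
    also have "\<dots> \<le> (C + C * cnorm R x * C + 1) * \<epsilon>" using \<epsilon> by (simp add: algebra_simps)
    also have "\<dots> = 1/8" using pos by (simp add: \<epsilon>_def)
    finally show ?thesis .
  qed
  then obtain p where p: "p \<in> carrier R" "star R p = p" "p \<otimes> p = p" "p \<ominus> z \<in> K"
    using almost_idempotent_lift[OF K closed zc sz zzK] by blast
  have "p \<ominus> x = (p \<ominus> z) \<oplus> (z \<ominus> x)" using p x zc by (intro diff_split) auto
  then have "p \<ominus> x \<in> K" using p(4) zx by simp
  then show ?thesis using that p by blast
qed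

end

section \<open>Algebraic elements\<close>

text \<open>Gaussian elimination, one equation at a time.\<close>

lemma underdetermined_system:
  fixes C :: "'i \<Rightarrow> 'j \<Rightarrow> complex"
  assumes "finite J" "finite S" "card J < card S"
  shows "\<exists>\<alpha>. (\<exists>i\<in>S. \<alpha> i \<noteq> 0) \<and> (\<forall>j\<in>J. (\<Sum>i\<in>S. \<alpha> i * C i j) = 0)"
  using assms
proof (induction J arbitrary: S C rule: finite_induct)
  case empty
  then obtain i where "i \<in> S" by fastforce
  then show ?case by (intro exI[of _ "\<lambda>_. 1"]) auto
next
  case (insert j J)
  show ?case
  proof (cases "\<forall>i\<in>S. C i j = 0")
    case True
    have "card J < card S" using insert by simp
    then obtain \<alpha> where "\<exists>i\<in>S. \<alpha> i \<noteq> 0" "\<forall>k\<in>J. (\<Sum>i\<in>S. \<alpha> i * C i k) = 0"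
      using insert.IH[OF insert.prems(1)] by blast
    then show ?thesis using True by auto
  next
    case False
    then obtain i0 where i0: "i0 \<in> S" "C i0 j \<noteq> 0" by blast
    define T where "T = S - {i0}"
    \<comment> \<open>The equations with the unknown at the pivot \<open>i0\<close> eliminated by
      means of equation \<open>j\<close>; conversely, \<open>\<beta>\<close> recovers that unknown
      from equation \<open>j\<close>.\<close>
    define C' where "C' i k = C i k - C i j / C i0 j * C i0 k" for i k
    have T: "finite T" "i0 \<notin> T" "S = insert i0 T" using insert.prems i0 by (auto simp: T_def)
    have "card J < card T" using insert T by auto
    then obtain \<alpha> where \<alpha>: "\<exists>i\<in>T. \<alpha> i \<noteq> 0" "\<forall>k\<in>J. (\<Sum>i\<in>T. \<alpha> i * C' i k) = 0"
      using insert.IH[OF T(1)] by blast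
    define s where "s = (\<Sum>i\<in>T. \<alpha> i * C i j)"
    define \<beta> where "\<beta> = \<alpha>(i0 := - s / C i0 j)"
    have sum: "(\<Sum>i\<in>S. \<beta> i * C i k) = - s / C i0 j * C i0 k + (\<Sum>i\<in>T. \<alpha> i * C i k)" for k
      using T by (simp add: \<beta>_def) (intro sum.cong, auto)
    have "(\<Sum>i\<in>T. \<alpha> i * C' i k) = (\<Sum>i\<in>T. \<alpha> i * C i k) - s / C i0 j * C i0 k" for k
      unfolding C'_def s_def
      by (simp add: right_diff_distrib sum_subtractf sum_divide_distrib sum_distrib_right mult.assoc)
    then have "(\<Sum>i\<in>S. \<beta> i * C i k) = 0" if "k \<in> insert j J" for k
      using sum[of k] \<alpha>(2) that i0 by (auto simp: s_def)
    moreover have "\<exists>i\<in>S. \<beta> i \<noteq> 0" using \<alpha>(1) T by (auto simp: \<beta>_def)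
    ultimately show ?thesis by blast
  qed
qed

text \<open>A multiset keeps multiplicities and lets inductions split off one linear factor at a
  time.\<close>

definition root_prod :: "complex multiset \<Rightarrow> complex poly" where
  "root_prod M = (\<Prod>\<mu>\<in>#M. [:- \<mu>, 1:])"

lemma root_prod_empty [simp]: "root_prod {#} = 1"
  and root_prod_add [simp]: "root_prod (add_mset \<mu> M) = [:- \<mu>, 1:] * root_prod M"
  by (auto simp: root_prod_def)

context nstar_algebra begin

lemma smult_finsum:
  assumes "finite S" "f \<in> S \<rightarrow> carrier R"
  shows "c \<odot> finsum R f S = (\<Oplus>k\<in>S. c \<odot> f k)"
  using assms
proof (induction S rule: finite_induct)
  case (insert k S)
  then have "f k \<in> carrier R" "f \<in> S \<rightarrow> carrier R" "(\<lambda>k. c \<odot> f k) \<in> S \<rightarrow> carrier R" by auto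
  then show ?case using insert by (simp add: finsum_insert smult_r_distr finsum_closed)
qed (simp add: finsum_empty)

lemma finsum_smult_left:
  assumes "finite S" "x \<in> carrier R"
  shows "(\<Oplus>k\<in>S. c k \<odot> x) = (\<Sum>k\<in>S. c k) \<odot> x"
  using assms
proof (induction S rule: finite_induct)
  case (insert k S)
  then show ?case by (simp add: finsum_insert smult_l_distr)
qed (simp add: finsum_empty)

text \<open>Separate from \<open>span_dependent\<close> because for matrices the same coefficients
  \<alpha> have to serve all entries at once, so they come from a larger linear system.\<close>

lemma span_relation:
  assumes "finite B" "B \<subseteq> carrier R" "finite S"
    and x: "\<And>i. i \<in> S \<Longrightarrow> x i = (\<Oplus>b\<in>B. C i b \<odot> b)"
    and \<alpha>: "\<And>b. b \<in> B \<Longrightarrow> (\<Sum>i\<in>S. \<alpha> i * C i b) = 0"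
  shows "(\<Oplus>i\<in>S. \<alpha> i \<odot> x i) = \<zero>"
proof -
  have "(\<Oplus>i\<in>S. \<alpha> i \<odot> x i) = (\<Oplus>i\<in>S. \<Oplus>b\<in>B. (\<alpha> i * C i b) \<odot> b)"
  proof (intro finsum_cong' refl)
    fix i assume i: "i \<in> S"
    have "\<alpha> i \<odot> x i = (\<Oplus>b\<in>B. \<alpha> i \<odot> (C i b \<odot> b))"
      unfolding x[OF i] using assms(1,2) by (intro smult_finsum) auto
    also have "\<dots> = (\<Oplus>b\<in>B. (\<alpha> i * C i b) \<odot> b)"
      using assms(2) by (intro finsum_cong' refl) (auto simp: smult_smult)
    finally show "\<alpha> i \<odot> x i = (\<Oplus>b\<in>B. (\<alpha> i * C i b) \<odot> b)" .
  qed (use assms(2) in \<open>auto intro!: finsum_closed\<close>)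
  also have "\<dots> = (\<Oplus>b\<in>B. \<Oplus>i\<in>S. (\<alpha> i * C i b) \<odot> b)"
    using assms(1-3) by (intro finsum_swap) auto
  also have "\<dots> = \<zero>"
  proof (rule finsum_eq_zero)
    fix b assume b: "b \<in> B"
    then have "(\<Oplus>i\<in>S. (\<alpha> i * C i b) \<odot> b) = (\<Sum>i\<in>S. \<alpha> i * C i b) \<odot> b"
      using assms(2,3) by (intro finsum_smult_left) auto
    then show "(\<Oplus>i\<in>S. (\<alpha> i * C i b) \<odot> b) = \<zero>" using \<alpha>[OF b] b assms(2) by auto
  qed
  finally show ?thesis .
qed

lemma span_dependent:
  assumes "finite B" "B \<subseteq> carrier R" "finite S" "card B < card S"
    and x: "\<And>i. i \<in> S \<Longrightarrow> x i = (\<Oplus>b\<in>B. C i b \<odot> b)"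
  shows "\<exists>\<alpha>. (\<exists>i\<in>S. \<alpha> i \<noteq> 0) \<and> (\<Oplus>i\<in>S. \<alpha> i \<odot> x i) = \<zero>"
proof -
  obtain \<alpha> where \<alpha>: "\<exists>i\<in>S. \<alpha> i \<noteq> 0" "\<forall>b\<in>B. (\<Sum>i\<in>S. \<alpha> i * C i b) = 0"
    using underdetermined_system[OF assms(1,3,4)] by blast
  have "(\<Oplus>i\<in>S. \<alpha> i \<odot> x i) = \<zero>"
    using \<alpha>(2) by (intro span_relation[OF assms(1-3) x]) auto
  then show ?thesis using \<alpha>(1) by blast
qed

lemma algebraic_if_powers_dependent:
  assumes x: "x \<in> carrier R" and S: "finite S"
    and dep: "\<exists>i\<in>S. \<alpha> i \<noteq> 0" "(\<Oplus>i\<in>S. \<alpha> i \<odot> pw x i) = \<zero>"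
  shows "algebraic x"
proof -
  have ev_sum: "ev x (\<Sum>i\<in>T. Polynomial.smult (\<alpha> i) ([:0, 1:] ^ i)) = (\<Oplus>i\<in>T. \<alpha> i \<odot> pw x i)" if "finite T" for T
    using that
  proof (induction T rule: finite_induct)
    case (insert i T)
    then show ?case using x by (simp add: finsum_insert ev_add ev_smult pw_def)
  qed (simp add: finsum_empty)
  let ?p = "\<Sum>i\<in>S. Polynomial.smult (\<alpha> i) ([:0, 1:] ^ i)"
  have "coeff ?p j = \<alpha> j" if "j \<in> S" for j
  proof -
    have "Polynomial.smult (\<alpha> i) ([:0, 1:] ^ i) = Polynomial.monom (\<alpha> i) i" for i
      by (simp add: monom_altdef)
    then have "coeff ?p j = (\<Sum>i\<in>S. if i = j then \<alpha> i else 0)"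
      by (simp add: coeff_sum)
    then show ?thesis using that S by simp
  qed
  then have "?p \<noteq> 0" using dep(1) by (metis coeff_0)
  then show ?thesis unfolding algebraic_def using ev_sum[OF S] dep(2) by auto
qed

subsection \<open>Spectral bounds for algebraic elements\<close>

lemma algebraic_root_prod:
  assumes "x \<in> carrier R" "algebraic x"
  obtains M where "ev x (root_prod M) = \<zero>"
proof -
  obtain p where p: "p \<noteq> 0" "ev x p = \<zero>" using assms(2) by (auto simp: algebraic_def)
  obtain M where M: "p = Polynomial.smult (lead_coeff p) (root_prod M)"
    using alg_closed_imp_factorization[OF p(1)] unfolding root_prod_def by blast
  have "root_prod M = Polynomial.smult (1 / lead_coeff p) p"
    using p(1) by (subst (2) M) simp
  then have "ev x (root_prod M) = \<zero>" using p(2) assms(1) by (simp add: ev_smult)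
  then show ?thesis using that by blast
qed

lemma ev_linear: "x \<in> carrier R \<Longrightarrow> ev x [:- \<mu>, 1:] = x \<ominus> \<mu> \<odot> \<one>"
  by (simp add: ev_pCons minus_eq minus_eq_smult smult_smult a_comm)

lemma linear_mult: "\<lbrakk>x \<in> carrier R; w \<in> carrier R\<rbrakk> \<Longrightarrow> (x \<ominus> \<mu> \<odot> \<one>) \<otimes> w = x \<otimes> w \<ominus> \<mu> \<odot> w"
  by (simp add: minus_mult_left smult_mult_left)

text \<open>The substitute for the spectral radius formula. For a root \<mu>, v = (x - \<mu>) w is
  annihilated by the remaining factors, and x^(m+1) w = x^m v + \<mu> x^m w is a recurrence whose
  solution stays within a multiple of d^m because |\<mu>| < d.\<close>

lemma pw_growth_bound:
  assumes x: "x \<in> carrier R" and M: "\<And>\<mu>. \<mu> \<in># M \<Longrightarrow> cmod \<mu> < d"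
    and w: "w \<in> carrier R" "ev x (root_prod M) \<otimes> w = \<zero>"
  shows "\<exists>C. \<forall>m. cnorm R (pw x m \<otimes> w) \<le> C * d ^ m"
  using M w
proof (induction M arbitrary: w)
  case empty
  then have "w = \<zero>" using x by simp
  then show ?case using x by (intro exI[of _ 0]) simp
next
  case (add \<mu> M)
  define v where "v = x \<otimes> w \<ominus> \<mu> \<odot> w"
  have v: "v \<in> carrier R" using x add.prems by (simp add: v_def)
  have "v = ev x [:- \<mu>, 1:] \<otimes> w"
    using x add.prems by (simp add: v_def ev_linear linear_mult)
  then have "ev x (root_prod M) \<otimes> v = ev x (root_prod (add_mset \<mu> M)) \<otimes> w"
    using x add.prems by (simp only: root_prod_add ev_mult ev_closed m_assoc[symmetric] ev_commute)
  then obtain C where C: "\<And>m. cnorm R (pw x m \<otimes> v) \<le> C * d ^ m"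
    using add.IH[OF _ v] add.prems by auto
  have \<mu>: "cmod \<mu> < d" using add.prems by simp
  then have d: "0 < d" using norm_ge_zero[of \<mu>] by linarith
  \<comment> \<open>The first summand serves m = 0; the second ensures C + |\<mu>| C' \<le> C' d,
    which is the induction step.\<close>
  define C' where "C' = cnorm R w + \<bar>C\<bar> / (d - cmod \<mu>)"
  have C': "\<bar>C\<bar> \<le> C' * (d - cmod \<mu>)"
  proof -
    have "C' * (d - cmod \<mu>) = cnorm R w * (d - cmod \<mu>) + \<bar>C\<bar>"
      using \<mu> by (simp add: C'_def distrib_right)
    moreover have "0 \<le> cnorm R w * (d - cmod \<mu>)"
      using \<mu> cnorm_nonneg[OF add.prems(2)] by simp
    ultimately show ?thesis by simp
  qed
  have "cnorm R (pw x m \<otimes> w) \<le> C' * d ^ m" for m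
  proof (induction m)
    case 0
    then show ?case using x add.prems(2) \<mu> by (simp add: C'_def)
  next
    case (Suc m)
    have "x \<otimes> w = v \<oplus> \<mu> \<odot> w" using x add.prems by (simp add: v_def diff_add_cancel)
    moreover have "pw x (Suc m) = pw x m \<otimes> x" using pw_add[OF x, of m 1] x by (simp add: pw_Suc)
    ultimately have "pw x (Suc m) \<otimes> w = pw x m \<otimes> v \<oplus> \<mu> \<odot> (pw x m \<otimes> w)"
      using x v add.prems by (simp add: m_assoc r_distr smult_mult_right)
    then have "cnorm R (pw x (Suc m) \<otimes> w) \<le> cnorm R (pw x m \<otimes> v) + cmod \<mu> * cnorm R (pw x m \<otimes> w)"
      using x v add.prems cnorm_triangle[of "pw x m \<otimes> v" "\<mu> \<odot> (pw x m \<otimes> w)"] by (simp add: cnorm_smult)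
    also have "\<dots> \<le> C * d ^ m + cmod \<mu> * (C' * d ^ m)"
      using C[of m] Suc by (intro add_mono mult_left_mono) auto
    also have "\<dots> = (C + cmod \<mu> * C') * d ^ m" by (simp add: algebra_simps)
    also have "\<dots> \<le> (C' * d) * d ^ m"
    proof (rule mult_right_mono)
      show "C + cmod \<mu> * C' \<le> C' * d" using C' abs_ge_self[of C] by (simp add: algebra_simps)
    qed (use d in simp)
    finally show ?case by simp
  qed
  then show ?case by blast
qed

end

section \<open>AF algebras and their ideals\<close>

text \<open>The subalgebras enter as subsets closed under the operations of \<open>R\<close>, so
  that all computations take place in one record.\<close>

locale af_algebra = nstar_algebra R for R :: "'a cstar" (structure) +
  fixes F :: "nat \<Rightarrow> 'a set"
  assumes cstar_id: "x \<in> carrier R \<Longrightarrow> cnorm R (star R x \<otimes> x) = (cnorm R x)\<^sup>2"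
    and F_carrier: "F n \<subseteq> carrier R"
    and F_mono_Suc: "F n \<subseteq> F (Suc n)"
    and F_add: "\<lbrakk>x \<in> F n; y \<in> F n\<rbrakk> \<Longrightarrow> x \<oplus> y \<in> F n"
    and F_mult: "\<lbrakk>x \<in> F n; y \<in> F n\<rbrakk> \<Longrightarrow> x \<otimes> y \<in> F n"
    and F_star: "x \<in> F n \<Longrightarrow> star R x \<in> F n"
    and F_smult: "x \<in> F n \<Longrightarrow> c \<odot> x \<in> F n"
    and F_one: "\<one> \<in> F n"
    and F_span: "\<exists>B. finite B \<and> B \<subseteq> F n \<and> (\<forall>x\<in>F n. \<exists>c. x = (\<Oplus>b\<in>B. c b \<odot> b))"
    and F_dense: "\<lbrakk>x \<in> carrier R; 0 < \<epsilon>\<rbrakk> \<Longrightarrow> \<exists>n. \<exists>y\<in>F n. cnorm R (x \<ominus> y) < \<epsilon>"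
begin

lemma F_mono: "m \<le> n \<Longrightarrow> F m \<subseteq> F n"
  by (rule lift_Suc_mono_le[of F, OF F_mono_Suc])

lemma F_carrierD: "x \<in> F n \<Longrightarrow> x \<in> carrier R"
  using F_carrier by blast

lemma F_zero: "\<zero> \<in> F n"
  using F_smult[OF F_one, of 0] by simp

lemma F_minus: "\<lbrakk>x \<in> F n; y \<in> F n\<rbrakk> \<Longrightarrow> x \<ominus> y \<in> F n"
  by (simp add: minus_eq minus_eq_smult F_carrierD F_add F_smult)

lemma F_ev: "x \<in> F n \<Longrightarrow> ev x p \<in> F n"
  by (induction p) (auto simp: ev_pCons F_carrierD F_zero F_add F_smult F_one F_mult)

lemma F_algebraic:
  assumes "x \<in> F n"
  shows "algebraic x"
proof -
  obtain B where B: "finite B" "B \<subseteq> F n" "\<forall>x\<in>F n. \<exists>c. x = (\<Oplus>b\<in>B. c b \<odot> b)"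
    using F_span[of n] by (elim exE conjE) (rule that)
  have "\<forall>i. \<exists>c. pw x i = (\<Oplus>b\<in>B. c b \<odot> b)" using B(3) F_ev[OF assms] by (simp add: pw_def)
  then obtain C where C: "\<And>i. pw x i = (\<Oplus>b\<in>B. C i b \<odot> b)" by metis
  have "B \<subseteq> carrier R" using B(2) F_carrier by blast
  \<comment> \<open>The range \<open>{..card B}\<close> has one element more than
    \<open>B\<close>.\<close>
  then have "\<exists>\<alpha>. (\<exists>i\<in>{..card B}. \<alpha> i \<noteq> 0) \<and> (\<Oplus>i\<in>{..card B}. \<alpha> i \<odot> pw x i) = \<zero>"
    using C by (intro span_dependent[OF B(1)]) auto
  then show ?thesis using algebraic_if_powers_dependent F_carrierD[OF assms] by blast
qed

lemma star_self_eq_zero: "x \<in> carrier R \<Longrightarrow> star R x \<otimes> x = \<zero> \<Longrightarrow> x = \<zero>"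
  using cstar_id[of x] cnorm_eq_0[of x] by simp

lemma cnorm_projection_le:
  assumes "e \<in> carrier R" "star R e = e" "e \<otimes> e = e"
  shows "cnorm R e \<le> 1"
proof -
  have "cnorm R e = (cnorm R e)\<^sup>2" using cstar_id[OF assms(1)] assms by simp
  then have "cnorm R e = 0 \<or> cnorm R e = 1" by (simp add: power2_eq_square)
  then show ?thesis by auto
qed

lemma cnorm_pw_two_power:
  assumes "x \<in> carrier R" "star R x = x"
  shows "cnorm R (pw x (2 ^ k)) = cnorm R x ^ (2 ^ k)"
proof (induction k)
  case 0
  then show ?case using assms by (simp add: pw_Suc)
next
  case (Suc k)
  have "pw x (2 ^ Suc k) = star R (pw x (2 ^ k)) \<otimes> pw x (2 ^ k)"
    using assms pw_add[of x "2 ^ k" "2 ^ k"] by (simp add: star_pw mult_2)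
  then show ?case using cstar_id[of "pw x (2 ^ k)"] assms Suc by (simp add: power_mult[symmetric] mult.commute)
qed

text \<open>If |x| / d exceeded 1, its powers of exponent 2^k would be unbounded. The bound is asked
  for \<open>0 < m\<close> only: in its use, for h f with a projection f, the zeroth power is the
  unit of the algebra and not f.\<close>

lemma cnorm_le_if_pw_bounded:
  assumes x: "x \<in> carrier R" "star R x = x" and d: "0 < d"
    and bound: "\<And>m. 0 < m \<Longrightarrow> cnorm R (pw x m) \<le> C * d ^ m"
  shows "cnorm R x \<le> d"
proof (rule ccontr)
  assume "\<not> cnorm R x \<le> d"
  then have t: "1 < cnorm R x / d" using d by simp
  then obtain k where k: "C < (cnorm R x / d) ^ k" using real_arch_pow by blast
  have "(cnorm R x / d) ^ k \<le> (cnorm R x / d) ^ (2 ^ k)"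
    using t by (intro power_increasing) (auto simp: less_imp_le)
  also have "\<dots> = cnorm R (pw x (2 ^ k)) / d ^ (2 ^ k)"
    using cnorm_pw_two_power[OF x] by (simp add: power_divide)
  also have "\<dots> \<le> C" using bound[of "2 ^ k"] d by (simp add: divide_le_eq)
  finally show False using k by simp
qed

end

locale af_ideal = af_algebra R F for R :: "'a cstar" (structure) and F :: "nat \<Rightarrow> 'a set" +
  fixes I :: "'a set"
  assumes ideal: "ideal I R"
    and closed: "\<lbrakk>x \<in> carrier R; \<And>\<epsilon>. 0 < \<epsilon> \<Longrightarrow> \<exists>y\<in>I. cnorm R (x \<ominus> y) < \<epsilon>\<rbrakk> \<Longrightarrow> x \<in> I"
begin

lemma I_carrier: "x \<in> I \<Longrightarrow> x \<in> carrier R"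
  using ideal.Icarr[OF ideal] .

lemma I_left: "\<lbrakk>x \<in> I; y \<in> carrier R\<rbrakk> \<Longrightarrow> y \<otimes> x \<in> I"
  and I_right: "\<lbrakk>x \<in> I; y \<in> carrier R\<rbrakk> \<Longrightarrow> x \<otimes> y \<in> I"
  using ideal.I_l_closed[OF ideal] ideal.I_r_closed[OF ideal] by auto

lemma I_minus: "\<lbrakk>x \<in> I; y \<in> I\<rbrakk> \<Longrightarrow> x \<ominus> y \<in> I"
  using ideal_minus_closed[OF ideal] .

lemma I_zero: "\<zero> \<in> I"
  using additive_subgroup.zero_closed[OF ideal.axioms(1)[OF ideal]] .

lemma I_add: "\<lbrakk>x \<in> I; y \<in> I\<rbrakk> \<Longrightarrow> x \<oplus> y \<in> I"
  using additive_subgroup.a_closed[OF ideal.axioms(1)[OF ideal]] .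

lemma I_smult: "x \<in> I \<Longrightarrow> c \<odot> x \<in> I"
  using I_left[of x "c \<odot> \<one>"] I_carrier[of x] by (simp add: smult_mult_left)

section \<open>Units of the ideals \<open>I \<inter> F n\<close>\<close>

lemma local_support_projection:
  assumes "g \<in> I \<inter> F n" "star R g = g"
  obtains e u where "e \<in> I \<inter> F n" "star R e = e" "e \<otimes> e = e" "g \<otimes> e = g" "e = u \<otimes> g" "u \<in> carrier R"
proof -
  have g: "g \<in> carrier R" using assms I_carrier by blast
  obtain r where r: "star R (g \<otimes> ev g r) = g \<otimes> ev g r"
    "(g \<otimes> ev g r) \<otimes> (g \<otimes> ev g r) = g \<otimes> ev g r" "g \<otimes> (g \<otimes> ev g r) = g"
    using support_projection[OF g assms(2)] F_algebraic star_self_eq_zero assms(1) by blast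
  have "g \<otimes> ev g r \<in> I \<inter> F n" using assms(1) g I_right F_mult F_ev by blast
  \<comment> \<open>The form e = u g is kept because it carries annihilation over: g w = 0 implies e
    w = 0.\<close>
  moreover have "g \<otimes> ev g r = ev g r \<otimes> g" using ev_commute_X[OF g] by simp
  ultimately show ?thesis using that r ev_closed[OF g] by blast
qed

text \<open>The length \<open>m\<close> plays the part of a rank of \<open>e\<close>: it is bounded
  in terms of \<open>F n\<close>, and a chain of maximal length has the unit of
  \<open>I \<inter> F n\<close> as its \<open>e\<close>.\<close>

definition orth_chain :: "nat \<Rightarrow> nat \<Rightarrow> 'a \<Rightarrow> (nat \<Rightarrow> 'a) \<Rightarrow> bool" where
  "orth_chain n m e q \<longleftrightarrow> e \<in> I \<inter> F n \<and> star R e = e \<and> e \<otimes> e = e \<and>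
    (\<forall>i<m. q i \<in> F n \<and> star R (q i) = q i \<and> q i \<otimes> q i = q i \<and> q i \<noteq> \<zero> \<and> e \<otimes> q i = q i) \<and>
    (\<forall>i<m. \<forall>j<m. i \<noteq> j \<longrightarrow> q i \<otimes> q j = \<zero>)"

text \<open>Nonzero orthogonal projections are linearly independent: multiplying a relation by
  \<open>q j\<close> isolates its j-th coefficient.\<close>

lemma orth_chain_length:
  assumes B: "finite B" "B \<subseteq> F n" "\<forall>x\<in>F n. \<exists>c. x = (\<Oplus>b\<in>B. c b \<odot> b)"
    and chain: "orth_chain n m e q"
  shows "m \<le> card B"
proof (rule ccontr)
  assume "\<not> m \<le> card B"
  have q: "q i \<in> F n" "q i \<in> carrier R" "q i \<otimes> q i = q i" "q i \<noteq> \<zero>" if "i < m" for i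
    using chain that F_carrierD unfolding orth_chain_def by blast+
  have "\<forall>i\<in>{..<m}. \<exists>c. q i = (\<Oplus>b\<in>B. c b \<odot> b)" using B(3) q by auto
  then obtain C where "\<And>i. i \<in> {..<m} \<Longrightarrow> q i = (\<Oplus>b\<in>B. C i b \<odot> b)" by metis
  then obtain \<alpha> j where \<alpha>: "j < m" "\<alpha> j \<noteq> 0" "(\<Oplus>i\<in>{..<m}. \<alpha> i \<odot> q i) = \<zero>"
    using span_dependent[of B "{..<m}" q C] B F_carrier \<open>\<not> m \<le> card B\<close> by fastforce
  have "\<zero> = q j \<otimes> (\<Oplus>i\<in>{..<m}. \<alpha> i \<odot> q i)" using \<alpha> q by simp
  also have "\<dots> = (\<Oplus>i\<in>{..<m}. q j \<otimes> (\<alpha> i \<odot> q i))"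
    using \<alpha>(1) q by (intro finsum_rdistr) auto
  also have "\<dots> = (\<Oplus>i\<in>{..<m}. if j = i then \<alpha> j \<odot> q j else \<zero>)"
    using \<alpha>(1) q chain by (intro finsum_cong' refl) (auto simp: smult_mult_right orth_chain_def)
  also have "\<dots> = \<alpha> j \<odot> q j"
    using \<alpha>(1) q by (intro add.finprod_singleton) auto
  finally have "\<alpha> j \<odot> q j = \<zero>" by simp
  then have "(1 / \<alpha> j) \<odot> (\<alpha> j \<odot> q j) = \<zero>" by simp
  then show False using \<alpha> q by (simp add: smult_smult)
qed

text \<open>If x e differs from x, then y = x - x e is nonzero with y e = 0. The support projection
  of star y y annihilates \<open>e\<close> as well, hence is orthogonal to it and can be added as a
  further link.\<close>

lemma orth_chain_extend:
  assumes chain: "orth_chain n m e q" and x: "x \<in> I \<inter> F n" "x \<otimes> e \<noteq> x"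
  shows "\<exists>e' q'. orth_chain n (Suc m) e' q'"
proof -
  have e: "e \<in> I" "e \<in> F n" "e \<in> carrier R" "star R e = e" "e \<otimes> e = e"
    using chain I_carrier by (auto simp: orth_chain_def)
  have q: "q i \<in> F n" "q i \<in> carrier R" "star R (q i) = q i" "q i \<otimes> q i = q i" "q i \<noteq> \<zero>" "e \<otimes> q i = q i"
    if "i < m" for i
    using chain that F_carrierD by (auto simp: orth_chain_def)
  have orth: "q i \<otimes> q j = \<zero>" if "i < m" "j < m" "i \<noteq> j" for i j
    using chain that by (auto simp: orth_chain_def)
  have xc: "x \<in> carrier R" using x I_carrier by blast
  define y where "y = x \<ominus> x \<otimes> e"
  have y: "y \<in> I" "y \<in> F n" "y \<in> carrier R" "y \<noteq> \<zero>"
    using x e xc I_minus I_right F_minus F_mult minus_eq_zero_iff[of x "x \<otimes> e"] unfolding y_def by auto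
  have ye: "y \<otimes> e = \<zero>" using xc e by (simp add: y_def minus_mult_left m_assoc minus_eq_zero_iff)
  define g where "g = star R y \<otimes> y"
  have g: "g \<in> I \<inter> F n" "star R g = g" "g \<in> carrier R"
    using y by (auto simp: g_def star_mult I_left F_mult F_star)
  have gne: "g \<noteq> \<zero>" using star_self_eq_zero[OF y(3)] y(4) unfolding g_def by blast
  obtain p u where p: "p \<in> I \<inter> F n" "star R p = p" "p \<otimes> p = p" "g \<otimes> p = g" "p = u \<otimes> g" "u \<in> carrier R"
    using local_support_projection[OF g(1,2)] by blast
  have pc: "p \<in> carrier R" using p I_carrier by blast
  have pne: "p \<noteq> \<zero>" using gne p(4) g by auto
  have pe: "p \<otimes> e = \<zero>" unfolding p(5) g_def using p y e ye by (simp add: m_assoc)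
  have ep: "e \<otimes> p = \<zero>" using arg_cong[OF pe, of "star R"] pc e p by (simp add: star_mult)
  have pq: "p \<otimes> q i = \<zero>" "q i \<otimes> p = \<zero>" if i: "i < m" for i
  proof -
    have "p \<otimes> q i = p \<otimes> (e \<otimes> q i)" using q[OF i] by simp
    also have "\<dots> = p \<otimes> e \<otimes> q i" using pc e q(2)[OF i] by (simp only: m_assoc)
    also have "\<dots> = \<zero>" using pe q(2)[OF i] by simp
    finally show 1: "p \<otimes> q i = \<zero>" .
    show "q i \<otimes> p = \<zero>" using arg_cong[OF 1, of "star R"] pc q[OF i] p by (simp add: star_mult)
  qed
  have "orth_chain n (Suc m) (e \<oplus> p) (q(m := p))"
    unfolding orth_chain_def
  proof (intro conjI allI impI)
    show "e \<oplus> p \<in> I \<inter> F n" using e p I_add F_add by blast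
    show "star R (e \<oplus> p) = e \<oplus> p" using e p pc by (simp add: star_add)
    show "(e \<oplus> p) \<otimes> (e \<oplus> p) = e \<oplus> p" using e p pc ep pe by (simp add: l_distr r_distr)
    fix i assume "i < Suc m"
    then have i: "i < m \<or> i = m" by auto
    show "(q(m := p)) i \<in> F n" "star R ((q(m := p)) i) = (q(m := p)) i"
      "(q(m := p)) i \<otimes> (q(m := p)) i = (q(m := p)) i" "(q(m := p)) i \<noteq> \<zero>"
      using i q p pne by auto
    show "(e \<oplus> p) \<otimes> (q(m := p)) i = (q(m := p)) i"
      using i q p pc e pq ep by (auto simp: l_distr)
    fix j assume "j < Suc m" "i \<noteq> j"
    then show "(q(m := p)) i \<otimes> (q(m := p)) j = \<zero>" using i orth pq by auto
  qed
  then show ?thesis by blast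
qed

lemma local_unit_exists:
  "\<exists>e. e \<in> I \<inter> F n \<and> star R e = e \<and> e \<otimes> e = e \<and> (\<forall>x\<in>I \<inter> F n. x \<otimes> e = x)"
proof -
  obtain B where B: "finite B" "B \<subseteq> F n" "\<forall>x\<in>F n. \<exists>c. x = (\<Oplus>b\<in>B. c b \<odot> b)"
    using F_span[of n] by (elim exE conjE) (rule that)
  have "orth_chain n 0 \<zero> (\<lambda>_. \<zero>)" using I_zero F_zero by (simp add: orth_chain_def)
  then have "\<exists>e q. orth_chain n 0 e q" by blast
  moreover have "\<forall>m. (\<exists>e q. orth_chain n m e q) \<longrightarrow> m \<le> card B" using orth_chain_length[OF B] by blast
  ultimately obtain m where m: "\<exists>e q. orth_chain n m e q" "\<forall>k. (\<exists>e q. orth_chain n k e q) \<longrightarrow> k \<le> m"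
    using ex_has_greatest_nat[of "\<lambda>m. \<exists>e q. orth_chain n m e q" 0 id "Suc (card B)"]
    by (auto simp: less_Suc_eq_le)
  then obtain e q where e: "orth_chain n m e q" by blast
  have "x \<otimes> e = x" if "x \<in> I \<inter> F n" for x
    using orth_chain_extend[OF e that] m(2) by (metis Suc_n_not_le_n)
  then show ?thesis using e by (auto simp: orth_chain_def)
qed

definition unit_of :: "nat \<Rightarrow> 'a" where
  "unit_of n = (SOME e. e \<in> I \<inter> F n \<and> star R e = e \<and> e \<otimes> e = e \<and> (\<forall>x\<in>I \<inter> F n. x \<otimes> e = x))"

lemma unit_of:
  shows unit_of_I: "unit_of n \<in> I" and unit_of_F: "unit_of n \<in> F n"
    and unit_of_carrier [simp]: "unit_of n \<in> carrier R"
    and unit_of_star: "star R (unit_of n) = unit_of n"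
    and unit_of_idem: "unit_of n \<otimes> unit_of n = unit_of n"
    and unit_of_right: "x \<in> I \<inter> F n \<Longrightarrow> x \<otimes> unit_of n = x"
proof -
  have *: "unit_of n \<in> I \<inter> F n \<and> star R (unit_of n) = unit_of n \<and> unit_of n \<otimes> unit_of n = unit_of n \<and>
      (\<forall>x\<in>I \<inter> F n. x \<otimes> unit_of n = x)"
    unfolding unit_of_def by (rule someI_ex[OF local_unit_exists])
  show "unit_of n \<in> I" "unit_of n \<in> F n" "unit_of n \<in> carrier R" "star R (unit_of n) = unit_of n"
    "unit_of n \<otimes> unit_of n = unit_of n" "x \<in> I \<inter> F n \<Longrightarrow> x \<otimes> unit_of n = x"
    using * I_carrier by auto
qed

text \<open>Taking adjoints in \<open>unit_of_right\<close> presupposes that star x belongs to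
  \<open>I\<close>, which is not known yet. It follows locally: the support projection p of x star x
  lies in \<open>I\<close> and satisfies star x = star x p.\<close>

lemma unit_of_left:
  assumes "x \<in> I \<inter> F n"
  shows "unit_of n \<otimes> x = x"
proof -
  have x: "x \<in> carrier R" using assms I_carrier by blast
  define h where "h = x \<otimes> star R x"
  have h: "h \<in> I \<inter> F n" "star R h = h" "h \<in> carrier R"
    using assms x by (auto simp: h_def star_mult I_right F_mult F_star)
  obtain p u where p: "p \<in> I \<inter> F n" "star R p = p" "p \<otimes> p = p" "h \<otimes> p = h"
    using local_support_projection[OF h(1,2)] by metis
  have pc: "p \<in> carrier R" using p I_carrier by blast
  have "star R (h \<otimes> p) = p \<otimes> h" using h(2,3) pc p(2) by (simp add: star_mult)
  then have ph: "p \<otimes> h = h" using p(4) h(2) by simp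
  define y where "y = star R x \<ominus> star R x \<otimes> p"
  have yc: "y \<in> carrier R" using x pc by (simp add: y_def)
  have "star R y \<otimes> y = (x \<ominus> p \<otimes> x) \<otimes> (star R x \<ominus> star R x \<otimes> p)"
    using x pc p by (simp add: y_def star_diff star_mult)
  also have "\<dots> = (h \<ominus> h \<otimes> p) \<ominus> (p \<otimes> h \<ominus> p \<otimes> h \<otimes> p)"
    using x pc by (simp add: minus_mult_left) (simp add: h_def minus_mult_right m_assoc)
  also have "\<dots> = \<zero>" using h pc p ph by (simp add: minus_eq r_neg)
  finally have "y = \<zero>" using star_self_eq_zero yc by blast
  then have "star R x = star R x \<otimes> p" using minus_eq_zero_iff x pc by (simp add: y_def)
  then have "star R x \<in> I \<inter> F n" using p x I_left[of p "star R x"] F_star assms by auto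
  from arg_cong[OF unit_of_right[OF this], of "star R"] show ?thesis
    using x by (simp add: star_mult unit_of_star)
qed

text \<open>Both sides equal e y e, because y e and e y lie in
  \<open>I \<inter> F n\<close>.\<close>

lemma unit_of_central:
  assumes "y \<in> F n"
  shows "y \<otimes> unit_of n = unit_of n \<otimes> y"
proof -
  have y: "y \<in> carrier R" using assms F_carrierD by blast
  have "y \<otimes> unit_of n \<in> I \<inter> F n" "unit_of n \<otimes> y \<in> I \<inter> F n"
    using y assms by (auto simp: I_left I_right unit_of_I unit_of_F F_mult)
  from unit_of_left[OF this(1)] unit_of_right[OF this(2)] show ?thesis
    using y by (simp add: m_assoc)
qed

section \<open>Complements of the local units and the distance to \<open>I\<close>\<close>

abbreviation co_unit :: "nat \<Rightarrow> 'a" where "co_unit n \<equiv> \<one> \<ominus> unit_of n"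

lemma co_unit_star: "star R (co_unit n) = co_unit n"
  by (simp add: star_diff unit_of_star)

lemma co_unit_idem: "co_unit n \<otimes> co_unit n = co_unit n"
proof -
  have "unit_of n \<otimes> co_unit n = \<zero>" by (simp add: minus_mult_right unit_of_idem minus_eq_zero_iff)
  then have "co_unit n \<otimes> co_unit n = co_unit n \<ominus> \<zero>" by (simp add: minus_mult_left)
  then show ?thesis by (simp add: minus_eq)
qed

lemma cnorm_co_unit_le: "cnorm R (co_unit n) \<le> 1"
  by (intro cnorm_projection_le) (simp_all add: co_unit_star co_unit_idem)

lemma cnorm_unit_of_le: "cnorm R (unit_of n) \<le> 1"
  by (intro cnorm_projection_le) (simp_all add: unit_of_star unit_of_idem)

lemma co_unit_kills: "x \<in> I \<inter> F n \<Longrightarrow> x \<otimes> co_unit n = \<zero>"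
  using I_carrier by (simp add: minus_mult_right unit_of_right minus_eq_zero_iff)

text \<open>Modulo \<open>I\<close>, the element \<open>h\<close> has norm less than \<open>d\<close>, so \<open>h - \<mu>\<close> is invertible there.\<close>

lemma cancel_large_root:
  assumes h: "h \<in> carrier R" and y: "y \<in> I" "cnorm R (h \<ominus> y) < d"
    and \<mu>: "d \<le> cmod \<mu>" and w: "w \<in> carrier R" "h \<otimes> w \<ominus> \<mu> \<odot> w \<in> I"
  shows "w \<in> I"
proof (rule closed[OF w(1)])
  have yc: "y \<in> carrier R" using y I_carrier by blast
  have d: "0 < d" using cnorm_nonneg[of "h \<ominus> y"] h yc y(2) by simp
  then have \<mu>0: "0 < cmod \<mu>" "\<mu> \<noteq> 0" using \<mu> by auto
  define \<rho> where "\<rho> = cnorm R (h \<ominus> y) / cmod \<mu>"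
  have \<rho>: "0 \<le> \<rho>" "\<rho> < 1" using cnorm_nonneg[of "h \<ominus> y"] h yc y(2) \<mu> \<mu>0 by (auto simp: \<rho>_def)
  have rearrange: "a \<oplus> b \<ominus> c \<ominus> e = b \<ominus> (c \<oplus> e \<ominus> a)"
    if "a \<in> carrier R" "b \<in> carrier R" "c \<in> carrier R" "e \<in> carrier R" for a b c e
    using that by (simp add: minus_eq minus_add a_ac)
  \<comment> \<open>The Neumann series for the inverse of h - \<mu> modulo \<open>I\<close>,
    unrolled: an approximation of w by an element v of \<open>I\<close> is improved by the factor
    \<rho>, the ratio of the norm of h - y to |\<mu>|.\<close>
  have "\<exists>v\<in>I. cnorm R (w \<ominus> v) \<le> \<rho> ^ k * cnorm R w" for k
  proof (induction k)
    case 0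
    then show ?case using w by (intro bexI[OF _ I_zero]) (simp add: minus_eq)
  next
    case (Suc k)
    then obtain v where v: "v \<in> I" "cnorm R (w \<ominus> v) \<le> \<rho> ^ k * cnorm R w" by blast
    have vc: "v \<in> carrier R" using v I_carrier by blast
    define u where "u = h \<otimes> w \<ominus> \<mu> \<odot> w"
    have uc: "u \<in> carrier R" using w h by (simp add: u_def)
    have hw: "h \<otimes> w = u \<oplus> \<mu> \<odot> w" using w h by (simp add: u_def diff_add_cancel)
    \<comment> \<open>Collects the terms in \<open>I\<close>, so that (h - y) (w - v) = \<mu> w -
      v'.\<close>
    define v' where "v' = h \<otimes> v \<oplus> y \<otimes> (w \<ominus> v) \<ominus> u"
    have v': "v' \<in> I" "v' \<in> carrier R"
      using v y w h vc yc I_left I_right I_add I_minus uc unfolding v'_def u_def by auto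
    have "(h \<ominus> y) \<otimes> (w \<ominus> v) = \<mu> \<odot> w \<ominus> v'"
    proof -
      have "(h \<ominus> y) \<otimes> (w \<ominus> v) = h \<otimes> (w \<ominus> v) \<ominus> y \<otimes> (w \<ominus> v)"
        using h yc w vc by (intro minus_mult_left) auto
      also have "h \<otimes> (w \<ominus> v) = u \<oplus> \<mu> \<odot> w \<ominus> h \<otimes> v"
        unfolding minus_mult_right[OF w(1) vc h] hw ..
      also have "u \<oplus> \<mu> \<odot> w \<ominus> h \<otimes> v \<ominus> y \<otimes> (w \<ominus> v) = \<mu> \<odot> w \<ominus> v'"
        unfolding v'_def using h yc w(1) vc uc by (intro rearrange) auto
      finally show ?thesis .
    qed
    then have "(1 / \<mu>) \<odot> ((h \<ominus> y) \<otimes> (w \<ominus> v)) = w \<ominus> (1 / \<mu>) \<odot> v'"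
      using w v' \<mu>0 by (simp add: minus_eq smult_r_distr smult_smult minus_eq_smult)
    then have "cnorm R (w \<ominus> (1 / \<mu>) \<odot> v') = cnorm R ((h \<ominus> y) \<otimes> (w \<ominus> v)) / cmod \<mu>"
      using h yc w vc by (metis (no_types, lifting) cnorm_smult m_closed minus_closed norm_divide norm_one mult_1 times_divide_eq_left)
    also have "\<dots> \<le> cnorm R (h \<ominus> y) * (\<rho> ^ k * cnorm R w) / cmod \<mu>"
      using h yc w vc v \<mu>0 by (intro divide_right_mono cnorm_mult_le) auto
    also have "\<dots> = \<rho> ^ Suc k * cnorm R w" by (simp add: \<rho>_def)
    finally show ?case using I_smult[OF v'(1)] by blast
  qed
  moreover fix \<epsilon> :: real assume "0 < \<epsilon>"
  have "(\<lambda>k. \<rho> ^ k * cnorm R w) \<longlonglongrightarrow> 0 * cnorm R w"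
    using \<rho> by (intro tendsto_intros LIMSEQ_power_zero) auto
  then have "\<forall>\<^sub>F k in sequentially. \<rho> ^ k * cnorm R w < \<epsilon>"
    using \<open>0 < \<epsilon>\<close> by (intro order_tendstoD(2)) auto
  from eventually_happens'[OF sequentially_bot this]
  obtain k where "\<rho> ^ k * cnorm R w < \<epsilon>" ..
  ultimately show "\<exists>v\<in>I. cnorm R (w \<ominus> v) < \<epsilon>" by (meson le_less_trans)
qed

text \<open>The roots of modulus at least \<open>d\<close> are cancelled one by one;
  \<open>r\<close> accumulates the factors of the small roots already passed.\<close>

lemma small_roots_in_ideal:
  assumes h: "h \<in> carrier R" and y: "y \<in> I" "cnorm R (h \<ominus> y) < d"
    and "ev h (root_prod M * r) \<in> I"
  shows "ev h (root_prod (filter_mset (\<lambda>\<mu>. cmod \<mu> < d) M) * r) \<in> I"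
  using assms(4)
proof (induction M arbitrary: r)
  case (add \<mu> M)
  show ?case
  proof (cases "cmod \<mu> < d")
    case True
    have "ev h (root_prod M * ([:- \<mu>, 1:] * r)) \<in> I"
      using add.prems by (simp only: root_prod_add mult.assoc mult.left_commute)
    from add.IH[OF this] show ?thesis
      using True by (simp only: filter_mset_add_mset if_True root_prod_add mult.assoc mult.left_commute)
  next
    case False
    have "ev h (root_prod (add_mset \<mu> M) * r) = h \<otimes> ev h (root_prod M * r) \<ominus> \<mu> \<odot> ev h (root_prod M * r)"
      unfolding root_prod_add mult.assoc using h by (simp only: ev_mult[of h "[:- \<mu>, 1:]"] ev_linear linear_mult ev_closed)
    then have "h \<otimes> ev h (root_prod M * r) \<ominus> \<mu> \<odot> ev h (root_prod M * r) \<in> I"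
      using add.prems by (simp only:)
    then have "ev h (root_prod M * r) \<in> I"
      using False by (intro cancel_large_root[OF h y _ ev_closed[OF h]]) simp_all
    from add.IH[OF this] show ?thesis
      using False by (simp only: filter_mset_add_mset if_False)
  qed
qed simp

text \<open>The factors of the roots below \<open>d\<close> multiply to an element of
  \<open>I \<inter> F n\<close>, which the complement 1 - e_n kills. Hence the powers of h (1 - e_n)
  grow at most like d^m, and this element, being self-adjoint, has norm at most
  \<open>d\<close>.\<close>

lemma cnorm_mult_co_unit_le:
  assumes h: "h \<in> F n" "star R h = h" and y: "y \<in> I" "cnorm R (h \<ominus> y) < d"
  shows "cnorm R (h \<otimes> co_unit n) \<le> d"
proof -
  let ?f = "co_unit n"
  have hc: "h \<in> carrier R" using h F_carrierD by blast
  have yc: "y \<in> carrier R" using y I_carrier by blast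
  have d: "0 < d" using cnorm_nonneg[of "h \<ominus> y"] hc yc y(2) by simp
  obtain M where M: "ev h (root_prod M) = \<zero>" using algebraic_root_prod[OF hc F_algebraic[OF h(1)]] .
  define N where "N = filter_mset (\<lambda>\<mu>. cmod \<mu> < d) M"
  have "ev h (root_prod N) \<in> I \<inter> F n"
    using small_roots_in_ideal[OF hc y, of M 1] M I_zero F_ev[OF h(1)] by (simp add: N_def)
  then have "ev h (root_prod N) \<otimes> ?f = \<zero>" by (rule co_unit_kills)
  then obtain C where C: "\<And>m. cnorm R (pw h m \<otimes> ?f) \<le> C * d ^ m"
    using pw_growth_bound[OF hc, of N d ?f] by (auto simp: N_def)
  have comm: "h \<otimes> ?f = ?f \<otimes> h"
    using hc unit_of_central[OF h(1)] by (simp add: minus_mult_left minus_mult_right)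
  have pw: "pw (h \<otimes> ?f) (Suc m) = pw h (Suc m) \<otimes> ?f" for m
  proof (induction m)
    case 0 then show ?case using hc by (simp add: pw_Suc)
  next
    case (Suc m)
    have "pw (h \<otimes> ?f) (Suc (Suc m)) = h \<otimes> ?f \<otimes> (pw h (Suc m) \<otimes> ?f)"
      using pw_Suc[of "h \<otimes> ?f" "Suc m"] hc by (simp only: Suc m_closed minus_closed one_closed unit_of_carrier)
    also have "pw h (Suc m) = h \<otimes> pw h m" using hc by (simp add: pw_Suc)
    also have "h \<otimes> ?f \<otimes> (h \<otimes> pw h m \<otimes> ?f) = h \<otimes> (?f \<otimes> h \<otimes> pw h m) \<otimes> ?f"
      using hc by (simp add: m_assoc)
    also have "?f \<otimes> h \<otimes> pw h m = pw h (Suc m) \<otimes> ?f"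
    proof -
      have "pw h k \<otimes> ?f = ?f \<otimes> pw h k" for k
      proof (induction k)
        case (Suc k)
        have "pw h (Suc k) \<otimes> ?f = h \<otimes> ?f \<otimes> pw h k" using hc Suc by (simp add: pw_Suc m_assoc)
        then show ?case using hc comm by (simp add: pw_Suc m_assoc)
      qed (use hc in simp)
      from this[of "Suc m"] show ?thesis using hc by (simp add: pw_Suc m_assoc)
    qed
    also have "h \<otimes> (pw h (Suc m) \<otimes> ?f) \<otimes> ?f = pw h (Suc (Suc m)) \<otimes> ?f"
      using hc co_unit_idem[of n] by (simp add: pw_Suc[of h "Suc m"] m_assoc)
    finally show ?case .
  qed
  show ?thesis
  proof (rule cnorm_le_if_pw_bounded[OF _ _ d])
    show "h \<otimes> ?f \<in> carrier R" using hc by simp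
    show "star R (h \<otimes> ?f) = h \<otimes> ?f" using hc h comm by (simp add: star_mult co_unit_star)
    show "cnorm R (pw (h \<otimes> ?f) m) \<le> C * d ^ m" if "0 < m" for m
      using pw[of "m - 1"] C[of m] that by simp
  qed
qed

section \<open>The approximate unit and what it yields\<close>

lemma approximate_unit:
  assumes x: "x \<in> I" and \<epsilon>: "0 < \<epsilon>"
  shows "\<forall>\<^sub>F n in sequentially. cnorm R (x \<otimes> co_unit n) < \<epsilon>"
proof -
  have xc: "x \<in> carrier R" using x I_carrier by blast
  have xn: "0 \<le> cnorm R x" using cnorm_nonneg xc by blast
  define d where "d = (\<epsilon> / 2)\<^sup>2"
  have d: "0 < d" using \<epsilon> by (simp add: d_def)
  \<comment> \<open>The first bound gives |y| \<le> |x| + 1, the second absorbs the norm of (x - y)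
    f, and the third brings star y y within d = (\<epsilon>/2)^2 of the element star y x of
    \<open>I\<close>.\<close>
  define \<delta> where "\<delta> = min (min 1 (\<epsilon> / 4)) (d / (2 * (cnorm R x + 1)))"
  have \<delta>: "0 < \<delta>" "\<delta> \<le> 1" "\<delta> \<le> \<epsilon> / 4" "(cnorm R x + 1) * \<delta> < d"
  proof -
    have "\<delta> \<le> d / (2 * (cnorm R x + 1))" by (simp add: \<delta>_def)
    then have "(cnorm R x + 1) * \<delta> \<le> d / 2" using xn by (simp add: field_simps)
    then show "(cnorm R x + 1) * \<delta> < d" using d by linarith
    show "\<delta> \<le> \<epsilon> / 4" unfolding \<delta>_def by linarith
  qed (use \<epsilon> d xn in \<open>auto simp: \<delta>_def\<close>)
  obtain n0 y where y: "y \<in> F n0" "cnorm R (x \<ominus> y) < \<delta>" using F_dense[OF xc \<delta>(1)] by blast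
  have yc: "y \<in> carrier R" using y F_carrierD by blast
  have "cnorm R (x \<otimes> co_unit n) < \<epsilon>" if n: "n0 \<le> n" for n
  proof -
    let ?f = "co_unit n"
    have yn: "y \<in> F n" using y F_mono[OF n] by blast
    have ynorm: "cnorm R y \<le> cnorm R x + 1"
      using cnorm_le_diff_add[OF yc xc] cnorm_diff_commute[OF xc yc] y(2) \<delta> by linarith
    have "star R y \<otimes> y \<ominus> star R y \<otimes> x = star R y \<otimes> (y \<ominus> x)"
      using xc yc by (simp add: minus_mult_right)
    then have "cnorm R (star R y \<otimes> y \<ominus> star R y \<otimes> x) \<le> (cnorm R x + 1) * \<delta>"
      using xc yc ynorm y(2) cnorm_diff_commute[OF xc yc]
        cnorm_mult_le[of "star R y" "y \<ominus> x" "cnorm R x + 1" \<delta>] by (simp add: cnorm_star)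
    then have "cnorm R ((star R y \<otimes> y) \<otimes> ?f) \<le> d"
      using \<delta> yn yc x I_left
      by (intro cnorm_mult_co_unit_le[of _ _ "star R y \<otimes> x"]) (auto simp: star_mult F_mult F_star)
    then have "1 * d \<ge> cnorm R ?f * cnorm R ((star R y \<otimes> y) \<otimes> ?f)"
      using cnorm_co_unit_le[of n] yc by (intro mult_mono cnorm_nonneg) auto
    \<comment> \<open>\<open>cnorm_mult_co_unit_le\<close> applies to self-adjoint elements; the
      C*-identity leads from star y y back to y.\<close>
    moreover have "(cnorm R (y \<otimes> ?f))\<^sup>2 = cnorm R (?f \<otimes> ((star R y \<otimes> y) \<otimes> ?f))"
      using cstar_id[of "y \<otimes> ?f"] yc by (simp add: star_mult co_unit_star m_assoc)
    ultimately have "(cnorm R (y \<otimes> ?f))\<^sup>2 \<le> d"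
      using cnorm_mult[of ?f "(star R y \<otimes> y) \<otimes> ?f"] yc by simp
    then have yf: "cnorm R (y \<otimes> ?f) \<le> \<epsilon> / 2"
      unfolding d_def using \<epsilon> by (simp add: power2_le_iff_abs_le)
    have "cnorm R ((x \<ominus> y) \<otimes> ?f) \<le> \<delta> * 1"
      using xc yc y(2) cnorm_co_unit_le by (intro cnorm_mult_le) auto
    moreover have "x \<otimes> ?f \<ominus> y \<otimes> ?f = (x \<ominus> y) \<otimes> ?f" using xc yc by (simp add: minus_mult_left)
    ultimately have "cnorm R (x \<otimes> ?f) \<le> \<delta> + cnorm R (y \<otimes> ?f)"
      using cnorm_le_diff_add[of "x \<otimes> ?f" "y \<otimes> ?f"] xc yc by simp
    then show ?thesis using yf \<delta> \<epsilon> by linarith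
  qed
  then show ?thesis unfolding eventually_sequentially by blast
qed

text \<open>An element of \<open>F n0\<close> commutes exactly with every \<open>unit_of n\<close>
  for n0 \<le> n, and such elements are dense.\<close>

lemma approximately_central:
  assumes x: "x \<in> carrier R" and \<epsilon>: "0 < \<epsilon>"
  shows "\<forall>\<^sub>F n in sequentially. cnorm R (x \<otimes> unit_of n \<ominus> unit_of n \<otimes> x) < \<epsilon>"
proof -
  obtain n0 y where y: "y \<in> F n0" "cnorm R (x \<ominus> y) < \<epsilon> / 2" using F_dense[OF x, of "\<epsilon> / 2"] \<epsilon> by auto
  have yc: "y \<in> carrier R" using y F_carrierD by blast
  have "cnorm R (x \<otimes> unit_of n \<ominus> unit_of n \<otimes> x) < \<epsilon>" if n: "n0 \<le> n" for n
  proof -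
    let ?e = "unit_of n"
    have c: "y \<otimes> ?e = ?e \<otimes> y" using unit_of_central y F_mono[OF n] by blast
    have 1: "x \<otimes> ?e \<ominus> ?e \<otimes> x = (x \<otimes> ?e \<ominus> y \<otimes> ?e) \<oplus> (?e \<otimes> y \<ominus> ?e \<otimes> x)"
      using x yc diff_split[of "x \<otimes> ?e" "y \<otimes> ?e" "?e \<otimes> x"] c by simp
    have 2: "cnorm R (x \<otimes> ?e \<ominus> y \<otimes> ?e) \<le> cnorm R (x \<ominus> y) * 1"
      unfolding minus_mult_left[OF x yc unit_of_carrier, symmetric]
      using x yc cnorm_unit_of_le by (intro cnorm_mult_le) auto
    have 3: "cnorm R (?e \<otimes> y \<ominus> ?e \<otimes> x) \<le> 1 * cnorm R (x \<ominus> y)"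
      unfolding minus_mult_right[OF yc x unit_of_carrier, symmetric]
      using x yc cnorm_unit_of_le cnorm_diff_commute[OF x yc] by (intro cnorm_mult_le) auto
    show ?thesis unfolding 1 using 2 3 y(2) x yc
        cnorm_triangle[of "x \<otimes> ?e \<ominus> y \<otimes> ?e" "?e \<otimes> y \<ominus> ?e \<otimes> x"] by simp
  qed
  then show ?thesis unfolding eventually_sequentially by blast
qed

text \<open>star x is the limit of e_n star x, the adjoints of x e_n, and these lie in
  \<open>I\<close> because e_n does.\<close>

lemma ideal_star_closed:
  assumes x: "x \<in> I"
  shows "star R x \<in> I"
proof (rule closed)
  have xc: "x \<in> carrier R" using x I_carrier by blast
  then show "star R x \<in> carrier R" by simp
  fix \<epsilon> :: real assume "0 < \<epsilon>"
  from eventually_happens'[OF sequentially_bot approximate_unit[OF x this]]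
  obtain n where n: "cnorm R (x \<otimes> co_unit n) < \<epsilon>" ..
  have "star R (x \<otimes> co_unit n) = star R x \<ominus> unit_of n \<otimes> star R x"
    using xc by (simp add: star_mult co_unit_star minus_mult_left)
  then have "cnorm R (star R x \<ominus> unit_of n \<otimes> star R x) < \<epsilon>"
    using n xc cnorm_star[of "x \<otimes> co_unit n"] by simp
  then show "\<exists>y\<in>I. cnorm R (star R x \<ominus> y) < \<epsilon>"
    using I_right[OF unit_of_I] xc by blast
qed

lemma ideal_trivial_if_no_projections:
  assumes "\<And>e. e \<in> I \<Longrightarrow> star R e = e \<Longrightarrow> e \<otimes> e = e \<Longrightarrow> e = \<zero>"
  shows "I = {\<zero>}"
proof -
  have "x = \<zero>" if x: "x \<in> I" for x
  proof (rule ccontr)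
    have xc: "x \<in> carrier R" using x I_carrier by blast
    assume "x \<noteq> \<zero>"
    then have "0 < cnorm R x" using cnorm_eq_0 cnorm_nonneg xc by (simp add: order_less_le)
    from eventually_happens'[OF sequentially_bot approximate_unit[OF x this]]
    obtain n where n: "cnorm R (x \<otimes> co_unit n) < cnorm R x" ..
    have "unit_of n = \<zero>" using assms unit_of by blast
    then show False using n xc by (simp add: minus_eq)
  qed
  then show ?thesis using I_zero by blast
qed

end

section \<open>Matrix algebras\<close>

text \<open>The sum of the norms of the entries is submultiplicative and invariant under the
  adjoint, and convergence in it is entrywise.\<close>

definition mat_alg :: "'a cstar \<Rightarrow> nat \<Rightarrow> 'a mat cstar" where
  "mat_alg A k =
    \<lparr>carrier = amat A k k, monoid.mult = amult A,
     one = Matrix.mat k k (\<lambda>(i, j). if i = j then \<one>\<^bsub>A\<^esub> else \<zero>\<^bsub>A\<^esub>),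
     ring.zero = Matrix.mat k k (\<lambda>_. \<zero>\<^bsub>A\<^esub>),
     add = (\<lambda>a b. Matrix.mat k k (\<lambda>(i, j). a $$ (i, j) \<oplus>\<^bsub>A\<^esub> b $$ (i, j))),
     module.smult = (\<lambda>c a. Matrix.mat k k (\<lambda>(i, j). c \<odot>\<^bsub>A\<^esub> a $$ (i, j))),
     star = aadj A,
     cnorm = (\<lambda>a. \<Sum>i<k. \<Sum>j<k. cnorm A (a $$ (i, j)))\<rparr>"

lemma mat_alg_simps:
  "carrier (mat_alg A k) = amat A k k"
  "a \<otimes>\<^bsub>mat_alg A k\<^esub> b = amult A a b"
  "\<one>\<^bsub>mat_alg A k\<^esub> = Matrix.mat k k (\<lambda>(i, j). if i = j then \<one>\<^bsub>A\<^esub> else \<zero>\<^bsub>A\<^esub>)"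
  "\<zero>\<^bsub>mat_alg A k\<^esub> = Matrix.mat k k (\<lambda>_. \<zero>\<^bsub>A\<^esub>)"
  "a \<oplus>\<^bsub>mat_alg A k\<^esub> b = Matrix.mat k k (\<lambda>(i, j). a $$ (i, j) \<oplus>\<^bsub>A\<^esub> b $$ (i, j))"
  "c \<odot>\<^bsub>mat_alg A k\<^esub> a = Matrix.mat k k (\<lambda>(i, j). c \<odot>\<^bsub>A\<^esub> a $$ (i, j))"
  "star (mat_alg A k) a = aadj A a"
  "cnorm (mat_alg A k) a = (\<Sum>i<k. \<Sum>j<k. cnorm A (a $$ (i, j)))"
  by (simp_all add: mat_alg_def)

lemma amat_eqI:
  assumes "a \<in> amat R m n" "b \<in> amat R m n" "\<And>i j. i < m \<Longrightarrow> j < n \<Longrightarrow> a $$ (i, j) = b $$ (i, j)"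
  shows "a = b"
  using assms by (intro eq_matI) (auto simp: amatD)

context nstar_algebra begin

lemma cnorm_finsum_le:
  assumes "finite S" "f \<in> S \<rightarrow> carrier R"
  shows "cnorm R (finsum R f S) \<le> (\<Sum>k\<in>S. cnorm R (f k))"
  using assms
proof (induction S rule: finite_induct)
  case (insert k S)
  then have f: "f k \<in> carrier R" "f \<in> S \<rightarrow> carrier R" by auto
  then show ?case
    using insert cnorm_triangle[OF f(1) finsum_closed[OF f(2)]] by (simp add: finsum_insert)
qed (simp add: finsum_empty)

abbreviation M :: "nat \<Rightarrow> 'a mat cstar" where "M k \<equiv> mat_alg R k"

lemma amult_scalar_right:
  assumes "a \<in> amat R k k" "u \<in> carrier R" "i < k" "j < k"
  shows "amult R a (Matrix.mat k k (\<lambda>(i, j). if i = j then u else \<zero>)) $$ (i, j) = a $$ (i, j) \<otimes> u"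
proof -
  note [simp] = amatD[OF assms(1)]
  have "amult R a (Matrix.mat k k (\<lambda>(i, j). if i = j then u else \<zero>)) $$ (i, j) =
      (\<Oplus>l\<in>{..<k}. if j = l then a $$ (i, j) \<otimes> u else \<zero>)"
    using assms by (simp add: amult_index) (intro finsum_cong' refl, auto)
  also have "\<dots> = a $$ (i, j) \<otimes> u" using assms by (intro add.finprod_singleton) auto
  finally show ?thesis .
qed

lemma amult_scalar_left:
  assumes "a \<in> amat R k k" "u \<in> carrier R" "i < k" "j < k"
  shows "amult R (Matrix.mat k k (\<lambda>(i, j). if i = j then u else \<zero>)) a $$ (i, j) = u \<otimes> a $$ (i, j)"
proof -
  note [simp] = amatD[OF assms(1)]
  have "amult R (Matrix.mat k k (\<lambda>(i, j). if i = j then u else \<zero>)) a $$ (i, j) =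
      (\<Oplus>l\<in>{..<k}. if i = l then u \<otimes> a $$ (i, j) else \<zero>)"
    using assms by (simp add: amult_index) (intro finsum_cong' refl, auto)
  also have "\<dots> = u \<otimes> a $$ (i, j)" using assms by (intro add.finprod_singleton) auto
  finally show ?thesis .
qed

lemma mat_alg_ring: "ring (M k)"
proof (rule ringI)
  show "abelian_group (M k)"
  proof (rule abelian_groupI)
    fix x assume x: "x \<in> carrier (M k)"
    show "\<exists>y\<in>carrier (M k). y \<oplus>\<^bsub>M k\<^esub> x = \<zero>\<^bsub>M k\<^esub>"
      using x by (intro bexI[of _ "Matrix.mat k k (\<lambda>(i, j). \<ominus> (x $$ (i, j)))"])
        (auto simp: mat_alg_simps l_neg amatD intro!: amatI eq_matI)
  qed (auto simp: mat_alg_simps amatD a_ac intro!: amatI eq_matI)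
  show "monoid (M k)"
  proof (rule monoidI)
    fix x assume x: "x \<in> carrier (M k)"
    have 1: "\<one>\<^bsub>M k\<^esub> \<in> amat R k k" by (auto simp: mat_alg_simps intro!: amatI)
    show "\<one>\<^bsub>M k\<^esub> \<otimes>\<^bsub>M k\<^esub> x = x" "x \<otimes>\<^bsub>M k\<^esub> \<one>\<^bsub>M k\<^esub> = x"
      using x 1 by (auto simp: mat_alg_simps amult_scalar_left amult_scalar_right amatD intro!: amat_eqI[of _ R k k])
    fix y z assume yz: "y \<in> carrier (M k)" "z \<in> carrier (M k)"
    show "x \<otimes>\<^bsub>M k\<^esub> y \<in> carrier (M k)" using x yz by (auto simp: mat_alg_simps)
    show "x \<otimes>\<^bsub>M k\<^esub> y \<otimes>\<^bsub>M k\<^esub> z = x \<otimes>\<^bsub>M k\<^esub> (y \<otimes>\<^bsub>M k\<^esub> z)"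
      using x yz by (auto simp: mat_alg_simps amult_assoc)
  qed (auto simp: mat_alg_simps intro!: amatI)
next
  fix x y z assume "x \<in> carrier (M k)" "y \<in> carrier (M k)" "z \<in> carrier (M k)"
  then have *: "x \<in> amat R k k" "y \<in> amat R k k" "z \<in> amat R k k" by (auto simp: mat_alg_simps)
  note [simp] = amatD[OF *(1)] amatD[OF *(2)] amatD[OF *(3)]
  have d: "x $$ (i, l) \<otimes> z $$ (l, j) \<in> carrier R" "y $$ (i, l) \<otimes> z $$ (l, j) \<in> carrier R"
    "z $$ (i, l) \<otimes> x $$ (l, j) \<in> carrier R" "z $$ (i, l) \<otimes> y $$ (l, j) \<in> carrier R"
    if "i < k" "j < k" "l < k" for i j l using that by auto
  show "(x \<oplus>\<^bsub>M k\<^esub> y) \<otimes>\<^bsub>M k\<^esub> z = x \<otimes>\<^bsub>M k\<^esub> z \<oplus>\<^bsub>M k\<^esub> y \<otimes>\<^bsub>M k\<^esub> z"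
  proof (rule eq_matI)
    fix i j assume "i < dim_row (x \<otimes>\<^bsub>M k\<^esub> z \<oplus>\<^bsub>M k\<^esub> y \<otimes>\<^bsub>M k\<^esub> z)"
      "j < dim_col (x \<otimes>\<^bsub>M k\<^esub> z \<oplus>\<^bsub>M k\<^esub> y \<otimes>\<^bsub>M k\<^esub> z)"
    then have ij: "i < k" "j < k" by (auto simp: mat_alg_simps)
    have "((x \<oplus>\<^bsub>M k\<^esub> y) \<otimes>\<^bsub>M k\<^esub> z) $$ (i, j) =
        (\<Oplus>l\<in>{..<k}. x $$ (i, l) \<otimes> z $$ (l, j) \<oplus> y $$ (i, l) \<otimes> z $$ (l, j))"
      using ij by (simp add: mat_alg_simps amult_index del: add.finprod_multf) (intro finsum_cong' refl, auto simp: l_distr)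
    also have "\<dots> = (\<Oplus>l\<in>{..<k}. x $$ (i, l) \<otimes> z $$ (l, j)) \<oplus> (\<Oplus>l\<in>{..<k}. y $$ (i, l) \<otimes> z $$ (l, j))"
      using ij by (intro finsum_addf) auto
    finally show "((x \<oplus>\<^bsub>M k\<^esub> y) \<otimes>\<^bsub>M k\<^esub> z) $$ (i, j) = (x \<otimes>\<^bsub>M k\<^esub> z \<oplus>\<^bsub>M k\<^esub> y \<otimes>\<^bsub>M k\<^esub> z) $$ (i, j)"
      using ij by (simp add: mat_alg_simps amult_index)
  qed (auto simp: mat_alg_simps)
  show "z \<otimes>\<^bsub>M k\<^esub> (x \<oplus>\<^bsub>M k\<^esub> y) = z \<otimes>\<^bsub>M k\<^esub> x \<oplus>\<^bsub>M k\<^esub> z \<otimes>\<^bsub>M k\<^esub> y"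
  proof (rule eq_matI)
    fix i j assume "i < dim_row (z \<otimes>\<^bsub>M k\<^esub> x \<oplus>\<^bsub>M k\<^esub> z \<otimes>\<^bsub>M k\<^esub> y)"
      "j < dim_col (z \<otimes>\<^bsub>M k\<^esub> x \<oplus>\<^bsub>M k\<^esub> z \<otimes>\<^bsub>M k\<^esub> y)"
    then have ij: "i < k" "j < k" by (auto simp: mat_alg_simps)
    have "(z \<otimes>\<^bsub>M k\<^esub> (x \<oplus>\<^bsub>M k\<^esub> y)) $$ (i, j) =
        (\<Oplus>l\<in>{..<k}. z $$ (i, l) \<otimes> x $$ (l, j) \<oplus> z $$ (i, l) \<otimes> y $$ (l, j))"
      using ij by (simp add: mat_alg_simps amult_index del: add.finprod_multf) (intro finsum_cong' refl, auto simp: r_distr)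
    also have "\<dots> = (\<Oplus>l\<in>{..<k}. z $$ (i, l) \<otimes> x $$ (l, j)) \<oplus> (\<Oplus>l\<in>{..<k}. z $$ (i, l) \<otimes> y $$ (l, j))"
      using ij by (intro finsum_addf) auto
    finally show "(z \<otimes>\<^bsub>M k\<^esub> (x \<oplus>\<^bsub>M k\<^esub> y)) $$ (i, j) = (z \<otimes>\<^bsub>M k\<^esub> x \<oplus>\<^bsub>M k\<^esub> z \<otimes>\<^bsub>M k\<^esub> y) $$ (i, j)"
      using ij by (simp add: mat_alg_simps amult_index)
  qed (auto simp: mat_alg_simps)
qed

lemma mat_alg_uminus:
  assumes "a \<in> amat R k k" "i < k" "j < k"
  shows "(\<ominus>\<^bsub>M k\<^esub> a) $$ (i, j) = \<ominus> (a $$ (i, j))"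
proof -
  interpret MR: ring "M k" by (rule mat_alg_ring)
  have "\<ominus>\<^bsub>M k\<^esub> a = Matrix.mat k k (\<lambda>(i, j). \<ominus> (a $$ (i, j)))"
    using assms(1) by (intro MR.minus_equality)
      (auto simp: mat_alg_simps l_neg amatD intro!: amatI eq_matI)
  then show ?thesis using assms by simp
qed

lemma mat_alg_minus:
  assumes "a \<in> amat R k k" "b \<in> amat R k k" "i < k" "j < k"
  shows "(a \<ominus>\<^bsub>M k\<^esub> b) $$ (i, j) = a $$ (i, j) \<ominus> b $$ (i, j)"
  using assms by (simp add: a_minus_def mat_alg_simps(5) mat_alg_uminus)

lemma mat_alg_cnorm_entry:
  assumes "a \<in> amat R k k" "i < k" "j < k"
  shows "cnorm R (a $$ (i, j)) \<le> cnorm (M k) a"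
proof -
  have nn: "0 \<le> cnorm R (a $$ (i, j))" if "i < k" "j < k" for i j
    using that assms(1) by (intro cnorm_nonneg) (simp add: amatD)
  have "cnorm R (a $$ (i, j)) \<le> (\<Sum>j<k. cnorm R (a $$ (i, j)))"
    using assms nn by (intro member_le_sum) auto
  also have "\<dots> \<le> (\<Sum>i<k. \<Sum>j<k. cnorm R (a $$ (i, j)))"
    using assms nn by (intro member_le_sum[where f = "\<lambda>i. \<Sum>j<k. cnorm R (a $$ (i, j))"] sum_nonneg) auto
  finally show ?thesis by (simp add: mat_alg_simps)
qed

text \<open>The \<open>+ 1\<close> makes the conclusion strict and admits k = 0.\<close>

lemma mat_alg_cnorm_le:
  assumes "\<And>i j. i < k \<Longrightarrow> j < k \<Longrightarrow> cnorm R (a $$ (i, j)) \<le> \<epsilon> / (real k * real k + 1)" "0 < \<epsilon>"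
  shows "cnorm (M k) a < \<epsilon>"
proof -
  have "cnorm (M k) a \<le> (\<Sum>i<k. \<Sum>j<k. \<epsilon> / (real k * real k + 1))"
    unfolding mat_alg_simps using assms by (intro sum_mono) auto
  also have "\<dots> = real k * real k * \<epsilon> / (real k * real k + 1)" by simp
  also have "\<dots> < \<epsilon>"
  proof -
    have "0 < real k * real k + 1" by (simp add: add_nonneg_pos)
    then show ?thesis using assms(2) by (simp add: divide_less_eq algebra_simps)
  qed
  finally show ?thesis .
qed

lemma mat_alg_cnorm_mult:
  assumes a: "a \<in> amat R k k" and b: "b \<in> amat R k k"
  shows "cnorm (M k) (amult R a b) \<le> cnorm (M k) a * cnorm (M k) b"
proof -
  note [simp] = amatD[OF a] amatD[OF b]
  let ?n = "cnorm R"
  have nn: "0 \<le> ?n (a $$ (i, j))" "0 \<le> ?n (b $$ (i, j))" if "i < k" "j < k" for i j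
    using that by (auto intro!: cnorm_nonneg)
  have "cnorm (M k) (amult R a b) \<le> (\<Sum>i<k. \<Sum>j<k. \<Sum>l<k. ?n (a $$ (i, l)) * ?n (b $$ (l, j)))"
    unfolding mat_alg_simps
  proof (intro sum_mono)
    fix i j assume ij: "i \<in> {..<k}" "j \<in> {..<k}"
    have "?n (amult R a b $$ (i, j)) \<le> (\<Sum>l<k. ?n (a $$ (i, l) \<otimes> b $$ (l, j)))"
      using ij cnorm_finsum_le[of "{..<k}" "\<lambda>l. a $$ (i, l) \<otimes> b $$ (l, j)"] by (auto simp: amult_index)
    also have "\<dots> \<le> (\<Sum>l<k. ?n (a $$ (i, l)) * ?n (b $$ (l, j)))"
      using ij by (intro sum_mono cnorm_mult) auto
    finally show "?n (amult R a b $$ (i, j)) \<le> (\<Sum>l<k. ?n (a $$ (i, l)) * ?n (b $$ (l, j)))" .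
  qed
  \<comment> \<open>Enlarging an entry of \<open>b\<close> to a column sum decouples the indices, so
    that the triple sum factors.\<close>
  also have "\<dots> \<le> (\<Sum>i<k. \<Sum>j<k. \<Sum>l<k. ?n (a $$ (i, l)) * (\<Sum>m<k. ?n (b $$ (m, j))))"
  proof (intro sum_mono mult_left_mono)
    fix i j l assume "i \<in> {..<k}" "j \<in> {..<k}" "l \<in> {..<k}"
    then show "?n (b $$ (l, j)) \<le> (\<Sum>m<k. ?n (b $$ (m, j)))" "0 \<le> ?n (a $$ (i, l))"
      using nn by (auto intro!: member_le_sum[where f = "\<lambda>m. ?n (b $$ (m, j))"])
  qed
  also have "\<dots> = (\<Sum>i<k. (\<Sum>l<k. ?n (a $$ (i, l))) * (\<Sum>j<k. \<Sum>m<k. ?n (b $$ (m, j))))"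
    by (subst sum.swap) (simp add: sum_product)
  also have "\<dots> = cnorm (M k) a * (\<Sum>j<k. \<Sum>m<k. ?n (b $$ (m, j)))"
    by (simp add: mat_alg_simps sum_distrib_right)
  also have "(\<Sum>j<k. \<Sum>m<k. ?n (b $$ (m, j))) = cnorm (M k) b"
    unfolding mat_alg_simps by (rule sum.swap)
  finally show ?thesis .
qed

theorem mat_alg_nstar: "nstar_algebra (M k)"
proof -
  interpret MR: ring "M k" by (rule mat_alg_ring)
  show ?thesis
  proof (intro nstar_algebra.intro normed_star_algebra.intro star_ring.intro star_ring_axioms.intro
      normed_star_algebra_axioms.intro nstar_algebra_axioms.intro)
    show "ring (M k)" by (rule mat_alg_ring)
    show "star (M k) x \<in> carrier (M k)" "star (M k) (star (M k) x) = x" if "x \<in> carrier (M k)" for x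
      using that by (auto simp: mat_alg_simps aadj_aadj)
    show "star (M k) (x \<oplus>\<^bsub>M k\<^esub> y) = star (M k) x \<oplus>\<^bsub>M k\<^esub> star (M k) y"
      if "x \<in> carrier (M k)" "y \<in> carrier (M k)" for x y
      using that by (auto simp: mat_alg_simps aadj_index star_add amatD intro!: eq_matI)
    show "star (M k) (x \<otimes>\<^bsub>M k\<^esub> y) = star (M k) y \<otimes>\<^bsub>M k\<^esub> star (M k) x"
      if "x \<in> carrier (M k)" "y \<in> carrier (M k)" for x y
      using that by (auto simp: mat_alg_simps aadj_amult)
    show "Module.module complex_ring (M k)"
    proof (rule moduleI)
      show "cring complex_ring" using complex_module by (rule module.axioms(1))
      show "abelian_group (M k)" by (rule MR.abelian_group_axioms)
    qed (auto simp: mat_alg_simps complex_ring_def smult_l_distr smult_r_distr smult_smult amatD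
        intro!: amatI eq_matI)
    show "(c \<odot>\<^bsub>M k\<^esub> x) \<otimes>\<^bsub>M k\<^esub> y = c \<odot>\<^bsub>M k\<^esub> (x \<otimes>\<^bsub>M k\<^esub> y)"
      "x \<otimes>\<^bsub>M k\<^esub> (c \<odot>\<^bsub>M k\<^esub> y) = c \<odot>\<^bsub>M k\<^esub> (x \<otimes>\<^bsub>M k\<^esub> y)"
      if "x \<in> carrier (M k)" "y \<in> carrier (M k)" for c x y
    proof -
      have *: "x \<in> amat R k k" "y \<in> amat R k k" using that by (auto simp: mat_alg_simps)
      note [simp] = amatD[OF *(1)] amatD[OF *(2)]
      have e: "c \<odot> (\<Oplus>l\<in>{..<k}. x $$ (i, l) \<otimes> y $$ (l, j)) = (\<Oplus>l\<in>{..<k}. c \<odot> (x $$ (i, l) \<otimes> y $$ (l, j)))"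
        if "i < k" "j < k" for i j using that by (intro smult_finsum) auto
      show "(c \<odot>\<^bsub>M k\<^esub> x) \<otimes>\<^bsub>M k\<^esub> y = c \<odot>\<^bsub>M k\<^esub> (x \<otimes>\<^bsub>M k\<^esub> y)"
        by (rule eq_matI) (auto simp: mat_alg_simps amult_index e smult_mult_left intro!: finsum_cong')
      show "x \<otimes>\<^bsub>M k\<^esub> (c \<odot>\<^bsub>M k\<^esub> y) = c \<odot>\<^bsub>M k\<^esub> (x \<otimes>\<^bsub>M k\<^esub> y)"
        by (rule eq_matI) (auto simp: mat_alg_simps amult_index e smult_mult_right intro!: finsum_cong')
    qed
    show "star (M k) (c \<odot>\<^bsub>M k\<^esub> x) = cnj c \<odot>\<^bsub>M k\<^esub> star (M k) x" if "x \<in> carrier (M k)" for c x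
      using that by (auto simp: mat_alg_simps aadj_index star_smult amatD intro!: eq_matI)
    show "0 \<le> cnorm (M k) x" if "x \<in> carrier (M k)" for x
      using that by (auto simp: mat_alg_simps amatD intro!: sum_nonneg cnorm_nonneg)
    show "cnorm (M k) x = 0 \<longleftrightarrow> x = \<zero>\<^bsub>M k\<^esub>" if x: "x \<in> carrier (M k)" for x
    proof
      assume "cnorm (M k) x = 0"
      then have "cnorm R (x $$ (i, j)) = 0" if "i < k" "j < k" for i j
        using mat_alg_cnorm_entry[of x k i j] cnorm_nonneg[of "x $$ (i, j)"] x that
        by (simp add: mat_alg_simps(1) amatD)
      then show "x = \<zero>\<^bsub>M k\<^esub>"
        using x by (auto simp: mat_alg_simps cnorm_eq_0 amatD intro!: eq_matI)
    next
      assume "x = \<zero>\<^bsub>M k\<^esub>"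
      then show "cnorm (M k) x = 0" by (simp add: mat_alg_simps)
    qed
    show "cnorm (M k) (c \<odot>\<^bsub>M k\<^esub> x) = cmod c * cnorm (M k) x" if "x \<in> carrier (M k)" for c x
      using that by (simp add: mat_alg_simps cnorm_smult amatD sum_distrib_left)
    show "cnorm (M k) (x \<oplus>\<^bsub>M k\<^esub> y) \<le> cnorm (M k) x + cnorm (M k) y"
      if "x \<in> carrier (M k)" "y \<in> carrier (M k)" for x y
    proof -
      have "cnorm (M k) (x \<oplus>\<^bsub>M k\<^esub> y) \<le> (\<Sum>i<k. \<Sum>j<k. cnorm R (x $$ (i, j)) + cnorm R (y $$ (i, j)))"
        using that by (auto simp: mat_alg_simps amatD intro!: sum_mono cnorm_triangle)
      then show ?thesis by (simp add: mat_alg_simps sum.distrib)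
    qed
    show "cnorm (M k) (x \<otimes>\<^bsub>M k\<^esub> y) \<le> cnorm (M k) x * cnorm (M k) y"
      if "x \<in> carrier (M k)" "y \<in> carrier (M k)" for x y
      using that mat_alg_cnorm_mult by (simp only: mat_alg_simps(1,2))
    show "cnorm (M k) (star (M k) x) = cnorm (M k) x" if x: "x \<in> carrier (M k)" for x
    proof -
      have "cnorm (M k) (star (M k) x) = (\<Sum>i<k. \<Sum>j<k. cnorm R (x $$ (j, i)))"
        using x by (simp add: mat_alg_simps aadj_index amatD cnorm_star)
      also have "\<dots> = cnorm (M k) x" unfolding mat_alg_simps by (rule sum.swap)
      finally show ?thesis .
    qed
    show "\<exists>l\<in>carrier (M k). (\<lambda>n. cnorm (M k) (s n \<ominus>\<^bsub>M k\<^esub> l)) \<longlonglongrightarrow> 0"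
      if s: "\<And>n. s n \<in> carrier (M k)"
        and step: "\<And>n. cnorm (M k) (s (Suc n) \<ominus>\<^bsub>M k\<^esub> s n) \<le> C * (1/2) ^ n" for s C
    proof -
      have sa: "s n \<in> amat R k k" for n using s by (simp add: mat_alg_simps)
      have "\<exists>l. l \<in> carrier R \<and> (\<lambda>n. cnorm R (s n $$ (i, j) \<ominus> l)) \<longlonglongrightarrow> 0" if "i < k" "j < k" for i j
      proof -
        have "cnorm R (s (Suc n) $$ (i, j) \<ominus> s n $$ (i, j)) \<le> C * (1/2) ^ n" for n
        proof -
          have "s (Suc n) \<ominus>\<^bsub>M k\<^esub> s n \<in> amat R k k"
            using MR.minus_closed[OF s s] by (simp add: mat_alg_simps)
          from mat_alg_cnorm_entry[OF this that] show ?thesis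
            using step[of n] mat_alg_minus[OF sa sa that] by simp
        qed
        then show ?thesis
          using geometric_limit[of "\<lambda>n. s n $$ (i, j)" C] amatD(3)[OF sa that] by blast
      qed
      then obtain l where l: "\<And>i j. i < k \<Longrightarrow> j < k \<Longrightarrow> l i j \<in> carrier R"
        "\<And>i j. i < k \<Longrightarrow> j < k \<Longrightarrow> (\<lambda>n. cnorm R (s n $$ (i, j) \<ominus> l i j)) \<longlonglongrightarrow> 0"
        by metis
      let ?l = "Matrix.mat k k (\<lambda>(i, j). l i j)"
      have la: "?l \<in> amat R k k" using l(1) by (auto intro!: amatI)
      have "(\<lambda>n. \<Sum>i<k. \<Sum>j<k. cnorm R (s n $$ (i, j) \<ominus> l i j)) \<longlonglongrightarrow> (\<Sum>i<k. \<Sum>j<k. 0)"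
        using l(2) by (intro tendsto_sum) auto
      moreover have "cnorm (M k) (s n \<ominus>\<^bsub>M k\<^esub> ?l) = (\<Sum>i<k. \<Sum>j<k. cnorm R (s n $$ (i, j) \<ominus> l i j))" for n
        unfolding mat_alg_simps(8) by (intro sum.cong refl) (simp add: mat_alg_minus[OF sa la])
      ultimately show ?thesis using la by (intro bexI[of _ ?l]) (simp_all add: mat_alg_simps(1))
    qed
  qed
qed

lemma mat_alg_finsum_index:
  assumes "finite S" "\<And>m. m \<in> S \<Longrightarrow> x m \<in> amat R k k" "i < k" "j < k"
  shows "finsum (M k) x S $$ (i, j) = (\<Oplus>m\<in>S. x m $$ (i, j))"
  using assms(1,2)
proof (induction S rule: finite_induct)
  case empty
  interpret MR: ring "M k" by (rule mat_alg_ring)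
  show ?case using assms(3,4) by (simp add: MR.finsum_empty finsum_empty mat_alg_simps)
next
  case (insert m S)
  interpret MR: ring "M k" by (rule mat_alg_ring)
  have "x \<in> S \<rightarrow> carrier (M k)" "x m \<in> carrier (M k)" using insert.prems by (auto simp: mat_alg_simps)
  then have "finsum (M k) x (insert m S) = x m \<oplus>\<^bsub>M k\<^esub> finsum (M k) x S"
    using insert.hyps by (intro MR.finsum_insert)
  then have "finsum (M k) x (insert m S) $$ (i, j) = x m $$ (i, j) \<oplus> (\<Oplus>m\<in>S. x m $$ (i, j))"
    using insert assms(3,4) by (simp add: mat_alg_simps(5))
  also have "\<dots> = (\<Oplus>m\<in>insert m S. x m $$ (i, j))"
    using insert assms(3,4) by (intro finsum_insert[symmetric]) (auto intro!: amatD(3))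
  finally show ?case .
qed

subsection \<open>Finiteness\<close>

text \<open>The C*-identity, and with it \<open>v = v * star v * v\<close>, is not available; hence \<open>v * P\<close>.\<close>

lemma subprojection_equiv_imp_eq:
  assumes fin: "\<And>b. b \<in> carrier R \<Longrightarrow> star R b \<otimes> b = \<one> \<Longrightarrow> b \<otimes> star R b = \<one>"
    and v: "v \<in> carrier R" "P = star R v \<otimes> v" "Q = v \<otimes> star R v"
    and PQ: "P \<otimes> P = P" "Q \<otimes> Q = Q" "P \<otimes> Q = Q"
  shows "P = Q"
proof -
  have P: "P \<in> carrier R" "star R P = P" and Q: "Q \<in> carrier R" using v by (auto simp: star_mult)
  define w where "w = v \<otimes> P"
  have w: "w \<in> carrier R" using v(1) P by (simp add: w_def)
  have wP: "w \<otimes> P = w" using v(1) P PQ by (simp add: w_def m_assoc)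
  have "star R w \<otimes> w = P \<otimes> (star R v \<otimes> v) \<otimes> P" using v(1) P by (simp add: w_def star_mult m_assoc)
  then have sww: "star R w \<otimes> w = P" using PQ v(2) by simp
  have "w \<otimes> star R w = v \<otimes> (P \<otimes> P) \<otimes> star R v" using v(1) P by (simp add: w_def star_mult m_assoc)
  also have "\<dots> = v \<otimes> (star R v \<otimes> v) \<otimes> star R v" using PQ(1) v(2) by simp
  also have "\<dots> = Q \<otimes> Q" using v(1) by (simp add: v(3) m_assoc)
  finally have wsw: "w \<otimes> star R w = Q" using PQ by simp
  have "Q \<otimes> w = v \<otimes> (star R v \<otimes> v) \<otimes> P" using v(1) P by (simp add: w_def v(3) m_assoc)
  also have "\<dots> = w" using PQ(1) v(1) P by (simp add: w_def m_assoc flip: v(2))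
  finally have Qw: "Q \<otimes> w = w" .
  have "P \<otimes> w = P \<otimes> Q \<otimes> w" using P Q w Qw by (simp add: m_assoc)
  then have Pw: "P \<otimes> w = w" using PQ Qw by simp
  \<comment> \<open>The isometry w from P to Q is completed by the complement f to an isometry w + f
    in the full algebra. Finiteness makes w + f unitary, which says Q + f = 1.\<close>
  define f where "f = \<one> \<ominus> P"
  have f: "f \<in> carrier R" "star R f = f" using P by (auto simp: f_def star_diff)
  have ff: "f \<otimes> f = f"
  proof -
    have "P \<otimes> f = \<zero>" using P PQ by (simp add: f_def minus_mult_right minus_eq_zero_iff)
    then have "f \<otimes> f = f \<ominus> \<zero>" using P f by (simp add: f_def minus_mult_left)
    then show ?thesis using f by (simp add: minus_eq)
  qed
  have wf: "w \<otimes> f = \<zero>" using w P wP by (simp add: f_def minus_mult_right minus_eq_zero_iff)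
  have fw: "f \<otimes> w = \<zero>" using w P Pw by (simp add: f_def minus_mult_left minus_eq_zero_iff)
  have "star R (w \<otimes> f) = f \<otimes> star R w" using w f by (simp add: star_mult)
  then have fsw: "f \<otimes> star R w = \<zero>" using wf by simp
  have "star R (f \<otimes> w) = star R w \<otimes> f" using w f by (simp add: star_mult)
  then have swf: "star R w \<otimes> f = \<zero>" using fw by simp
  have "star R (w \<oplus> f) \<otimes> (w \<oplus> f) = P \<oplus> f"
    using w f P by (simp add: star_add l_distr r_distr sww swf fw ff)
  also have "\<dots> = \<one>" using P by (simp add: f_def diff_add_cancel a_comm[of P])
  finally have "(w \<oplus> f) \<otimes> star R (w \<oplus> f) = \<one>" using fin w f by simp
  then have "Q \<oplus> f = \<one>" using w f Q by (simp add: star_add l_distr r_distr wsw wf fsw ff)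
  then have "Q \<ominus> P = \<zero>"
    using P Q by (metis f_def a_minus_def add.m_comm add.inv_closed add.m_lcomm add.r_cancel_one' one_closed a_closed)
  then show ?thesis using minus_eq_zero_iff P Q by simp
qed

end

context af_algebra begin

text \<open>Powers of \<open>y\<close> have entries in \<open>F n\<close>. Their coordinates over a
  finite spanning set B give k^2 card B equations for the coefficients of a relation, so one power
  more than that forces a nontrivial one.\<close>

lemma mat_alg_algebraic:
  assumes y: "y \<in> amat R k k" "\<And>i j. i < k \<Longrightarrow> j < k \<Longrightarrow> y $$ (i, j) \<in> F n"
  shows "nstar_algebra.algebraic (M k) y"
proof -
  interpret MN: nstar_algebra "M k" by (rule mat_alg_nstar)
  have yc: "y \<in> carrier (M k)" using y by (simp add: mat_alg_simps)
  obtain B where B: "finite B" "B \<subseteq> F n" "\<forall>x\<in>F n. \<exists>c. x = (\<Oplus>b\<in>B. c b \<odot> b)"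
    using F_span[of n] by (elim exE conjE) (rule that)
  have BC: "B \<subseteq> carrier R" using B(2) F_carrier by blast
  have Ffinsum: "finsum R f S \<in> F n" if "finite S" "\<And>l. l \<in> S \<Longrightarrow> f l \<in> F n" for f and S :: "nat set"
    using that
  proof (induction S rule: finite_induct)
    case (insert l S)
    have "f \<in> S \<rightarrow> carrier R" "f l \<in> carrier R"
      using F_carrierD[OF insert.prems] by auto
    then show ?case using insert by (simp add: finsum_insert F_add)
  qed (simp add: finsum_empty F_zero)
  have pwF: "MN.pw y m $$ (i, j) \<in> F n" if "i < k" "j < k" for m i j
    using that
  proof (induction m arbitrary: i j)
    case 0
    then show ?case using yc F_one F_zero by (simp add: mat_alg_simps)
  next
    case (Suc m)
    have "MN.pw y m \<in> amat R k k" using MN.pw_closed[OF yc] by (simp add: mat_alg_simps)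
    then have "MN.pw y (Suc m) $$ (i, j) = (\<Oplus>l\<in>{..<k}. y $$ (i, l) \<otimes> MN.pw y m $$ (l, j))"
      using Suc.prems y(1) yc by (simp add: MN.pw_Suc mat_alg_simps(2) amult_index amatD)
    also have "\<dots> \<in> F n" using Suc y by (intro Ffinsum F_mult) auto
    finally show ?case .
  qed
  define C where "C m i j = (SOME c. MN.pw y m $$ (i, j) = (\<Oplus>b\<in>B. c b \<odot> b))" for m i j
  have C: "MN.pw y m $$ (i, j) = (\<Oplus>b\<in>B. C m i j b \<odot> b)" if "i < k" "j < k" for m i j
    unfolding C_def
    by (rule someI_ex[where P = "\<lambda>c. MN.pw y m $$ (i, j) = (\<Oplus>b\<in>B. c b \<odot> b)"])
      (use pwF[OF that] B(3) in blast)
  let ?J = "{..<k} \<times> {..<k} \<times> B"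
  let ?S = "{..card ?J}"
  obtain \<alpha> where \<alpha>: "\<exists>m\<in>?S. \<alpha> m \<noteq> 0"
    "\<forall>(i, j, b)\<in>?J. (\<Sum>m\<in>?S. \<alpha> m * C m i j b) = 0"
    using underdetermined_system[of ?J ?S "\<lambda>m (i, j, b). C m i j b"] B(1) by fastforce
  have pwa: "MN.pw y m \<in> amat R k k" for m using MN.pw_closed[OF yc] by (simp add: mat_alg_simps)
  have sa: "\<alpha> m \<odot>\<^bsub>M k\<^esub> MN.pw y m \<in> amat R k k" for m
    using MN.smult_closed[OF MN.pw_closed[OF yc]] by (simp add: mat_alg_simps(1))
  have "(\<Oplus>\<^bsub>M k\<^esub>m\<in>?S. \<alpha> m \<odot>\<^bsub>M k\<^esub> MN.pw y m) = \<zero>\<^bsub>M k\<^esub>"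
  proof (rule amat_eqI)
    show "(\<Oplus>\<^bsub>M k\<^esub>m\<in>?S. \<alpha> m \<odot>\<^bsub>M k\<^esub> MN.pw y m) \<in> amat R k k" "\<zero>\<^bsub>M k\<^esub> \<in> amat R k k"
      using MN.finsum_closed[of "\<lambda>m. \<alpha> m \<odot>\<^bsub>M k\<^esub> MN.pw y m" ?S] MN.zero_closed sa
      by (auto simp: mat_alg_simps(1))
    fix i j assume ij: "i < k" "j < k"
    have "(\<Oplus>\<^bsub>M k\<^esub>m\<in>?S. \<alpha> m \<odot>\<^bsub>M k\<^esub> MN.pw y m) $$ (i, j) = (\<Oplus>m\<in>?S. (\<alpha> m \<odot>\<^bsub>M k\<^esub> MN.pw y m) $$ (i, j))"
      using sa ij by (intro mat_alg_finsum_index) auto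
    also have "\<dots> = (\<Oplus>m\<in>?S. \<alpha> m \<odot> MN.pw y m $$ (i, j))"
      using ij by (simp only: mat_alg_simps(6) index_mat prod.case)
    also have "\<dots> = \<zero>"
      using \<alpha>(2) ij C by (intro span_relation[OF B(1) BC _ C[OF ij]]) auto
    finally show "(\<Oplus>\<^bsub>M k\<^esub>m\<in>?S. \<alpha> m \<odot>\<^bsub>M k\<^esub> MN.pw y m) $$ (i, j) = \<zero>\<^bsub>M k\<^esub> $$ (i, j)"
      using ij by (simp add: mat_alg_simps(4))
  qed
  then show ?thesis using MN.algebraic_if_powers_dependent[OF yc _ \<alpha>(1)] by blast
qed

lemma mat_alg_algebraic_dense:
  assumes x: "x \<in> carrier (M k)" and \<epsilon>: "0 < \<epsilon>"
  shows "\<exists>y\<in>carrier (M k). nstar_algebra.algebraic (M k) y \<and> cnorm (M k) (x \<ominus>\<^bsub>M k\<^esub> y) < \<epsilon>"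
proof -
  have xa: "x \<in> amat R k k" using x by (simp add: mat_alg_simps)
  define \<delta> where "\<delta> = \<epsilon> / (real k * real k + 1)"
  have \<delta>: "0 < \<delta>" using \<epsilon> by (simp add: \<delta>_def add_nonneg_pos)
  have "\<exists>n y. y \<in> F n \<and> cnorm R (x $$ (i, j) \<ominus> y) < \<delta>" if "i < k" "j < k" for i j
    using F_dense[OF amatD(3)[OF xa that] \<delta>] by blast
  then obtain N Y where Y: "\<And>i j. i < k \<Longrightarrow> j < k \<Longrightarrow> Y i j \<in> F (N i j)"
    "\<And>i j. i < k \<Longrightarrow> j < k \<Longrightarrow> cnorm R (x $$ (i, j) \<ominus> Y i j) < \<delta>"
    by metis
  \<comment> \<open>One stage of the filtration for all entries; the inserted 0 covers k =
    0.\<close>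
  define n where "n = Max (insert 0 ((\<lambda>(i, j). N i j) ` ({..<k} \<times> {..<k})))"
  have "N i j \<le> n" if "i < k" "j < k" for i j
    unfolding n_def using that by (intro Max_ge) (auto intro!: image_eqI[of _ _ "(i, j)"])
  then have YF: "Y i j \<in> F n" if "i < k" "j < k" for i j
    using that Y(1) F_mono by blast
  let ?y = "Matrix.mat k k (\<lambda>(i, j). Y i j)"
  have ya: "?y \<in> amat R k k" using F_carrierD[OF YF] by (auto intro!: amatI)
  have "cnorm (M k) (x \<ominus>\<^bsub>M k\<^esub> ?y) < \<epsilon>"
  proof (rule mat_alg_cnorm_le[OF _ \<epsilon>])
    fix i j assume ij: "i < k" "j < k"
    then show "cnorm R ((x \<ominus>\<^bsub>M k\<^esub> ?y) $$ (i, j)) \<le> \<epsilon> / (real k * real k + 1)"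
      using Y(2)[OF ij] mat_alg_minus[OF xa ya ij] by (simp add: \<delta>_def)
  qed
  moreover have "nstar_algebra.algebraic (M k) ?y" using ya YF by (intro mat_alg_algebraic) auto
  ultimately show ?thesis using ya by (auto simp: mat_alg_simps(1))
qed

lemma mat_alg_finite:
  assumes "b \<in> carrier (M k)" "star (M k) b \<otimes>\<^bsub>M k\<^esub> b = \<one>\<^bsub>M k\<^esub>"
  shows "b \<otimes>\<^bsub>M k\<^esub> star (M k) b = \<one>\<^bsub>M k\<^esub>"
  using nstar_algebra.isometry_imp_unitary[OF mat_alg_nstar mat_alg_algebraic_dense assms] by blast

text \<open>For some r, the block sums e + 0 + r and 0 + 0 + r are equivalent projections of the
  same size, and the latter is a subprojection of the former. Finiteness makes them equal, and their
  top left entries are \<open>e\<close> and 0.\<close>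

lemma stably_finite:
  assumes e: "e \<in> carrier R" "star R e = e" "e \<otimes> e = e"
    and class_eq: "K0_class R (Matrix.mat 1 1 (\<lambda>_. e)) (zero_proj R) = K0_class R (zero_proj R) (zero_proj R)"
  shows "e = \<zero>"
proof -
  let ?e = "Matrix.mat 1 1 (\<lambda>_. e)" and ?z = "zero_proj R"
  have ep: "?e \<in> projections R"
    using e by (intro projectionsI[of _ 1])
      (auto simp: amult_index aadj_index lessThan_Suc finsum_insert finsum_empty intro!: amatI eq_matI)
  have zp: "?z \<in> projections R" by (rule zero_proj_projection)
  obtain r where r: "r \<in> projections R" "mvn_equiv R (dsum R (dsum R ?e ?z) r) (dsum R (dsum R ?z ?z) r)"
    using class_eq unfolding K0_class_eq_iff[OF ep zp zp zp] by (auto simp: K0_rel_def)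
  define k where "k = 2 + dim_row r"
  define P where "P = dsum R (dsum R ?e ?z) r"
  define Q where "Q = dsum R (dsum R ?z ?z) r"
  have dz: "dim_row ?z = 1" "dim_col ?z = 1" by (auto simp: zero_proj_def)
  note ra = projectionsD(1)[OF r(1)] and za = projectionsD(1)[OF zp, unfolded dz] and ea = projectionsD(1)[OF ep, simplified]
  have dims: "dim_row P = k" "dim_row Q = k" by (auto simp: P_def Q_def k_def dz)
  obtain v where v: "v \<in> amat R k k" "P = amult R (aadj R v) v" "Q = amult R v (aadj R v)"
    using r(2) unfolding mvn_equiv_def P_def[symmetric] Q_def[symmetric] dims by blast
  have PP: "amult R P P = P" and QQ: "amult R Q Q = Q"
    unfolding P_def Q_def using ep zp r(1) by (auto intro!: projectionsD(3) dsum_projections)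
  have ez: "amult R ?e ?z = ?z"
    using e(1) by (intro eq_matI) (auto simp: zero_proj_def amult_index lessThan_Suc finsum_insert finsum_empty)
  have ez2: "dsum R ?e ?z \<in> amat R (Suc 1) (Suc 1)" "dsum R ?z ?z \<in> amat R (Suc 1) (Suc 1)"
    using dsum_amat[OF ea za] dsum_amat[OF za za] by simp_all
  have PQ: "amult R P Q = Q"
    unfolding P_def Q_def amult_dsum[OF ez2(1) ra ez2(2) ra]
    using amult_dsum[of ?e 1 1 ?z 1 1 ?z 1 ?z 1] ea za ez projectionsD(3)[OF zp] projectionsD(3)[OF r(1)] by simp
  have "P = Q"
    using nstar_algebra.subprojection_equiv_imp_eq[OF mat_alg_nstar mat_alg_finite, where v = v and P = P and Q = Q] v PP QQ PQ
    by (simp add: mat_alg_simps(1,2,7))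
  then have "P $$ (0, 0) = Q $$ (0, 0)" by simp
  then show ?thesis using dz by (simp add: P_def Q_def dsum_index) (simp add: zero_proj_def)
qed

end

section \<open>Lifting matrix projections modulo an ideal\<close>

context af_ideal begin

definition mat_ideal :: "nat \<Rightarrow> 'a mat set" where
  "mat_ideal k = {a \<in> amat R k k. \<forall>i<k. \<forall>j<k. a $$ (i, j) \<in> I}"

lemma I_finsum: "finite S \<Longrightarrow> (\<And>l. l \<in> S \<Longrightarrow> f l \<in> I) \<Longrightarrow> finsum R f S \<in> I"
proof (induction S rule: finite_induct)
  case (insert l S)
  have "f \<in> S \<rightarrow> carrier R" "f l \<in> carrier R" using I_carrier[OF insert.prems] by auto
  then show ?case using insert by (simp add: finsum_insert I_add)
qed (simp add: finsum_empty I_zero)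

lemma mat_ideal_ideal: "ideal (mat_ideal k) (M k)"
proof (rule idealI)
  show "ring (M k)" by (rule mat_alg_ring)
  interpret MN: nstar_algebra "M k" by (rule mat_alg_nstar)
  show "subgroup (mat_ideal k) (add_monoid (M k))"
  proof (rule MN.add.subgroupI)
    show "mat_ideal k \<subseteq> carrier (M k)" by (auto simp: mat_ideal_def mat_alg_simps)
    show "mat_ideal k \<noteq> {}"
      using MN.zero_closed I_zero by (auto simp: mat_ideal_def mat_alg_simps(1,4) intro!: exI[of _ "\<zero>\<^bsub>M k\<^esub>"])
    fix a assume a: "a \<in> mat_ideal k"
    then have ac: "a \<in> amat R k k" "a \<in> carrier (M k)" by (auto simp: mat_ideal_def mat_alg_simps(1))
    have "\<ominus>\<^bsub>M k\<^esub> a \<in> amat R k k" using MN.a_inv_closed[OF ac(2)] by (simp add: mat_alg_simps(1))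
    moreover have "\<ominus> (a $$ (i, j)) \<in> I" if "i < k" "j < k" for i j
      using a that I_smult[of "a $$ (i, j)" "-1"] I_carrier by (simp add: mat_ideal_def minus_eq_smult)
    ultimately show "\<ominus>\<^bsub>M k\<^esub> a \<in> mat_ideal k"
      using ac by (simp add: mat_ideal_def mat_alg_uminus)
    fix b assume "b \<in> mat_ideal k"
    then show "a \<oplus>\<^bsub>M k\<^esub> b \<in> mat_ideal k"
      using a by (auto simp: mat_ideal_def mat_alg_simps(5) amatD I_add intro!: amatI)
  qed
  fix a x assume a: "a \<in> mat_ideal k" and x: "x \<in> carrier (M k)"
  then have *: "a \<in> amat R k k" "x \<in> amat R k k" "\<And>i j. i < k \<Longrightarrow> j < k \<Longrightarrow> a $$ (i, j) \<in> I"
    by (auto simp: mat_ideal_def mat_alg_simps(1))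
  show "x \<otimes>\<^bsub>M k\<^esub> a \<in> mat_ideal k" "a \<otimes>\<^bsub>M k\<^esub> x \<in> mat_ideal k"
    using * by (auto simp: mat_ideal_def mat_alg_simps(2) amult_index amatD I_left I_right intro!: I_finsum)
qed

lemma mat_ideal_closed:
  assumes x: "x \<in> carrier (M k)" and "\<And>\<epsilon>. 0 < \<epsilon> \<Longrightarrow> \<exists>y\<in>mat_ideal k. cnorm (M k) (x \<ominus>\<^bsub>M k\<^esub> y) < \<epsilon>"
  shows "x \<in> mat_ideal k"
proof -
  have xa: "x \<in> amat R k k" using x by (simp add: mat_alg_simps)
  interpret MN: nstar_algebra "M k" by (rule mat_alg_nstar)
  have "x $$ (i, j) \<in> I" if ij: "i < k" "j < k" for i j
  proof (rule closed)
    show "x $$ (i, j) \<in> carrier R" using xa ij by (simp add: amatD)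
    fix \<epsilon> :: real assume "0 < \<epsilon>"
    then obtain y where y: "y \<in> mat_ideal k" "cnorm (M k) (x \<ominus>\<^bsub>M k\<^esub> y) < \<epsilon>" using assms(2) by blast
    have ya: "y \<in> amat R k k" "y $$ (i, j) \<in> I" using y ij by (auto simp: mat_ideal_def)
    have "x \<ominus>\<^bsub>M k\<^esub> y \<in> amat R k k"
      using MN.minus_closed[of x y] xa ya by (simp add: mat_alg_simps(1))
    from mat_alg_cnorm_entry[OF this ij] show "\<exists>y\<in>I. cnorm R (x $$ (i, j) \<ominus> y) < \<epsilon>"
      using y(2) ya mat_alg_minus[OF xa ya(1) ij] by (intro bexI[OF _ ya(2)]) simp
  qed
  then show ?thesis using xa by (simp add: mat_ideal_def)
qed

text \<open>\<open>e\<close> is the diagonal matrix with entries \<open>unit_of n\<close>; as there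
  are finitely many entries, one n serves them all. The bound k^2 is crude but independent of
  \<epsilon>, as \<open>projection_lift\<close> demands.\<close>

lemma mat_quasi_central:
  assumes x: "x \<in> carrier (M k)" and d: "d \<in> mat_ideal k" and \<epsilon>: "0 < \<epsilon>"
  shows "\<exists>e\<in>mat_ideal k. star (M k) e = e \<and> e \<otimes>\<^bsub>M k\<^esub> e = e \<and>
    cnorm (M k) (\<one>\<^bsub>M k\<^esub> \<ominus>\<^bsub>M k\<^esub> e) \<le> real k * real k \<and>
    cnorm (M k) (d \<otimes>\<^bsub>M k\<^esub> (\<one>\<^bsub>M k\<^esub> \<ominus>\<^bsub>M k\<^esub> e)) < \<epsilon> \<and>
    cnorm (M k) (x \<otimes>\<^bsub>M k\<^esub> e \<ominus>\<^bsub>M k\<^esub> e \<otimes>\<^bsub>M k\<^esub> x) < \<epsilon>"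
proof -
  interpret MN: nstar_algebra "M k" by (rule mat_alg_nstar)
  have xa: "x \<in> amat R k k" using x by (simp add: mat_alg_simps)
  have da: "d \<in> amat R k k" "\<And>i j. i < k \<Longrightarrow> j < k \<Longrightarrow> d $$ (i, j) \<in> I" using d by (auto simp: mat_ideal_def)
  define \<delta> where "\<delta> = \<epsilon> / (real k * real k + 1)"
  have \<delta>: "0 < \<delta>" using \<epsilon> by (simp add: \<delta>_def add_nonneg_pos)
  have "\<forall>\<^sub>F n in sequentially. \<forall>i\<in>{..<k}. \<forall>j\<in>{..<k}. cnorm R (d $$ (i, j) \<otimes> co_unit n) < \<delta> \<and>
      cnorm R (x $$ (i, j) \<otimes> unit_of n \<ominus> unit_of n \<otimes> x $$ (i, j)) < \<delta>"
    using da(2) xa \<delta>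
    by (intro eventually_ball_finite ballI eventually_conj approximate_unit approximately_central)
      (auto simp: amatD)
  from eventually_happens'[OF sequentially_bot this]
  obtain n where n: "\<And>i j. i < k \<Longrightarrow> j < k \<Longrightarrow> cnorm R (d $$ (i, j) \<otimes> co_unit n) < \<delta>"
    "\<And>i j. i < k \<Longrightarrow> j < k \<Longrightarrow> cnorm R (x $$ (i, j) \<otimes> unit_of n \<ominus> unit_of n \<otimes> x $$ (i, j)) < \<delta>"
    by auto
  define e where "e = Matrix.mat k k (\<lambda>(i, j). if i = j then unit_of n else \<zero>)"
  have ea: "e \<in> amat R k k" by (auto simp: e_def intro!: amatI)
  have eK: "e \<in> mat_ideal k" using ea unit_of_I I_zero by (simp add: mat_ideal_def e_def)
  have ec: "e \<in> carrier (M k)" using ea by (simp add: mat_alg_simps)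
  have se: "star (M k) e = e"
    unfolding mat_alg_simps by (rule eq_matI) (auto simp: e_def aadj_index unit_of_star)
  have ee: "e \<otimes>\<^bsub>M k\<^esub> e = e"
    unfolding mat_alg_simps
  proof (rule amat_eqI)
    show "amult R e e \<in> amat R k k" "e \<in> amat R k k" using ea by auto
    fix i j assume ij: "i < k" "j < k"
    have "amult R e e $$ (i, j) = e $$ (i, j) \<otimes> unit_of n"
      using amult_scalar_right[OF ea unit_of_carrier ij] by (simp add: e_def)
    then show "amult R e e $$ (i, j) = e $$ (i, j)" using ij by (simp add: e_def unit_of_idem)
  qed
  define f where "f = \<one>\<^bsub>M k\<^esub> \<ominus>\<^bsub>M k\<^esub> e"
  have f: "f = Matrix.mat k k (\<lambda>(i, j). if i = j then co_unit n else \<zero>)"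
  proof (rule amat_eqI)
    show "f \<in> amat R k k" using MN.minus_closed[OF MN.one_closed ec] by (simp add: f_def mat_alg_simps(1))
    show "Matrix.mat k k (\<lambda>(i, j). if i = j then co_unit n else \<zero>) \<in> amat R k k" by (auto intro!: amatI)
    fix i j assume ij: "i < k" "j < k"
    have "\<one>\<^bsub>M k\<^esub> \<in> amat R k k" using MN.one_closed by (simp only: mat_alg_simps(1))
    then show "f $$ (i, j) = Matrix.mat k k (\<lambda>(i, j). if i = j then co_unit n else \<zero>) $$ (i, j)"
      unfolding f_def using mat_alg_minus[OF _ ea ij] ij
      by (simp add: mat_alg_simps(3) e_def minus_eq_zero_iff)
  qed
  have "cnorm (M k) f \<le> (\<Sum>i<k. \<Sum>j<k. 1)"
    unfolding mat_alg_simps f by (intro sum_mono) (auto simp: cnorm_co_unit_le)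
  then have 1: "cnorm (M k) f \<le> real k * real k" by simp
  have 2: "cnorm (M k) (d \<otimes>\<^bsub>M k\<^esub> f) < \<epsilon>"
  proof (rule mat_alg_cnorm_le[OF _ \<epsilon>])
    fix i j assume ij: "i < k" "j < k"
    have "(d \<otimes>\<^bsub>M k\<^esub> f) $$ (i, j) = d $$ (i, j) \<otimes> co_unit n"
      unfolding f mat_alg_simps(2) using ij by (intro amult_scalar_right[OF da(1)]) auto
    then show "cnorm R ((d \<otimes>\<^bsub>M k\<^esub> f) $$ (i, j)) \<le> \<epsilon> / (real k * real k + 1)"
      using n(1)[OF ij] by (simp add: \<delta>_def)
  qed
  have 3: "cnorm (M k) (x \<otimes>\<^bsub>M k\<^esub> e \<ominus>\<^bsub>M k\<^esub> e \<otimes>\<^bsub>M k\<^esub> x) < \<epsilon>"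
  proof (rule mat_alg_cnorm_le[OF _ \<epsilon>])
    fix i j assume ij: "i < k" "j < k"
    have "amult R x e \<in> amat R k k" "amult R e x \<in> amat R k k" using xa ea by auto
    then have "(x \<otimes>\<^bsub>M k\<^esub> e \<ominus>\<^bsub>M k\<^esub> e \<otimes>\<^bsub>M k\<^esub> x) $$ (i, j) = amult R x e $$ (i, j) \<ominus> amult R e x $$ (i, j)"
      using ij by (simp only: mat_alg_simps(2) mat_alg_minus)
    also have "\<dots> = x $$ (i, j) \<otimes> unit_of n \<ominus> unit_of n \<otimes> x $$ (i, j)"
      unfolding e_def amult_scalar_right[OF xa unit_of_carrier ij] amult_scalar_left[OF xa unit_of_carrier ij] ..
    finally show "cnorm R ((x \<otimes>\<^bsub>M k\<^esub> e \<ominus>\<^bsub>M k\<^esub> e \<otimes>\<^bsub>M k\<^esub> x) $$ (i, j)) \<le> \<epsilon> / (real k * real k + 1)"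
      using n(2)[OF ij] by (simp add: \<delta>_def)
  qed
  show ?thesis using eK se ee 1 2 3 unfolding f_def by blast
qed

theorem mat_projection_lift:
  assumes x: "x \<in> amat R k k" "aadj R x = x"
    and def: "\<And>i j. i < k \<Longrightarrow> j < k \<Longrightarrow> amult R x x $$ (i, j) \<ominus> x $$ (i, j) \<in> I"
  obtains p where "p \<in> amat R k k" "aadj R p = p" "amult R p p = p"
    "\<And>i j. i < k \<Longrightarrow> j < k \<Longrightarrow> p $$ (i, j) \<ominus> x $$ (i, j) \<in> I"
proof -
  interpret MN: nstar_algebra "M k" by (rule mat_alg_nstar)
  have xc: "x \<in> carrier (M k)" using x by (simp add: mat_alg_simps)
  have xx: "amult R x x \<in> amat R k k" using x by blast
  let ?d = "x \<otimes>\<^bsub>M k\<^esub> x \<ominus>\<^bsub>M k\<^esub> x"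
  have dK: "?d \<in> mat_ideal k"
    using MN.minus_closed[of "amult R x x" x] xx x def
    by (simp add: mat_ideal_def mat_alg_simps(1,2) mat_alg_minus)
  obtain p where p: "p \<in> carrier (M k)" "star (M k) p = p" "p \<otimes>\<^bsub>M k\<^esub> p = p" "p \<ominus>\<^bsub>M k\<^esub> x \<in> mat_ideal k"
  proof (rule MN.projection_lift[OF mat_ideal_ideal mat_ideal_closed xc _ dK])
    show "star (M k) x = x" using x by (simp add: mat_alg_simps)
    show "\<exists>e\<in>mat_ideal k. star (M k) e = e \<and> e \<otimes>\<^bsub>M k\<^esub> e = e \<and>
        cnorm (M k) (\<one>\<^bsub>M k\<^esub> \<ominus>\<^bsub>M k\<^esub> e) \<le> real k * real k \<and>
        cnorm (M k) (?d \<otimes>\<^bsub>M k\<^esub> (\<one>\<^bsub>M k\<^esub> \<ominus>\<^bsub>M k\<^esub> e)) < \<epsilon> \<and>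
        cnorm (M k) (x \<otimes>\<^bsub>M k\<^esub> e \<ominus>\<^bsub>M k\<^esub> e \<otimes>\<^bsub>M k\<^esub> x) < \<epsilon>" if "0 < \<epsilon>" for \<epsilon>
      using mat_quasi_central[OF xc dK that] .
  qed blast+
  have pa: "p \<in> amat R k k" using p by (simp add: mat_alg_simps)
  have "p $$ (i, j) \<ominus> x $$ (i, j) \<in> I" if "i < k" "j < k" for i j
  proof -
    have "(p \<ominus>\<^bsub>M k\<^esub> x) $$ (i, j) \<in> I" using p(4) that by (simp add: mat_ideal_def)
    then show ?thesis using mat_alg_minus[OF pa x(1) that] by simp
  qed
  then show ?thesis using that pa p by (simp add: mat_alg_simps(2,7))
qed

end

section \<open>The unital l-group of integral piecewise linear functions\<close>

definition M1_aff :: "int \<Rightarrow> int \<Rightarrow> real \<Rightarrow> real" where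
  "M1_aff a b = (\<lambda>x\<in>{0..1}. of_int a * x + of_int b)"

text \<open>Partition-free form of integral piecewise linearity for continuous functions: sums and
  maxima combine finite sets of affine functions instead of refining partitions.\<close>

definition affine_selection :: "(real \<Rightarrow> real) \<Rightarrow> (int \<times> int) set \<Rightarrow> bool" where
  "affine_selection f L \<longleftrightarrow>
    finite L \<and> (\<forall>x\<in>{0..1}. \<exists>(a, b)\<in>L. f x = of_int a * x + of_int b)"

section \<open>Local affine form of integral piecewise linear functions\<close>

lemma partition_piece_left:
  fixes t :: "nat \<Rightarrow> real"
  assumes "t 0 \<le> x" "x < t n"
  shows "\<exists>i<n. t i \<le> x \<and> x < t (Suc i)"
  using assms by (induction n) (auto, metis less_Suc_eq not_le)

lemma partition_piece_right:
  fixes t :: "nat \<Rightarrow> real"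
  assumes "t 0 < x" "x \<le> t n"
  shows "\<exists>i<n. t i < x \<and> x \<le> t (Suc i)"
  using assms by (induction n) (auto, metis less_Suc_eq not_le)

lemma pl_integral_right_piece:
  assumes "pl_integral h" "x0 \<in> {0..1}"
  shows "\<exists>\<delta>>0. \<exists>a b :: int. \<forall>x\<in>{0..1}. x0 \<le> x \<longrightarrow> x < x0 + \<delta> \<longrightarrow> h x = of_int a * x + of_int b"
proof -
  obtain n t where t: "t 0 = 0" "t n = 1"
    "\<And>i. i < n \<Longrightarrow> t i < t (Suc i) \<and>
      (\<exists>a b :: int. \<forall>x\<in>{t i..t (Suc i)}. h x = of_int a * x + of_int b)"
    using assms(1) unfolding pl_integral_def by blast
  show ?thesis
  proof (cases "x0 < 1")
    case True
    then obtain i where i: "i < n" "t i \<le> x0" "x0 < t (Suc i)"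
      using partition_piece_left[of t x0 n] t assms by auto
    then obtain a b :: int where ab: "\<forall>x\<in>{t i..t (Suc i)}. h x = of_int a * x + of_int b"
      using t(3) by blast
    show ?thesis using i ab
      by (intro exI[of _ "t (Suc i) - x0"] conjI exI[of _ a] exI[of _ b]) auto
  next
    case False
    then have x0: "x0 = 1" using assms by auto
    then obtain i where i: "i < n" "t i < 1" "1 \<le> t (Suc i)"
      using partition_piece_right[of t x0 n] t assms by auto
    then obtain a b :: int where ab: "\<forall>x\<in>{t i..t (Suc i)}. h x = of_int a * x + of_int b"
      using t(3) by blast
    \<comment> \<open>At the right end only the point 1 itself has to be covered, so the size of
      \<delta> is arbitrary.\<close>
    show ?thesis using i ab x0
      by (intro exI[of _ "1"] conjI exI[of _ a] exI[of _ b]) auto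
  qed
qed

text \<open>Reduces pieces to the left of a point to pieces to the right.\<close>

lemma pl_integral_reflect:
  assumes "pl_integral h"
  shows "pl_integral (\<lambda>x. h (1 - x))"
proof -
  obtain n t where t: "t 0 = 0" "t n = 1"
    "\<And>i. i < n \<Longrightarrow> t i < t (Suc i) \<and>
      (\<exists>a b :: int. \<forall>x\<in>{t i..t (Suc i)}. h x = of_int a * x + of_int b)"
    using assms(1) unfolding pl_integral_def by blast
  define s where "s i = 1 - t (n - i)" for i
  have "s i < s (Suc i) \<and> (\<exists>a b :: int. \<forall>x\<in>{s i..s (Suc i)}. h (1 - x) = of_int a * x + of_int b)"
    if "i < n" for i
  proof -
    define j where "j = n - Suc i"
    have j: "j < n" "n - i = Suc j" using that by (auto simp: j_def)
    obtain a b :: int where ab: "\<forall>x\<in>{t j..t (Suc j)}. h x = of_int a * x + of_int b"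
      using t(3)[OF j(1)] by blast
    have "h (1 - x) = of_int (-a) * x + of_int (a + b)" if "x \<in> {s i..s (Suc i)}" for x
      using ab[rule_format, of "1 - x"] that j by (auto simp: s_def j_def[symmetric] algebra_simps)
    moreover have "s i < s (Suc i)" using t(3)[OF j(1)] j by (simp add: s_def j_def[symmetric])
    ultimately show ?thesis by blast
  qed
  moreover have "s 0 = 0" "s n = 1" using t by (auto simp: s_def)
  ultimately show ?thesis unfolding pl_integral_def by blast
qed

lemma pl_integral_left_piece:
  assumes "pl_integral h" "x0 \<in> {0..1}"
  shows "\<exists>\<delta>>0. \<exists>a b :: int. \<forall>x\<in>{0..1}. x \<le> x0 \<longrightarrow> x0 - \<delta> < x \<longrightarrow> h x = of_int a * x + of_int b"
proof -
  obtain \<delta> and a b :: int where d: "\<delta> > 0"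
    "\<And>x. x \<in> {0..1} \<Longrightarrow> 1 - x0 \<le> x \<Longrightarrow> x < 1 - x0 + \<delta> \<Longrightarrow> h (1 - x) = of_int a * x + of_int b"
    using pl_integral_right_piece[OF pl_integral_reflect[OF assms(1)], of "1 - x0"] assms(2) by auto
  have "h x = of_int (-a) * x + of_int (a + b)" if "x \<in> {0..1}" "x \<le> x0" "x0 - \<delta> < x" for x
    using d(2)[of "1 - x"] that by (auto simp: algebra_simps)
  then show ?thesis using d(1) by blast
qed

text \<open>Two affine germs that agree at x0 combine to their minimum or maximum, according to the
  order of the slopes. So every element of M_1 is locally a lattice term in affine functions, and
  lattice terms are what an endomorphism respects.\<close>

lemma pl_integral_local_form:
  assumes "pl_integral h" "x0 \<in> {0..1}"
  obtains \<delta> and a b a' b' :: int where "\<delta> > 0"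
    "(\<forall>x\<in>{0..1}. \<bar>x - x0\<bar> < \<delta> \<longrightarrow> h x = min (of_int a * x + of_int b) (of_int a' * x + of_int b')) \<or>
     (\<forall>x\<in>{0..1}. \<bar>x - x0\<bar> < \<delta> \<longrightarrow> h x = max (of_int a * x + of_int b) (of_int a' * x + of_int b'))"
proof -
  obtain d1 and a b :: int where 1: "d1 > 0"
    "\<And>x. x \<in> {0..1} \<Longrightarrow> x0 \<le> x \<Longrightarrow> x < x0 + d1 \<Longrightarrow> h x = of_int a * x + of_int b"
    using pl_integral_right_piece[OF assms] by blast
  obtain d2 and a' b' :: int where 2: "d2 > 0"
    "\<And>x. x \<in> {0..1} \<Longrightarrow> x \<le> x0 \<Longrightarrow> x0 - d2 < x \<Longrightarrow> h x = of_int a' * x + of_int b'"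
    using pl_integral_left_piece[OF assms] by blast
  have eq: "of_int a * x0 + of_int b = of_int a' * x0 + of_int b'"
    using 1(2)[of x0] 2(2)[of x0] 1(1) 2(1) assms(2) by auto
  have diff: "(of_int a * x + of_int b) - (of_int a' * x + of_int b') = of_int (a - a') * (x - x0)" for x
    using eq by (simp add: algebra_simps)
  show ?thesis
  proof (cases "a \<le> a'")
    case True
    have "h x = min (of_int a * x + of_int b) (of_int a' * x + of_int b')"
      if "x \<in> {0..1}" "\<bar>x - x0\<bar> < min d1 d2" for x
    proof (cases "x0 \<le> x")
      case T: True
      have "of_int (a - a') * (x - x0) \<le> 0"
        using True T by (intro mult_nonpos_nonneg) auto
      then show ?thesis using 1(2)[of x] that T diff[of x] by auto
    next
      case F: False
      have "of_int (a - a') * (x - x0) \<ge> 0"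
        using True F by (intro mult_nonpos_nonpos) auto
      then show ?thesis using 2(2)[of x] that F diff[of x] by auto
    qed
    then show ?thesis using that[of "min d1 d2" a b a' b'] 1(1) 2(1) by auto
  next
    case False
    have "h x = max (of_int a * x + of_int b) (of_int a' * x + of_int b')"
      if "x \<in> {0..1}" "\<bar>x - x0\<bar> < min d1 d2" for x
    proof (cases "x0 \<le> x")
      case T: True
      have "of_int (a - a') * (x - x0) \<ge> 0"
        using False T by (intro mult_nonneg_nonneg) auto
      then show ?thesis using 1(2)[of x] that T diff[of x] by auto
    next
      case F: False
      have "of_int (a - a') * (x - x0) \<le> 0"
        using False F by (intro mult_nonneg_nonpos) auto
      then show ?thesis using 2(2)[of x] that F diff[of x] by auto
    qed
    then show ?thesis using that[of "min d1 d2" a b a' b'] 1(1) 2(1) by auto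
  qed
qed

section \<open>Partitions and finite affine selections\<close>

lemma pl_integral_imp_affine_selection:
  assumes "pl_integral f"
  obtains L where "affine_selection f L"
proof -
  obtain n t where t: "t 0 = 0" "t n = 1"
    "\<And>i. i < n \<Longrightarrow> t i < t (Suc i) \<and>
      (\<exists>a b :: int. \<forall>x\<in>{t i..t (Suc i)}. f x = of_int a * x + of_int b)"
    using assms(1) unfolding pl_integral_def by blast
  then obtain a b :: "nat \<Rightarrow> int" where ab:
    "\<And>i x. i < n \<Longrightarrow> x \<in> {t i..t (Suc i)} \<Longrightarrow> f x = of_int (a i) * x + of_int (b i)"
    by metis
  have "\<exists>(a, b)\<in>(\<lambda>i. (a i, b i)) ` {..<n}. f x = of_int a * x + of_int b" if x: "x \<in> {0..1}" for x
  proof -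
    have "\<exists>i<n. x \<in> {t i..t (Suc i)}"
    proof (cases "x < 1")
      case True then show ?thesis using partition_piece_left[of t x n] t x by force
    next
      case False then show ?thesis using partition_piece_right[of t x n] t x by force
    qed
    then show ?thesis using ab by auto
  qed
  then show ?thesis by (intro that[of "(\<lambda>i. (a i, b i)) ` {..<n}"]) (auto simp: affine_selection_def)
qed

text \<open>The coincidence sets of \<open>f\<close> with the candidates are finitely many,
  relatively closed, and disjoint by \<open>sep\<close>; as they cover a connected interval, one of
  them is all of it.\<close>

lemma continuous_selection_constant_between:
  fixes f :: "real \<Rightarrow> real"
  assumes "finite L" "continuous_on {s..t} f" "s < t"
    and sel: "\<And>x. x \<in> {s<..<t} \<Longrightarrow> \<exists>p\<in>L. f x = \<phi> p x"
    and cont: "\<And>p. p \<in> L \<Longrightarrow> continuous_on {s..t} (\<phi> p)"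
    and sep: "\<And>x p q. x \<in> {s<..<t} \<Longrightarrow> p \<in> L \<Longrightarrow> q \<in> L \<Longrightarrow> \<phi> p x = \<phi> q x \<Longrightarrow> p = q"
  shows "\<exists>p\<in>L. \<forall>x\<in>{s..t}. f x = \<phi> p x"
proof -
  let ?U = "{s<..<t}"
  define m where "m = (s + t) / 2"
  have m: "m \<in> ?U" using assms(3) by (auto simp: m_def)
  obtain p where p: "p \<in> L" "f m = \<phi> p m" using sel[OF m] by blast
  define S where "S q = {x\<in>?U. f x - \<phi> q x = 0}" for q
  have cl: "closedin (top_of_set ?U) (S q)" if "q \<in> L" for q
    unfolding S_def using assms(2) cont[OF that]
    by (intro continuous_closedin_preimage_constant continuous_intros)
      (auto elim: continuous_on_subset)
  have "closedin (top_of_set ?U) (\<Union>(S ` (L - {p})))"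
    using assms(1) cl by (intro closedin_Union) auto
  moreover have "?U - S p = \<Union>(S ` (L - {p}))"
    using sel sep p(1) unfolding S_def by fastforce
  ultimately have "closedin (top_of_set ?U) (?U - S p)" by simp
  then have "openin (top_of_set ?U) (?U - (?U - S p))" by (intro openin_diff) auto
  moreover have "?U - (?U - S p) = S p" by (auto simp: S_def)
  ultimately have op: "openin (top_of_set ?U) (S p)" by simp
  have mS: "m \<in> S p" using m p by (auto simp: S_def)
  have "S p = {} \<or> S p = ?U"
    using iffD1[OF connected_clopen connected_Ioo, rule_format, OF conjI, OF op cl[OF p(1)]] .
  with mS have "S p = ?U" by blast
  then have "x \<in> S p" if "x \<in> ?U" for x using that by blast
  then have on_open: "f x - \<phi> p x = 0" if "x \<in> ?U" for x using that unfolding S_def by blast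
  have cont': "continuous_on {s..t} (\<lambda>x. f x - \<phi> p x)"
    using assms(2) cont[OF p(1)] by (intro continuous_intros)
  have "closed {x\<in>{s..t}. f x - \<phi> p x = 0}"
    using continuous_closed_preimage_constant[OF cont' closed_atLeastAtMost] .
  \<comment> \<open>Continuity extends the identity to the end points, where candidates may
    meet.\<close>
  then have "closure ?U \<subseteq> {x\<in>{s..t}. f x - \<phi> p x = 0}"
    using on_open by (intro closure_minimal) auto
  then show ?thesis using p(1) assms(3) by auto
qed

text \<open>The breakpoints are 0, 1 and the points where two distinct affine functions of
  \<open>L\<close> cross. Distinct ones cross at most once, so these points are finitely many, and
  strictly between neighbours no two candidates agree.\<close>

lemma affine_selection_imp_pl_integral:
  assumes cont: "continuous_on {0..1} f" and sel: "affine_selection f L"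
  shows "pl_integral f"
proof -
  define \<phi> where "\<phi> p x = of_int (fst p) * x + of_int (snd p)" for p :: "int \<times> int" and x :: real
  have L: "finite L" "\<And>x. x \<in> {0..1} \<Longrightarrow> \<exists>p\<in>L. f x = \<phi> p x"
    using sel unfolding affine_selection_def \<phi>_def by (auto simp: case_prod_beta)
  define C where "C = {0, 1} \<union> (\<Union>p\<in>L. \<Union>q\<in>L - {p}. {x\<in>{0..1}. \<phi> p x = \<phi> q x})"
  have fin: "finite {x\<in>{0..1}. \<phi> p x = \<phi> q x}" if "p \<noteq> q" for p q
  proof (cases "fst p = fst q")
    case True
    then have "{x\<in>{0..1}. \<phi> p x = \<phi> q x} = {}" using that by (auto simp: \<phi>_def prod_eq_iff)
    then show ?thesis by (simp only: finite.emptyI)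
  next
    case False
    have "x = of_int (snd q - snd p) / of_int (fst p - fst q)" if "\<phi> p x = \<phi> q x" for x
      using that False by (simp add: \<phi>_def field_simps)
    then have "{x\<in>{0..1}. \<phi> p x = \<phi> q x} \<subseteq> {of_int (snd q - snd p) / of_int (fst p - fst q)}"
      by blast
    then show ?thesis using finite_subset by blast
  qed
  have fC: "finite C" unfolding C_def using L(1)
    by (intro finite_UnI finite_UN_I finite_Diff fin) auto
  define xs where "xs = sorted_list_of_set C"
  have xs: "sorted xs" "distinct xs" "set xs = C" using fC by (auto simp: xs_def)
  have C01: "C \<subseteq> {0..1}" "0 \<in> C" "1 \<in> C" by (auto simp: C_def)
  then have len: "0 < length xs" using xs(3) by auto
  define n where "n = length xs - 1"
  have idx: "\<exists>i\<le>n. xs ! i = c" if "c \<in> C" for c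
    using that xs(3) len unfolding n_def in_set_conv_nth[of c xs, symmetric]
    by (metis One_nat_def Suc_pred in_set_conv_nth less_Suc_eq_le)
  have mono: "xs ! i \<le> xs ! j" if "i \<le> j" "j \<le> n" for i j
    proof -
    have "j < length xs" using that len unfolding n_def by linarith
    then show ?thesis using sorted_nth_mono[OF xs(1)] that by blast
  qed
  have inC: "xs ! i \<in> C" if "i \<le> n" for i
  proof -
    have "i < length xs" using that len unfolding n_def by linarith
    then show ?thesis using nth_mem xs(3) by blast
  qed
  have "xs ! 0 = 0"
    using idx[OF C01(2)] mono[of 0] inC[of 0] C01(1) by force
  moreover have "xs ! n = 1"
    using idx[OF C01(3)] mono[of _ n] inC[of n] C01(1) by force
  moreover have "xs ! i < xs ! Suc i \<and>
     (\<exists>a b :: int. \<forall>x\<in>{xs ! i..xs ! Suc i}. f x = of_int a * x + of_int b)" if i: "i < n" for i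
  proof -
    have lt: "xs ! i < xs ! Suc i"
    proof -
      have "i < length xs" "Suc i < length xs" using i len unfolding n_def by linarith+
      then have "xs ! i \<noteq> xs ! Suc i" using nth_eq_iff_index_eq[OF xs(2), of i "Suc i"] by simp
      then show ?thesis using mono[of i "Suc i"] i by simp
    qed
    have sub: "{xs ! i..xs ! Suc i} \<subseteq> {0..1}"
      using inC[of i] inC[of "Suc i"] i C01(1) by fastforce
    have gap: "x \<notin> C" if x: "x \<in> {xs ! i<..<xs ! Suc i}" for x
    proof
      assume "x \<in> C"
      then obtain j where j: "j \<le> n" "xs ! j = x" using idx by blast
      show False
      proof (cases "j \<le> i")
        case True then show False using mono[of j i] j x i by auto
      next
        case False then show False using mono[of "Suc i" j] j x i by auto
      qed
    qed
    have "\<exists>p\<in>L. \<forall>x\<in>{xs ! i..xs ! Suc i}. f x = \<phi> p x"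
    proof (rule continuous_selection_constant_between[OF L(1) _ lt])
      show "continuous_on {xs ! i..xs ! Suc i} f" using cont sub continuous_on_subset by blast
      show "\<exists>p\<in>L. f x = \<phi> p x" if "x \<in> {xs ! i<..<xs ! Suc i}" for x
        using L(2)[of x] that sub by force
      show "continuous_on {xs ! i..xs ! Suc i} (\<phi> p)" for p
        unfolding \<phi>_def by (intro continuous_intros)
      show "p = q" if "x \<in> {xs ! i<..<xs ! Suc i}" "p \<in> L" "q \<in> L" "\<phi> p x = \<phi> q x" for x p q
      proof (rule ccontr)
        assume "p \<noteq> q"
        moreover have "x \<in> {0..1}" using that(1) sub by force
        ultimately have "x \<in> C" using that by (auto simp: C_def)
        then show False using gap that by blast
      qed
    qed
    then show ?thesis using lt unfolding \<phi>_def by blast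
  qed
  ultimately show ?thesis unfolding pl_integral_def by (intro exI[of _ n] exI[of _ "\<lambda>i. xs ! i"]) blast
qed

section \<open>Operations of \<open>M1\<close>\<close>

lemma M1_carrier_iff:
  "f \<in> carrier M1 \<longleftrightarrow> f \<in> extensional {0..1} \<and> continuous_on {0..1} f \<and> (\<exists>L. affine_selection f L)"
  unfolding M1_def
  using affine_selection_imp_pl_integral pl_integral_imp_affine_selection by auto blast+

text \<open>One argument for sum, difference, maximum and minimum: by \<open>sel\<close>,
  \<open>H\<close> turns two affine functions into a selection from finitely many.\<close>

lemma M1_carrier_binary:
  assumes "f \<in> carrier M1" "g \<in> carrier M1"
    and cont: "continuous_on {0..1} (\<lambda>x. H (f x) (g x))"
    and sel: "\<And>a b a' b' :: int. \<exists>L. finite L \<and> (\<forall>x::real. \<exists>(c, d)\<in>L.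
      H (of_int a * x + of_int b) (of_int a' * x + of_int b') = of_int c * x + of_int d)"
  shows "(\<lambda>x\<in>{0..1}. H (f x) (g x)) \<in> carrier M1"
proof -
  obtain L L' where L: "affine_selection f L" "affine_selection g L'"
    using assms(1,2) M1_carrier_iff by blast
  have "\<forall>p. \<exists>N. finite N \<and> (\<forall>x::real. \<exists>(c, d)\<in>N.
      H (of_int (fst (fst p)) * x + of_int (snd (fst p))) (of_int (fst (snd p)) * x + of_int (snd (snd p)))
        = of_int c * x + of_int d)" for p
    using sel by blast
  then obtain N where N: "\<And>p. finite (N p)" "\<And>p x::real. \<exists>(c, d)\<in>N p.
      H (of_int (fst (fst p)) * x + of_int (snd (fst p))) (of_int (fst (snd p)) * x + of_int (snd (snd p)))
        = of_int c * x + of_int d"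
    by metis
  have "affine_selection (\<lambda>x\<in>{0..1}. H (f x) (g x)) (\<Union>(N ` (L \<times> L')))"
    unfolding affine_selection_def
  proof (intro conjI ballI)
    show "finite (\<Union>(N ` (L \<times> L')))"
      using L N(1) by (auto simp: affine_selection_def)
    fix x :: real assume x: "x \<in> {0..1}"
    obtain p q where pq: "p \<in> L" "q \<in> L'" "f x = of_int (fst p) * x + of_int (snd p)"
      "g x = of_int (fst q) * x + of_int (snd q)"
      using L x unfolding affine_selection_def by (metis (mono_tags, lifting) case_prod_beta)
    show "\<exists>(a, b)\<in>\<Union>(N ` (L \<times> L')). (\<lambda>x\<in>{0..1}. H (f x) (g x)) x = of_int a * x + of_int b"
      using N(2)[of "(p, q)" x] pq x by (auto intro!: bexI[of _ "(p,q)"])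
  qed
  moreover have "continuous_on {0..1} (\<lambda>x\<in>{0..1}. H (f x) (g x))"
    using cont by (rule continuous_on_eq) simp
  ultimately show ?thesis unfolding M1_carrier_iff by blast
qed

lemma M1_continuous: "f \<in> carrier M1 \<Longrightarrow> continuous_on {0..1} f"
  and M1_pl_integral: "f \<in> carrier M1 \<Longrightarrow> pl_integral f"
  and M1_extensional: "f \<in> carrier M1 \<Longrightarrow> f \<in> extensional {0..1}"
  by (auto simp: M1_def)

lemma M1_add_closed:
  assumes "f \<in> carrier M1" "g \<in> carrier M1"
  shows "(\<lambda>x\<in>{0..1}. f x + g x) \<in> carrier M1"
proof (rule M1_carrier_binary[OF assms])
  show "\<exists>L. finite L \<and> (\<forall>x::real. \<exists>(c, d)\<in>L.
     of_int a * x + of_int b + (of_int a' * x + of_int b') = of_int c * x + of_int d)"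
    for a b a' b' :: int
    by (rule exI[of _ "{(a + a', b + b')}"]) (auto simp: algebra_simps)
qed (use assms M1_continuous in \<open>intro continuous_intros; blast\<close>)

lemma M1_diff_closed:
  assumes "f \<in> carrier M1" "g \<in> carrier M1"
  shows "(\<lambda>x\<in>{0..1}. f x - g x) \<in> carrier M1"
proof (rule M1_carrier_binary[OF assms])
  show "\<exists>L. finite L \<and> (\<forall>x::real. \<exists>(c, d)\<in>L.
     of_int a * x + of_int b - (of_int a' * x + of_int b') = of_int c * x + of_int d)"
    for a b a' b' :: int
    by (rule exI[of _ "{(a - a', b - b')}"]) (auto simp: algebra_simps)
qed (use assms M1_continuous in \<open>intro continuous_intros; blast\<close>)

lemma M1_max_closed:
  assumes "f \<in> carrier M1" "g \<in> carrier M1"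
  shows "(\<lambda>x\<in>{0..1}. max (f x) (g x)) \<in> carrier M1"
proof (rule M1_carrier_binary[OF assms])
  show "\<exists>L. finite L \<and> (\<forall>x::real. \<exists>(c, d)\<in>L.
     max (of_int a * x + of_int b) (of_int a' * x + of_int b') = of_int c * x + of_int d)"
    for a b a' b' :: int
    by (rule exI[of _ "{(a, b), (a', b')}"]) (auto simp: max_def)
qed (use assms M1_continuous in \<open>intro continuous_intros; blast\<close>)

lemma M1_min_closed:
  assumes "f \<in> carrier M1" "g \<in> carrier M1"
  shows "(\<lambda>x\<in>{0..1}. min (f x) (g x)) \<in> carrier M1"
proof (rule M1_carrier_binary[OF assms])
  show "\<exists>L. finite L \<and> (\<forall>x::real. \<exists>(c, d)\<in>L.
     min (of_int a * x + of_int b) (of_int a' * x + of_int b') = of_int c * x + of_int d)"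
    for a b a' b' :: int
    by (rule exI[of _ "{(a, b), (a', b')}"]) (auto simp: min_def)
qed (use assms M1_continuous in \<open>intro continuous_intros; blast\<close>)

lemma M1_aff_closed: "M1_aff a b \<in> carrier M1"
proof -
  have "affine_selection (M1_aff a b) {(a, b)}"
    by (auto simp: affine_selection_def M1_aff_def)
  moreover have "continuous_on {0..1} (M1_aff a b)"
  proof -
    have "continuous_on {0..1} (\<lambda>x::real. of_int a * x + of_int b)" by (intro continuous_intros)
    then show ?thesis by (rule continuous_on_eq) (simp add: M1_aff_def)
  qed
  ultimately show ?thesis unfolding M1_carrier_iff by (auto simp: M1_aff_def)
qed

lemma M1_eqI:
  assumes "f \<in> carrier M1" "g \<in> carrier M1" "\<And>x. x \<in> {0..1} \<Longrightarrow> f x = g x"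
  shows "f = g"
  using assms M1_extensional by (blast intro: extensionalityI)

section \<open>Endomorphisms of \<open>M1\<close> as compositions with \<open>\<eta>\<close>\<close>

locale M1_endo =
  fixes f :: "(real \<Rightarrow> real) \<Rightarrow> real \<Rightarrow> real"
  assumes closed: "h \<in> carrier M1 \<Longrightarrow> f h \<in> carrier M1"
    and f_add: "\<lbrakk>h \<in> carrier M1; k \<in> carrier M1; x \<in> {0..1}\<rbrakk> \<Longrightarrow> f (\<lambda>x\<in>{0..1}. h x + k x) x = f h x + f k x"
    and f_max: "\<lbrakk>h \<in> carrier M1; k \<in> carrier M1; x \<in> {0..1}\<rbrakk> \<Longrightarrow> f (\<lambda>x\<in>{0..1}. max (h x) (k x)) x = max (f h x) (f k x)"
    and f_unit: "x \<in> {0..1} \<Longrightarrow> f (M1_aff 0 1) x = 1"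
begin

lemma f_diff:
  assumes "h \<in> carrier M1" "k \<in> carrier M1" "x \<in> {0..1}"
  shows "f (\<lambda>x\<in>{0..1}. h x - k x) x = f h x - f k x"
proof -
  let ?d = "\<lambda>x\<in>{0..1}. h x - k x"
  have "(\<lambda>x\<in>{0..1}. ?d x + k x) = h"
    using assms by (intro M1_eqI M1_add_closed M1_diff_closed) auto
  then have "f h x = f ?d x + f k x"
    using f_add[OF M1_diff_closed[OF assms(1,2)] assms(2,3)] by simp
  then show ?thesis by simp
qed

text \<open>Joins determine meets in an l-group: h + k - max h k is min h k.\<close>

lemma f_min:
  assumes "h \<in> carrier M1" "k \<in> carrier M1" "x \<in> {0..1}"
  shows "f (\<lambda>x\<in>{0..1}. min (h x) (k x)) x = min (f h x) (f k x)"
proof -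
  let ?s = "\<lambda>x\<in>{0..1}. h x + k x" and ?m = "\<lambda>x\<in>{0..1}. max (h x) (k x)"
  have "(\<lambda>x\<in>{0..1}. min (h x) (k x)) = (\<lambda>x\<in>{0..1}. ?s x - ?m x)"
    by (auto simp: fun_eq_iff)
  then have "f (\<lambda>x\<in>{0..1}. min (h x) (k x)) x = f ?s x - f ?m x"
    using f_diff[OF M1_add_closed[OF assms(1,2)] M1_max_closed[OF assms(1,2)] assms(3)] by simp
  then show ?thesis using f_add[OF assms] f_max[OF assms] by simp
qed

lemma f_aff_add:
  assumes "x \<in> {0..1}"
  shows "f (M1_aff (a + a') (b + b')) x = f (M1_aff a b) x + f (M1_aff a' b') x"
proof -
  have "M1_aff (a + a') (b + b') = (\<lambda>x\<in>{0..1}. M1_aff a b x + M1_aff a' b' x)"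
    by (auto simp: M1_aff_def algebra_simps fun_eq_iff)
  then show ?thesis using f_add[OF M1_aff_closed M1_aff_closed assms] by simp
qed

definition \<eta> :: "real \<Rightarrow> real" where "\<eta> = f (M1_aff 1 0)"

lemma f_aff:
  assumes "x \<in> {0..1}"
  shows "f (M1_aff a b) x = of_int a * \<eta> x + of_int b"
proof -
  have 0: "f (M1_aff 0 0) x = 0" using f_aff_add[OF assms, of 0 0 0 0] by simp
  have A: "f (M1_aff a 0) x = of_int a * \<eta> x" for a
  proof (induction a rule: int_induct[where k = 0])
    case (step1 i)
    then show ?case using f_aff_add[OF assms, of i 1 0 0] by (simp add: \<eta>_def algebra_simps)
  next
    case (step2 i)
    then show ?case using f_aff_add[OF assms, of "i - 1" 1 0 0] by (simp add: \<eta>_def algebra_simps)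
  qed (use 0 in simp)
  have B: "f (M1_aff 0 b) x = of_int b" for b
  proof (induction b rule: int_induct[where k = 0])
    case (step1 i)
    then show ?case using f_aff_add[OF assms, of 0 0 i 1] f_unit[OF assms] by simp
  next
    case (step2 i)
    then show ?case using f_aff_add[OF assms, of 0 0 "i - 1" 1] f_unit[OF assms] by simp
  qed (use 0 in simp)
  show ?thesis using f_aff_add[OF assms, of a 0 0 b] A[of a] B[of b] by simp
qed

text \<open>The inequalities 0 \<le> id \<le> 1 are lattice equations, which \<open>f\<close>
  preserves.\<close>

lemma \<eta>_range:
  assumes "x \<in> {0..1}"
  shows "\<eta> x \<in> {0..1}"
proof -
  have 1: "(\<lambda>x\<in>{0..1}. max (M1_aff 1 0 x) (M1_aff 0 0 x)) = M1_aff 1 0"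
    "(\<lambda>x\<in>{0..1}. min (M1_aff 1 0 x) (M1_aff 0 1 x)) = M1_aff 1 0"
    by (auto simp: M1_aff_def fun_eq_iff)
  show ?thesis
    using f_max[OF M1_aff_closed M1_aff_closed assms, of 1 0 0 0]
      f_min[OF M1_aff_closed M1_aff_closed assms, of 1 0 0 1] f_aff[OF assms] unfolding 1
    by (auto simp: max_def min_def split: if_splits)
qed

text \<open>A bump u at \<eta> y supported in the \<delta>-neighbourhood satisfies min |h - k| u =
  0, and \<open>f\<close> preserves this equation. As u is a lattice term in affine functions, f u y
  = u (\<eta> y) > 0, so \<open>f\<close> maps |h - k| to a function vanishing at y.\<close>

lemma f_eq_if_locally_eq:
  assumes "h \<in> carrier M1" "k \<in> carrier M1" "y \<in> {0..1}" "\<delta> > 0"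
    and eq: "\<And>x. x \<in> {0..1} \<Longrightarrow> \<bar>x - \<eta> y\<bar> < \<delta> \<Longrightarrow> h x = k x"
  shows "f h y = f k y"
proof -
  let ?x0 = "\<eta> y"
  obtain N :: nat where N: "N > 0" "1 / real N < \<delta>"
    by (metis assms(4) nat_approx_posE zero_less_Suc of_nat_Suc)
  \<comment> \<open>Integers strictly on either side of N \<eta> y and at distance at most 1 from
    it, also when N \<eta> y is itself an integer. Strictness makes the bump positive at \<eta> y;
    the distance makes it vanish from 1/N on.\<close>
  define c where "c = \<lceil>N * ?x0\<rceil> - 1"
  define c' where "c' = \<lfloor>N * ?x0\<rfloor> + 1"
  have c: "of_int c < N * ?x0" "N * ?x0 < of_int c'" "N * ?x0 - 1 \<le> of_int c" "of_int c' \<le> N * ?x0 + 1"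
    unfolding c_def c'_def by linarith+
  define l where "l = (\<lambda>x\<in>{0..1}. min (M1_aff (int N) (-c) x) (M1_aff (-int N) c' x))"
  define u where "u = (\<lambda>x\<in>{0..1}. max (M1_aff 0 0 x) (l x))"
  define d where "d = (\<lambda>x\<in>{0..1}. max ((\<lambda>x\<in>{0..1}. h x - k x) x) ((\<lambda>x\<in>{0..1}. k x - h x) x))"
  have lM: "l \<in> carrier M1" unfolding l_def by (intro M1_min_closed M1_aff_closed)
  have uM: "u \<in> carrier M1" unfolding u_def by (intro M1_max_closed M1_aff_closed lM)
  have dM: "d \<in> carrier M1" unfolding d_def by (intro M1_max_closed M1_diff_closed assms)
  have "(\<lambda>x\<in>{0..1}. min (d x) (u x)) = M1_aff 0 0"
  proof (intro M1_eqI M1_min_closed dM uM M1_aff_closed)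
    fix x :: real assume x: "x \<in> {0..1}"
    have d: "d x = \<bar>h x - k x\<bar>" using x by (auto simp: d_def)
    have u: "u x = max 0 (min (N * x - c) (c' - N * x))"
      using x by (auto simp: u_def l_def M1_aff_def)
    have "min (d x) (u x) = 0"
    proof (cases "\<bar>x - ?x0\<bar> < \<delta>")
      case True then show ?thesis using eq[OF x] d u by auto
    next
      case False
      then have "1 / real N \<le> \<bar>x - ?x0\<bar>" using N by linarith
      then have "1 \<le> N * \<bar>x - ?x0\<bar>" using N(1) by (simp add: field_simps)
      also have "\<dots> = \<bar>N * x - N * ?x0\<bar>"
        by (simp add: abs_mult right_diff_distrib[symmetric])
      finally have "u x = 0" using u c by auto
      then show ?thesis using d by auto
    qed
    then show "(\<lambda>x\<in>{0..1}. min (d x) (u x)) x = M1_aff 0 0 x" using x by (simp add: M1_aff_def)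
  qed
  then have "min (f d y) (f u y) = 0"
    using f_min[OF dM uM assms(3)] f_aff[OF assms(3), of 0 0] by simp
  moreover have "f d y = max (f h y - f k y) (f k y - f h y)"
    unfolding d_def f_max[OF M1_diff_closed[OF assms(1,2)] M1_diff_closed[OF assms(2,1)] assms(3)]
      f_diff[OF assms(1-3)] f_diff[OF assms(2,1,3)] by (rule refl)
  moreover have "f l y = min (N * ?x0 - c) (c' - N * ?x0)"
    unfolding l_def using f_min[OF M1_aff_closed M1_aff_closed assms(3)] f_aff[OF assms(3)] by simp
  then have "f u y = max 0 (min (N * ?x0 - c) (c' - N * ?x0))"
    unfolding u_def using f_max[OF M1_aff_closed lM assms(3)] f_aff[OF assms(3)] by simp
  ultimately show ?thesis using c by (auto simp: max_def min_def split: if_splits)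
qed

text \<open>Near \<eta> y, \<open>h\<close> agrees with the minimum or maximum of two affine
  functions, where \<open>f\<close> is known; locality transfers the value.\<close>

lemma f_eq_comp:
  assumes h: "h \<in> carrier M1" and y: "y \<in> {0..1}"
  shows "f h y = h (\<eta> y)"
proof -
  obtain \<delta> and a b a' b' :: int where d: "\<delta> > 0"
    "(\<forall>x\<in>{0..1}. \<bar>x - \<eta> y\<bar> < \<delta> \<longrightarrow> h x = min (of_int a * x + of_int b) (of_int a' * x + of_int b')) \<or>
     (\<forall>x\<in>{0..1}. \<bar>x - \<eta> y\<bar> < \<delta> \<longrightarrow> h x = max (of_int a * x + of_int b) (of_int a' * x + of_int b'))"
    using pl_integral_local_form[OF M1_pl_integral[OF h] \<eta>_range[OF y]] by blast
  let ?mn = "\<lambda>x\<in>{0..1}. min (M1_aff a b x) (M1_aff a' b' x)"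
  let ?mx = "\<lambda>x\<in>{0..1}. max (M1_aff a b x) (M1_aff a' b' x)"
  have cl: "?mn \<in> carrier M1" "?mx \<in> carrier M1"
    by (intro M1_min_closed M1_max_closed M1_aff_closed)+
  have fm: "f ?mn y = ?mn (\<eta> y)" "f ?mx y = ?mx (\<eta> y)"
    using f_min[OF M1_aff_closed M1_aff_closed y] f_max[OF M1_aff_closed M1_aff_closed y]
      f_aff[OF y] \<eta>_range[OF y] by (auto simp: M1_aff_def)
  from d(2) show ?thesis
  proof
    assume A: "\<forall>x\<in>{0..1}. \<bar>x - \<eta> y\<bar> < \<delta> \<longrightarrow> h x = min (of_int a * x + of_int b) (of_int a' * x + of_int b')"
    have "f h y = f ?mn y"
      using A by (intro f_eq_if_locally_eq[OF h cl(1) y d(1)]) (auto simp: M1_aff_def)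
    then show ?thesis using fm A d(1) \<eta>_range[OF y] by (auto simp: M1_aff_def)
  next
    assume A: "\<forall>x\<in>{0..1}. \<bar>x - \<eta> y\<bar> < \<delta> \<longrightarrow> h x = max (of_int a * x + of_int b) (of_int a' * x + of_int b')"
    have "f h y = f ?mx y"
      using A by (intro f_eq_if_locally_eq[OF h cl(2) y d(1)]) (auto simp: M1_aff_def)
    then show ?thesis using fm A d(1) \<eta>_range[OF y] by (auto simp: M1_aff_def)
  qed
qed

end

text \<open>An injective continuous \<open>g\<close> with g 0 < g 1 is strictly increasing, so each
  slope is a positive integer, hence at least 1; the growth over the pieces then adds up to at least
  the length of the interval.\<close>

lemma increasing_pl_integral_growth:
  assumes "continuous_on {0..1} g" "inj_on g {0..1}" "pl_integral g" "g 0 < g 1"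
  shows "1 \<le> g 1 - g 0"
proof -
  \<comment> \<open>\<open>continuous_inj_imp_mono\<close> compares an inner point with the two
    ends; a second application, on [0, x'], compares arbitrary points.\<close>
  have m1: "g 0 < g x \<and> g x \<le> g 1" if "x \<in> {0<..1}" for x
    using continuous_inj_imp_mono[of 0 x 1 g] assms that by (cases "x = 1") auto
  have mono: "g x < g x'" if "0 \<le> x" "x < x'" "x' \<le> 1" for x x'
  proof (cases "x = 0")
    case True then show ?thesis using m1[of x'] that by auto
  next
    case False
    have "continuous_on {0..x'} g" "inj_on g {0..x'}"
      using assms that by (auto elim!: continuous_on_subset inj_on_subset)
    then show ?thesis
      using continuous_inj_imp_mono[of 0 x x' g] m1[of x'] that False by auto
  qed
  obtain n t where t: "t 0 = 0" "t n = 1"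
    "\<And>i. i < n \<Longrightarrow> t i < t (Suc i) \<and>
      (\<exists>a b :: int. \<forall>x\<in>{t i..t (Suc i)}. g x = of_int a * x + of_int b)"
    using assms(3) unfolding pl_integral_def by blast
  have tm: "t i \<le> t j" if "i \<le> j" "j \<le> n" for i j
    using that
  proof (induction j)
    case (Suc j)
    then show ?case using t(3)[of j] by (cases "i = Suc j") auto
  qed simp
  have "t i \<le> g (t i) - g 0" if "i \<le> n" for i
    using that
  proof (induction i)
    case 0 then show ?case using t by simp
  next
    case (Suc i)
    then have i: "i < n" by simp
    obtain a b :: int where ab: "\<forall>x\<in>{t i..t (Suc i)}. g x = of_int a * x + of_int b"
      using t(3)[OF i] by blast
    have lt: "t i < t (Suc i)" using t(3)[OF i] by blast
    have eq: "g (t (Suc i)) - g (t i) = of_int a * (t (Suc i) - t i)"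
      using ab lt by (simp add: algebra_simps)
    have "g (t i) < g (t (Suc i))"
      using mono[OF _ lt] tm[of 0 i] tm[of "Suc i" n] i t by auto
    then have "0 < of_int a * (t (Suc i) - t i)" using eq by simp
    then have "0 < a" using lt by (simp add: zero_less_mult_iff)
    then have "1 * (t (Suc i) - t i) \<le> of_int a * (t (Suc i) - t i)"
      using lt by (intro mult_right_mono) auto
    then show ?case using Suc eq by simp
  qed
  from this[of n] show ?thesis using t by simp
qed

text \<open>A one-to-one integral piecewise linear function has nonzero integer slopes of constant
  sign, hence total variation at least 1.\<close>

theorem (in M1_endo) M1_endo_inj:
  assumes surj: "h \<in> carrier M1" "f h = M1_aff 1 0"
  shows "inj_on f (carrier M1)"
proof -
  have \<eta>M: "\<eta> \<in> carrier M1" unfolding \<eta>_def by (intro closed M1_aff_closed)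
  \<comment> \<open>A preimage of the identity function under \<open>f\<close> is a left inverse of
    \<eta>.\<close>
  have h: "h (\<eta> y) = y" if "y \<in> {0..1}" for y
    using f_eq_comp[OF surj(1) that] surj(2) that by (simp add: M1_aff_def)
  then have inj: "inj_on \<eta> {0..1}" by (metis inj_onI)
  then have ne: "\<eta> 0 \<noteq> \<eta> 1" by (auto dest: inj_onD)
  have cont: "continuous_on {0..1} \<eta>" using M1_continuous[OF \<eta>M] .
  have r: "\<eta> 0 \<in> {0..1}" "\<eta> 1 \<in> {0..1}" using \<eta>_range by auto
  have onto: "\<exists>y\<in>{0..1}. \<eta> y = x" if x: "x \<in> {0..1}" for x
  proof (cases "\<eta> 0 < \<eta> 1")
    case True
    \<comment> \<open>As both values lie in [0,1], this forces \<eta> 0 = 0 and \<eta> 1 =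
      1.\<close>
    then have "1 \<le> \<eta> 1 - \<eta> 0"
      using increasing_pl_integral_growth cont inj M1_pl_integral[OF \<eta>M] by blast
    then show ?thesis using IVT'[of \<eta> 0 x 1] cont r x by auto
  next
    case False
    \<comment> \<open>The decreasing case, reduced to the increasing one by a change of
      sign.\<close>
    define g where "g = (\<lambda>x\<in>{0..1}. M1_aff 0 0 x - \<eta> x)"
    have gM: "g \<in> carrier M1" unfolding g_def by (intro M1_diff_closed M1_aff_closed \<eta>M)
    have g: "g x = - \<eta> x" if "x \<in> {0..1}" for x using that by (simp add: g_def M1_aff_def)
    have "inj_on g {0..1}" using inj g by (simp add: inj_on_def)
    then have "1 \<le> g 1 - g 0"
      using False ne g by (intro increasing_pl_integral_growth M1_continuous M1_pl_integral gM) auto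
    then show ?thesis using IVT2'[of \<eta> 1 x 0] cont r x g by auto
  qed
  show ?thesis
  proof (rule inj_onI)
    fix k k' assume k: "k \<in> carrier M1" "k' \<in> carrier M1" "f k = f k'"
    show "k = k'"
    proof (rule M1_eqI[OF k(1,2)])
      fix x :: real assume "x \<in> {0..1}"
      then obtain y where "y \<in> {0..1}" "\<eta> y = x" using onto by blast
      then show "k x = k' x" using f_eq_comp[of _ y] k by metis
    qed
  qed
qed

section \<open>Functoriality of \<open>K\<^sub>0\<close>\<close>

context star_ring begin

lemma K0_rel_dsum:
  assumes "((p, q), (a, b)) \<in> K0_rel R" "((p', q'), (a', b')) \<in> K0_rel R"
  shows "((dsum R p p', dsum R q q'), (dsum R a a', dsum R b b')) \<in> K0_rel R"
proof -
  have P: "p \<in> projections R" "q \<in> projections R" "a \<in> projections R" "b \<in> projections R"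
    "p' \<in> projections R" "q' \<in> projections R" "a' \<in> projections R" "b' \<in> projections R"
    using assms by (auto simp: K0_rel_iff)
  obtain r where r: "r \<in> projections R" "mvn_equiv R (dsums [p, b, r]) (dsums [a, q, r])"
    using assms(1) by (auto simp: K0_rel_iff)
  obtain s where s: "s \<in> projections R" "mvn_equiv R (dsums [p', b', s]) (dsums [a', q', s])"
    using assms(2) by (auto simp: K0_rel_iff)
  have ex: "dsums [dsum R c c', dsum R d d', dsum R r s] = dsums [c, c', d, d', r, s]" for c c' d d'
    by (simp add: dsums_Cons dsums_Nil dsum_assoc)
  have app: "dsum R (dsums [c, d, e]) (dsums [f, g, h]) = dsums [c, d, e, f, g, h]" for c d e f g h
    by (simp add: dsums_Cons dsums_Nil dsum_assoc)
  have "mvn_equiv R (dsums [p, p', b, b', r, s]) (dsums [p, b, r, p', b', s])"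
    using P r s by (intro mvn_dsums_mset) auto
  moreover have "mvn_equiv R (dsums [p, b, r, p', b', s]) (dsums [a, q, r, a', q', s])"
    using mvn_dsum[OF r(2) s(2)] by (simp only: app)
  moreover have "mvn_equiv R (dsums [a, q, r, a', q', s]) (dsums [a, a', q, q', r, s])"
    using P r s by (intro mvn_dsums_mset) auto
  moreover have "set [p, p', b, b', r, s] \<subseteq> projections R" "set [a, q, r, a', q', s] \<subseteq> projections R"
    "set [a, a', q, q', r, s] \<subseteq> projections R"
    using P r s by auto
  ultimately have "mvn_equiv R (dsums [dsum R p p', dsum R b b', dsum R r s])
      (dsums [dsum R a a', dsum R q q', dsum R r s])"
    unfolding ex by (meson mvn_trans dsums_projections)
  then show ?thesis using P r(1) s(1) dsum_projections by (auto simp: K0_rel_iff)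
qed

lemma K0_class_self: "p \<in> projections R \<Longrightarrow> q \<in> projections R \<Longrightarrow> (p, q) \<in> K0_class R p q"
  unfolding K0_class_def by (intro equiv_class_self[OF equiv_K0_rel]) auto

lemma K0_add_class:
  assumes P: "p \<in> projections R" "q \<in> projections R" "p' \<in> projections R" "q' \<in> projections R"
  shows "K0_add R (K0_class R p q) (K0_class R p' q') = K0_class R (dsum R p p') (dsum R q q')"
proof -
  have *: "K0_class R (dsum R a a') (dsum R b b') = K0_class R (dsum R p p') (dsum R q q')"
    if "(a, b) \<in> K0_class R p q" "(a', b') \<in> K0_class R p' q'" for a b a' b'
  proof -
    have rel: "((p, q), (a, b)) \<in> K0_rel R" "((p', q'), (a', b')) \<in> K0_rel R"
      using that by (auto simp: K0_class_def)
    from K0_rel_dsum[OF this] show ?thesis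
      unfolding K0_class_def by (intro equiv_class_eq[OF equiv_K0_rel, symmetric])
  qed
  have "K0_add R (K0_class R p q) (K0_class R p' q') =
      (\<Union>x\<in>K0_class R p q. \<Union>y\<in>K0_class R p' q'. K0_class R (dsum R p p') (dsum R q q'))"
    unfolding K0_add_def
    by (intro SUP_cong refl, clarsimp simp only: prod.case, intro SUP_cong refl,
        clarsimp simp only: prod.case *)
  then show ?thesis using K0_class_self P by blast
qed

end

context star_hom begin

lemma K0_map_closed: "X \<in> carrier (K0 A) \<Longrightarrow> K0_map B h X \<in> carrier (K0 B)"
  by (elim A.K0_carrierE) (simp add: K0_map_class B.K0_class_in_carrier map_mat_projections)

lemma K0_map_add:
  assumes "X \<in> carrier (K0 A)" "Y \<in> carrier (K0 A)"
  shows "K0_map B h (K0_add A X Y) = K0_add B (K0_map B h X) (K0_map B h Y)"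
proof -
  obtain p q where X: "p \<in> projections A" "q \<in> projections A" "X = K0_class A p q"
    using A.K0_carrierE[OF assms(1)] .
  obtain p' q' where Y: "p' \<in> projections A" "q' \<in> projections A" "Y = K0_class A p' q'"
    using A.K0_carrierE[OF assms(2)] .
  show ?thesis using X Y
    by (simp add: A.K0_add_class B.K0_add_class K0_map_class map_mat_projections A.dsum_projections map_mat_dsum)
qed

lemma map_mat_zero_proj: "map_mat h (zero_proj A) = zero_proj B"
  and map_mat_unit_proj: "map_mat h (unit_proj A) = unit_proj B"
  by (auto simp: zero_proj_def unit_proj_def intro!: eq_matI)

lemma K0_map_unit: "K0_map B h (pg_unit (K0 A)) = pg_unit (K0 B)"
  by (simp add: K0_def K0_map_class A.zero_proj_projection A.unit_proj_projection map_mat_zero_proj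
      map_mat_unit_proj)

lemma K0_map_le:
  assumes "X \<in> carrier (K0 A)" "pg_le (K0 A) X Y"
  shows "pg_le (K0 B) (K0_map B h X) (K0_map B h Y)"
proof -
  obtain p where p: "p \<in> projections A" "Y = K0_add A X (K0_class A p (zero_proj A))"
    using assms(2) by (auto simp: K0_def)
  have "K0_map B h Y = K0_add B (K0_map B h X) (K0_class B (map_mat h p) (zero_proj B))"
    unfolding p(2) using p(1) assms(1)
    by (simp add: K0_map_add A.K0_class_in_carrier A.zero_proj_projection K0_map_class map_mat_zero_proj)
  then show ?thesis using map_mat_projections[OF p(1)] by (auto simp: K0_def)
qed

end

text \<open>The inverse map is induced by h', and both maps are monotone; hence the order is
  reflected as well as preserved.\<close>

lemma K0_map_iso:
  assumes "star_hom A B h" "star_hom B A h'"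
    and inv: "\<And>x. x \<in> carrier A \<Longrightarrow> h' (h x) = x" "\<And>y. y \<in> carrier B \<Longrightarrow> h (h' y) = y"
  shows "K0_map B h \<in> unital_po_iso (K0 A) (K0 B)"
proof -
  interpret H: star_hom A B h by fact
  interpret H': star_hom B A h' by fact
  have mm: "map_mat h' (map_mat h p) = p" if "p \<in> projections A" for p
    using amatD(2,3)[OF H.A.projectionsD(1)[OF that]] inv(1) by (intro eq_matI) auto
  have mm': "map_mat h (map_mat h' p) = p" if "p \<in> projections B" for p
    using amatD(2,3)[OF H.B.projectionsD(1)[OF that]] inv(2) by (intro eq_matI) auto
  have 1: "K0_map A h' (K0_map B h X) = X" if "X \<in> carrier (K0 A)" for X
    using that by (elim H.A.K0_carrierE) (simp add: H.K0_map_class H'.K0_map_class H.map_mat_projections mm)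
  have 2: "K0_map B h (K0_map A h' X) = X" if "X \<in> carrier (K0 B)" for X
    using that by (elim H.B.K0_carrierE) (simp add: H.K0_map_class H'.K0_map_class H'.map_mat_projections mm')
  have "bij_betw (K0_map B h) (carrier (K0 A)) (carrier (K0 B))"
    using 1 2 H.K0_map_closed H'.K0_map_closed by (intro bij_betw_byWitness[where f' = "K0_map A h'"]) auto
  moreover have "K0_map B h \<in> hom (K0 A) (K0 B)"
  proof (rule homI)
    fix X Y assume XY: "X \<in> carrier (K0 A)" "Y \<in> carrier (K0 A)"
    show "K0_map B h X \<in> carrier (K0 B)" using H.K0_map_closed XY by blast
    show "K0_map B h (X \<otimes>\<^bsub>K0 A\<^esub> Y) = K0_map B h X \<otimes>\<^bsub>K0 B\<^esub> K0_map B h Y"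
      using H.K0_map_add[OF XY] by (simp add: K0_def)
  qed
  moreover have "pg_le (K0 A) X Y \<longleftrightarrow> pg_le (K0 B) (K0_map B h X) (K0_map B h Y)"
    if "X \<in> carrier (K0 A)" "Y \<in> carrier (K0 A)" for X Y
    using H.K0_map_le[of X Y] H'.K0_map_le[of "K0_map B h X" "K0_map B h Y"] 1 that H.K0_map_closed by metis
  ultimately show ?thesis
    using H.K0_map_unit by (auto simp: unital_po_iso_def iso_def)
qed

section \<open>Joins in ordered groups\<close>

text \<open>A join described by the order alone can be transported along
  \<open>unital_po_iso\<close>, which speaks of the order only, to \<open>M1\<close>, where it is
  the pointwise maximum.\<close>

definition is_join :: "'g pogroup \<Rightarrow> 'g \<Rightarrow> 'g \<Rightarrow> 'g \<Rightarrow> bool" where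
  "is_join G x y z \<longleftrightarrow> z \<in> carrier G \<and> pg_le G x z \<and> pg_le G y z \<and>
    (\<forall>w\<in>carrier G. pg_le G x w \<longrightarrow> pg_le G y w \<longrightarrow> pg_le G z w)"

lemma order_of_simps [simp]:
  "carrier (order_of G) = carrier G" "gorder.le (order_of G) = pg_le G" "eq (order_of G) = (=)"
  by (auto simp: order_of_def)

lemma lattice_antisym:
  assumes "Lattice.lattice (order_of G)" "x \<in> carrier G" "y \<in> carrier G" "pg_le G x y" "pg_le G y x"
  shows "x = y"
proof -
  interpret Lattice.lattice "order_of G" by fact
  show ?thesis using assms by (intro le_antisym) auto
qed

lemma lattice_is_join:
  assumes "Lattice.lattice (order_of G)" "x \<in> carrier G" "y \<in> carrier G"
  shows "is_join G x y (x \<squnion>\<^bsub>order_of G\<^esub> y)"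
proof -
  interpret Lattice.lattice "order_of G" by fact
  show ?thesis
    using sup_of_two_least[of x y] assms(2,3)
    by (auto simp: is_join_def join_def least_def Upper_def)
qed

lemma join_pres_is_join:
  assumes "join_pres (order_of G) (order_of H) f" "f \<in> carrier G \<rightarrow> carrier H"
    and "x \<in> carrier G" "y \<in> carrier G" "is_join G x y z"
  shows "is_join H (f x) (f y) (f z)"
proof -
  have L: "Lattice.lattice (order_of G)" "Lattice.lattice (order_of H)"
    "f (x \<squnion>\<^bsub>order_of G\<^esub> y) = f x \<squnion>\<^bsub>order_of H\<^esub> f y"
    using assms by (auto simp: join_pres_def)
  have "z = x \<squnion>\<^bsub>order_of G\<^esub> y"
    using lattice_is_join[OF L(1) assms(3,4)] assms(5)
    by (intro lattice_antisym[OF L(1)]) (auto simp: is_join_def)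
  then show ?thesis using lattice_is_join[OF L(2), of "f x" "f y"] L(3) assms by auto
qed

lemma unital_po_isoD:
  assumes "f \<in> unital_po_iso G H"
  shows "bij_betw f (carrier G) (carrier H)" "f \<in> carrier G \<rightarrow> carrier H"
    "\<And>x y. x \<in> carrier G \<Longrightarrow> y \<in> carrier G \<Longrightarrow> f (x \<otimes>\<^bsub>G\<^esub> y) = f x \<otimes>\<^bsub>H\<^esub> f y"
    "\<And>x y. x \<in> carrier G \<Longrightarrow> y \<in> carrier G \<Longrightarrow> pg_le G x y \<longleftrightarrow> pg_le H (f x) (f y)"
    "f (pg_unit G) = pg_unit H"
  using assms by (auto simp: unital_po_iso_def iso_def hom_def)

lemma unital_po_iso_is_join:
  assumes f: "f \<in> unital_po_iso G H" and "x \<in> carrier G" "y \<in> carrier G" "is_join G x y z"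
  shows "is_join H (f x) (f y) (f z)"
proof -
  have "pg_le H (f z) w" if "w \<in> carrier H" "pg_le H (f x) w" "pg_le H (f y) w" for w
  proof -
    have "w \<in> f ` carrier G"
      using that(1) unfolding bij_betw_imp_surj_on[OF unital_po_isoD(1)[OF f]] .
    then obtain v where "v \<in> carrier G" "w = f v" by blast
    then show ?thesis using that assms unital_po_isoD(4)[OF f] by (auto simp: is_join_def)
  qed
  then show ?thesis using assms unital_po_isoD(2,4)[OF f] by (auto simp: is_join_def)
qed

lemma unital_po_iso_inv:
  assumes "group G" "pg_unit G \<in> carrier G" "f \<in> unital_po_iso G H"
  shows "inv_into (carrier G) f \<in> unital_po_iso H G"
proof -
  let ?g = "inv_into (carrier G) f"
  note f = unital_po_isoD[OF assms(3)]
  have iso: "?g \<in> iso H G" using assms by (auto simp: unital_po_iso_def intro: group.iso_set_sym)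
  have cl: "?g x \<in> carrier G" "f (?g x) = x" if "x \<in> carrier H" for x
    using that f(1) by (auto simp: bij_betw_def inv_into_into f_inv_into_f)
  have "pg_le H x y \<longleftrightarrow> pg_le G (?g x) (?g y)" if "x \<in> carrier H" "y \<in> carrier H" for x y
    using f(4)[OF cl(1)[OF that(1)] cl(1)[OF that(2)]] cl(2) that by simp
  moreover have "?g (pg_unit H) = pg_unit G"
    using f(1,5) assms(2) by (metis bij_betw_def inv_into_f_f)
  ultimately show ?thesis using iso by (simp add: unital_po_iso_def)
qed

lemma M1_simps:
  "pg_le M1 f g \<longleftrightarrow> (\<forall>x\<in>{0..1}. f x \<le> g x)"
  "f \<otimes>\<^bsub>M1\<^esub> g = (\<lambda>x\<in>{0..1}. f x + g x)"
  "pg_unit M1 = M1_aff 0 1"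
  by (auto simp: M1_def M1_aff_def)

lemma M1_is_join_iff:
  assumes "f \<in> carrier M1" "g \<in> carrier M1"
  shows "is_join M1 f g h \<longleftrightarrow> h = (\<lambda>x\<in>{0..1}. max (f x) (g x))"
proof -
  have *: "is_join M1 f g (\<lambda>x\<in>{0..1}. max (f x) (g x))"
    using M1_max_closed[OF assms] by (auto simp: is_join_def M1_simps)
  have "h = h'" if "is_join M1 f g h" "is_join M1 f g h'" for h'
    using that by (intro M1_eqI order_antisym) (auto simp: is_join_def M1_simps)
  with * show ?thesis by blast
qed

text \<open>Conjugating \<open>\<tau> \<circ> g\<close> by \<psi> yields an endomorphism of M_1
  whose range contains the identity function, because \<open>g\<close> is onto.\<close>

theorem M1_hopfian:
  fixes G :: "'g pogroup" and H :: "'h pogroup"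
  assumes G: "unital_l_group G"
    and \<psi>: "\<psi> \<in> unital_po_iso G M1" and \<tau>: "\<tau> \<in> unital_po_iso H G"
    and g: "g \<in> unital_l_hom G H" "g ` carrier G = carrier H"
  shows "inj_on g (carrier G)"
proof -
  interpret G: unital_l_group G by fact
  define \<psi>' where "\<psi>' = inv_into (carrier G) \<psi>"
  have \<psi>': "\<psi>' \<in> unital_po_iso M1 G"
    unfolding \<psi>'_def using unital_po_iso_inv[OF G.is_group G.unit_closed \<psi>] .
  define f where "f h = \<psi> (\<tau> (g (\<psi>' h)))" for h
  note \<psi>D = unital_po_isoD[OF \<psi>] and \<psi>'D = unital_po_isoD[OF \<psi>'] and \<tau>D = unital_po_isoD[OF \<tau>]
  have gD: "g \<in> carrier G \<rightarrow> carrier H" "g (pg_unit G) = pg_unit H"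
    "\<And>x y. x \<in> carrier G \<Longrightarrow> y \<in> carrier G \<Longrightarrow> g (x \<otimes>\<^bsub>G\<^esub> y) = g x \<otimes>\<^bsub>H\<^esub> g y"
    "join_pres (order_of G) (order_of H) g"
    using g(1) by (auto simp: unital_l_hom_def hom_def)
  have c1: "\<psi>' h \<in> carrier G" if "h \<in> carrier M1" for h using \<psi>'D(2) that by blast
  have c2: "g (\<psi>' h) \<in> carrier H" if "h \<in> carrier M1" for h using gD(1) c1[OF that] by blast
  have c3: "\<tau> (g (\<psi>' h)) \<in> carrier G" if "h \<in> carrier M1" for h using \<tau>D(2) c2[OF that] by blast
  have c4: "f h \<in> carrier M1" if "h \<in> carrier M1" for h
    unfolding f_def using \<psi>D(2) c3[OF that] by blast
  have join: "is_join M1 (f h) (f k) (f l)" if "h \<in> carrier M1" "k \<in> carrier M1" "is_join M1 h k l" for h k l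
    unfolding f_def using that c1 c2 c3
    by (intro unital_po_iso_is_join[OF \<psi>] unital_po_iso_is_join[OF \<tau>] join_pres_is_join[OF gD(4,1)]
        unital_po_iso_is_join[OF \<psi>'])
  have mult: "f (h \<otimes>\<^bsub>M1\<^esub> k) = f h \<otimes>\<^bsub>M1\<^esub> f k" if "h \<in> carrier M1" "k \<in> carrier M1" for h k
    unfolding f_def using that c1 c2 c3 by (simp add: \<psi>D(3) \<psi>'D(3) \<tau>D(3) gD(3))
  have unit: "f (M1_aff 0 1) = M1_aff 0 1"
    unfolding f_def M1_simps(3)[symmetric] by (simp add: \<psi>D(5) \<psi>'D(5) \<tau>D(5) gD(2))
  interpret M1_endo f
  proof
    fix h k x assume hk: "h \<in> carrier M1" "k \<in> carrier M1" and x: "x \<in> {0..1::real}"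
    show "f (\<lambda>x\<in>{0..1}. h x + k x) x = f h x + f k x"
      using mult[OF hk] x by (simp add: M1_simps)
    show "f (\<lambda>x\<in>{0..1}. max (h x) (k x)) x = max (f h x) (f k x)"
      using join[OF hk, unfolded M1_is_join_iff[OF hk], OF refl] x
      unfolding M1_is_join_iff[OF c4[OF hk(1)] c4[OF hk(2)]] by simp
  qed (use c4 unit in \<open>auto simp: M1_aff_def\<close>)
  have \<psi>'\<psi>: "\<psi>' (\<psi> X) = X" if "X \<in> carrier G" for X
    unfolding \<psi>'_def using \<psi>D(1) that by (simp add: bij_betw_def)
  obtain Y where Y: "Y \<in> carrier G" "\<psi> Y = M1_aff 1 0"
    using \<psi>D(1) M1_aff_closed by (metis bij_betw_def imageE)
  obtain Z where Z: "Z \<in> carrier H" "\<tau> Z = Y"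
    using \<tau>D(1) Y(1) by (metis bij_betw_def imageE)
  have "Z \<in> g ` carrier G" unfolding g(2) by (rule Z(1))
  then obtain W where W: "W \<in> carrier G" "g W = Z" by blast
  have "f (\<psi> W) = M1_aff 1 0" unfolding f_def \<psi>'\<psi>[OF W(1)] W(2) Z(2) Y(2) ..
  moreover have "\<psi> W \<in> carrier M1" using \<psi>D(2) W(1) by blast
  ultimately have inj: "inj_on f (carrier M1)" using M1_endo_inj by blast
  show ?thesis
  proof (rule inj_onI)
    fix X X' assume X: "X \<in> carrier G" "X' \<in> carrier G" "g X = g X'"
    then have "f (\<psi> X) = f (\<psi> X')" by (simp add: f_def \<psi>'\<psi>)
    then have "\<psi> X = \<psi> X'" using inj X \<psi>D(2) by (blast dest: inj_onD)
    then show "X = X'" using \<psi>D(1) X by (auto simp: bij_betw_def dest: inj_onD)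
  qed
qed

section \<open>Unital AF algebras\<close>

context cstar_algebra begin

lemma cnorm_star_eq:
  assumes "x \<in> carrier A"
  shows "cnorm A (star A x) = cnorm A x"
proof -
  have le: "cnorm A y \<le> cnorm A (star A y)" if y: "y \<in> carrier A" for y
  proof (cases "cnorm A y = 0")
    case False
    have "cnorm A y * cnorm A y \<le> cnorm A (star A y) * cnorm A y"
      using cstar_identity[OF y] cnorm_mult[OF star_closed[OF y] y] by (simp add: power2_eq_square)
    moreover have "0 < cnorm A y" using False cnorm_nonneg[OF y] by simp
    ultimately show ?thesis by simp
  qed (use cnorm_nonneg star_closed y in simp)
  show ?thesis using le[OF assms] le[OF star_closed[OF assms]] star_star[OF assms] by simp
qed

lemma normed_star: "normed_star_algebra A"
  by (intro normed_star_algebra.intro star_ring.intro star_ring_axioms.intro normed_star_algebra_axioms.intro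
      ring_axioms complex_module star_closed star_star star_add star_mult smult_mult_left smult_mult_right
      star_smult cnorm_nonneg cnorm_eq_0 cnorm_smult cnorm_triangle cnorm_mult cnorm_star_eq)

lemma metric: "Metric_space (carrier A) (cdist A)"
proof -
  interpret N: normed_star_algebra A by (rule normed_star)
  show ?thesis
  proof
    show "0 \<le> cdist A x y" for x y by (simp add: cdist_def N.cnorm_nonneg)
    show "cdist A x y = cdist A y x" for x y by (simp add: cdist_def N.cnorm_diff_commute)
    show "cdist A x y = 0 \<longleftrightarrow> x = y" if "x \<in> carrier A" "y \<in> carrier A" for x y
      using that by (simp add: cdist_def N.cnorm_eq_0 N.minus_eq_zero_iff)
    show "cdist A x z \<le> cdist A x y + cdist A y z" if "x \<in> carrier A" "y \<in> carrier A" "z \<in> carrier A" for x y z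
      using that by (simp add: cdist_def N.cnorm_diff_triangle)
  qed
qed

lemma nstar: "nstar_algebra A"
proof (intro nstar_algebra.intro nstar_algebra_axioms.intro normed_star)
  interpret N: normed_star_algebra A by (rule normed_star)
  interpret MS: Metric_space "carrier A" "cdist A" by (rule metric)
  fix s :: "nat \<Rightarrow> 'a" and C :: real
  assume s: "\<And>n. s n \<in> carrier A" and step: "\<And>n. cnorm A (s (Suc n) \<ominus> s n) \<le> C * (1/2) ^ n"
  have C: "0 \<le> C" using N.cnorm_nonneg[of "s (Suc 0) \<ominus> s 0"] step[of 0] s by simp
  \<comment> \<open>The subtracted term, the remainder of the geometric series, makes the induction
    on m close.\<close>
  have tail: "cnorm A (s (n + m) \<ominus> s n) \<le> 2 * C * (1/2) ^ n - 2 * C * (1/2) ^ (n + m)" for n m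
  proof (induction m)
    case 0 then show ?case using s by (simp add: N.minus_eq_zero_iff[THEN iffD2])
  next
    case (Suc m)
    have "cnorm A (s (n + Suc m) \<ominus> s n) \<le> cnorm A (s (Suc (n + m)) \<ominus> s (n + m)) + cnorm A (s (n + m) \<ominus> s n)"
      using N.cnorm_diff_triangle[of "s (Suc (n + m))" "s (n + m)" "s n"] s by simp
    then show ?case using Suc step[of "n + m"] by simp
  qed
  have tail2: "cnorm A (s m \<ominus> s n) \<le> 2 * C * (1/2) ^ n" if "n \<le> m" for n m
  proof -
    have "0 \<le> 2 * C * (1/2) ^ m" using C by simp
    then show ?thesis using tail[of n "m - n"] that by simp
  qed
  have "MS.MCauchy s"
    unfolding MS.MCauchy_def
  proof (intro conjI allI impI)
    show "range s \<subseteq> carrier A" using s by blast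
    fix \<epsilon> :: real assume "0 < \<epsilon>"
    have "(\<lambda>n. 2 * C * (1/2) ^ n) \<longlonglongrightarrow> 2 * C * 0"
      by (intro tendsto_intros LIMSEQ_power_zero) auto
    then have "\<forall>\<^sub>F n in sequentially. 2 * C * (1/2) ^ n < \<epsilon>"
      using \<open>0 < \<epsilon>\<close> by (intro order_tendstoD(2)) auto
    then obtain N where N: "\<And>n. N \<le> n \<Longrightarrow> 2 * C * (1/2) ^ n < \<epsilon>"
      by (auto simp: eventually_sequentially)
    have "cdist A (s n) (s n') < \<epsilon>" if "N \<le> n" "N \<le> n'" for n n'
    proof (cases "n \<le> n'")
      case True
      then show ?thesis using tail2[OF True] N[OF that(1)] s N.cnorm_diff_commute[of "s n" "s n'"]
        by (simp add: cdist_def)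
    next
      case False
      then show ?thesis using tail2[of n' n] N[OF that(2)] s by (simp add: cdist_def)
    qed
    then show "\<exists>N. \<forall>n n'. N \<le> n \<longrightarrow> N \<le> n' \<longrightarrow> cdist A (s n) (s n') < \<epsilon>" by blast
  qed
  then obtain l where l: "limitin MS.mtopology s l sequentially"
    using complete by (auto simp: MS.mcomplete_def)
  then have lc: "l \<in> carrier A" by (simp add: MS.limitin_metric)
  have "(\<lambda>n. cnorm A (s n \<ominus> l)) \<longlonglongrightarrow> 0"
  proof (rule tendstoI)
    fix \<epsilon> :: real assume "0 < \<epsilon>"
    then have "\<forall>\<^sub>F n in sequentially. s n \<in> carrier A \<and> cdist A (s n) l < \<epsilon>"
      using l by (simp add: MS.limitin_metric)
    then show "\<forall>\<^sub>F n in sequentially. dist (cnorm A (s n \<ominus> l)) 0 < \<epsilon>"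
      by (rule eventually_mono) (use lc N.cnorm_nonneg in \<open>auto simp: cdist_def split: if_splits\<close>)
  qed
  then show "\<exists>l\<in>carrier A. (\<lambda>n. cnorm A (s n \<ominus> l)) \<longlonglongrightarrow> 0" using lc by blast
qed

end

text \<open>\<open>finite_dim\<close> of a subalgebra takes its sums in the record with the smaller
  carrier, and \<open>finsum\<close> depends on the carrier.\<close>

lemma subalgebra_finsum:
  assumes "abelian_monoid R" "abelian_monoid (R\<lparr>carrier := F\<rparr>)" "F \<subseteq> carrier R"
    and "finite S" "f \<in> S \<rightarrow> F"
  shows "finsum (R\<lparr>carrier := F\<rparr>) f S = finsum R f S"
proof -
  interpret R: abelian_monoid R by fact
  interpret S: abelian_monoid "R\<lparr>carrier := F\<rparr>" by fact
  show ?thesis using assms(4,5)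
  proof (induction S rule: finite_induct)
    case empty then show ?case by (simp add: R.finsum_empty S.finsum_empty)
  next
    case (insert k S)
    then have f: "f k \<in> F" "f \<in> S \<rightarrow> F" by auto
    then have fc: "f k \<in> carrier R" "f \<in> S \<rightarrow> carrier R" using assms(3) by auto
    show ?case
      using insert S.finsum_insert[of S k f] R.finsum_insert[of S k f] f fc by simp
  qed
qed

lemma unital_AF_imp_af_ideal:
  assumes AF: "unital_AF A" and I: "cstar_ideal I A"
  obtains F where "af_ideal A F I"
proof -
  interpret C: cstar_algebra A using AF by (simp add: unital_AF_def)
  interpret N: nstar_algebra A by (rule C.nstar)
  interpret MS: Metric_space "carrier A" "cdist A" by (rule C.metric)
  obtain F where F: "\<And>n. F n \<subseteq> carrier A" "\<And>n. F n \<subseteq> F (Suc n)"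
    "\<And>n. cstar_algebra (A\<lparr>carrier := F n\<rparr>)" "\<And>n. finite_dim (A\<lparr>carrier := F n\<rparr>)"
    "ctopology A closure_of (\<Union>n. F n) = carrier A"
    using AF unfolding unital_AF_def by metis
  have "af_ideal A F I"
  proof (intro af_ideal.intro af_algebra.intro af_algebra_axioms.intro af_ideal_axioms.intro N.nstar_algebra_axioms)
    show "cnorm A (star A x \<otimes>\<^bsub>A\<^esub> x) = (cnorm A x)\<^sup>2" if "x \<in> carrier A" for x
      using C.cstar_identity that .
    fix n
    interpret S: cstar_algebra "A\<lparr>carrier := F n\<rparr>" by (rule F(3))
    interpret SN: nstar_algebra "A\<lparr>carrier := F n\<rparr>" by (rule S.nstar)
    show "F n \<subseteq> carrier A" "F n \<subseteq> F (Suc n)" using F by auto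
    show "x \<oplus>\<^bsub>A\<^esub> y \<in> F n" "x \<otimes>\<^bsub>A\<^esub> y \<in> F n" if "x \<in> F n" "y \<in> F n" for x y
      using S.a_closed[of x y] S.m_closed[of x y] that by auto
    show "star A x \<in> F n" if "x \<in> F n" for x using S.star_closed[of x] that by simp
    show smF: "c \<odot>\<^bsub>A\<^esub> x \<in> F n" if "x \<in> F n" for c x using SN.smult_closed[of x c] that by simp
    show "\<one>\<^bsub>A\<^esub> \<in> F n" using S.one_closed by simp
    obtain B where B: "finite B" "B \<subseteq> F n"
      "\<forall>x\<in>F n. \<exists>c. x = (\<Oplus>\<^bsub>A\<lparr>carrier := F n\<rparr>\<^esub>b\<in>B. c b \<odot>\<^bsub>A\<^esub> b)"
      using F(4)[of n] by (auto simp: finite_dim_def)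
    have "(\<Oplus>\<^bsub>A\<lparr>carrier := F n\<rparr>\<^esub>b\<in>B. c b \<odot>\<^bsub>A\<^esub> b) = (\<Oplus>\<^bsub>A\<^esub>b\<in>B. c b \<odot>\<^bsub>A\<^esub> b)" for c
      using B smF F(1) by (intro subalgebra_finsum abelian_group.axioms(1) ring.axioms(1) C.ring_axioms S.ring_axioms) auto
    then show "\<exists>B. finite B \<and> B \<subseteq> F n \<and> (\<forall>x\<in>F n. \<exists>c. x = (\<Oplus>\<^bsub>A\<^esub>b\<in>B. c b \<odot>\<^bsub>A\<^esub> b))"
      using B by auto
  next
    fix x and \<epsilon> :: real assume x: "x \<in> carrier A" and \<epsilon>: "0 < \<epsilon>"
    then have "x \<in> MS.mtopology closure_of (\<Union>n. F n)" using F(5) by (simp add: ctopology_def)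
    then obtain n y where y: "y \<in> F n" "y \<in> MS.mball x \<epsilon>" using \<epsilon> by (auto simp: MS.metric_closure_of)
    then have "cnorm A (x \<ominus>\<^bsub>A\<^esub> y) < \<epsilon>" by (auto simp: cdist_def)
    then show "\<exists>n. \<exists>y\<in>F n. cnorm A (x \<ominus>\<^bsub>A\<^esub> y) < \<epsilon>" using y(1) by blast
  next
    show "ideal I A" using I by (simp add: cstar_ideal_def)
  next
    fix x assume x: "x \<in> carrier A" and approx: "\<And>\<epsilon>. 0 < \<epsilon> \<Longrightarrow> \<exists>y\<in>I. cnorm A (x \<ominus>\<^bsub>A\<^esub> y) < \<epsilon>"
    have cl: "closedin MS.mtopology I" using I by (simp add: cstar_ideal_def ctopology_def)
    show "x \<in> I"
    proof (rule ccontr)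
      assume "x \<notin> I"
      then obtain r where r: "0 < r" "disjnt I (MS.mball x r)"
        using cl x unfolding MS.closedin_metric by blast
      obtain y where y: "y \<in> I" "cnorm A (x \<ominus>\<^bsub>A\<^esub> y) < r" using approx[OF r(1)] by blast
      then have "y \<in> carrier A" using cl unfolding MS.closedin_metric by blast
      then have "y \<in> MS.mball x r" using y x by (simp add: cdist_def)
      then show False using r(2) y(1) by (auto simp: disjnt_iff)
    qed
  qed
  then show ?thesis using that by blast
qed

section \<open>Quotients\<close>

lemma cstar_quot_simps:
  "carrier (cstar_quot A I) = carrier (A Quot I)"
  "X \<otimes>\<^bsub>cstar_quot A I\<^esub> Y = X \<otimes>\<^bsub>A Quot I\<^esub> Y"
  "X \<oplus>\<^bsub>cstar_quot A I\<^esub> Y = X \<oplus>\<^bsub>A Quot I\<^esub> Y"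
  "\<one>\<^bsub>cstar_quot A I\<^esub> = \<one>\<^bsub>A Quot I\<^esub>"
  "\<zero>\<^bsub>cstar_quot A I\<^esub> = \<zero>\<^bsub>A Quot I\<^esub>"
  "star (cstar_quot A I) X = (\<Union>x\<in>X. I +>\<^bsub>A\<^esub> star A x)"
  "c \<odot>\<^bsub>cstar_quot A I\<^esub> X = (\<Union>x\<in>X. I +>\<^bsub>A\<^esub> (c \<odot>\<^bsub>A\<^esub> x))"
  by (simp_all add: cstar_quot_def)

context af_ideal begin

abbreviation "B \<equiv> cstar_quot R I"
abbreviation "\<sigma> \<equiv> quot_map R I"

lemma quot_eq_iff: "\<lbrakk>x \<in> carrier R; y \<in> carrier R\<rbrakk> \<Longrightarrow> \<sigma> x = \<sigma> y \<longleftrightarrow> x \<ominus> y \<in> I"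
  unfolding quot_map_def using quotient_eq_iff_same_a_r_cos[OF ideal] by simp

lemma quot_surj: "\<sigma> ` carrier R = carrier B"
  by (auto simp: cstar_quot_simps FactRing_def A_RCOSETS_def' quot_map_def)

lemma quot_mem_iff:
  assumes "x \<in> carrier R"
  shows "y \<in> \<sigma> x \<longleftrightarrow> y \<in> carrier R \<and> \<sigma> y = \<sigma> x"
proof -
  interpret ideal I R by (rule ideal)
  have sub: "\<sigma> x \<subseteq> carrier R" using assms a_r_coset_subset_G a_subset by (simp add: quot_map_def)
  show ?thesis
  proof
    assume "y \<in> \<sigma> x"
    then show "y \<in> carrier R \<and> \<sigma> y = \<sigma> x"
      using sub a_repr_independence'[of y x] assms by (auto simp: quot_map_def)
  next
    assume "y \<in> carrier R \<and> \<sigma> y = \<sigma> x"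
    then show "y \<in> \<sigma> x" using a_rcos_self[of y] by (auto simp: quot_map_def)
  qed
qed

text \<open>Evaluates the operations of \<open>cstar_quot\<close> that are unions over
  representatives: if \<open>T\<close> respects congruence modulo \<open>I\<close>, all cosets in
  the union coincide.\<close>

lemma quot_union:
  assumes x: "x \<in> carrier R" and T: "\<And>y. y \<in> carrier R \<Longrightarrow> T y \<in> carrier R"
    and resp: "\<And>y. y \<in> carrier R \<Longrightarrow> y \<ominus> x \<in> I \<Longrightarrow> T y \<ominus> T x \<in> I"
  shows "(\<Union>y\<in>\<sigma> x. I +> T y) = \<sigma> (T x)"
proof -
  have "I +> T y = \<sigma> (T x)" if "y \<in> \<sigma> x" for y
  proof -
    have y: "y \<in> carrier R" "\<sigma> y = \<sigma> x" using that quot_mem_iff[OF x] by auto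
    then have "T y \<ominus> T x \<in> I" using resp quot_eq_iff x by blast
    then show ?thesis using quot_eq_iff[OF T[OF y(1)] T[OF x]] by (simp add: quot_map_def)
  qed
  moreover have "x \<in> \<sigma> x" using quot_mem_iff[OF x] x by simp
  ultimately show ?thesis by blast
qed

text \<open>Well defined on cosets because \<open>I\<close> is closed under the star, a property
  that \<open>cstar_ideal\<close> entails by way of the approximate unit.\<close>

lemma quot_star: "x \<in> carrier R \<Longrightarrow> star B (\<sigma> x) = \<sigma> (star R x)"
  unfolding cstar_quot_simps using ideal_star_closed
  by (intro quot_union) (auto simp: star_diff[symmetric])

lemma quot_smult: "x \<in> carrier R \<Longrightarrow> c \<odot>\<^bsub>B\<^esub> \<sigma> x = \<sigma> (c \<odot> x)"
proof -
  assume x: "x \<in> carrier R"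
  have "c \<odot> y \<ominus> c \<odot> x = c \<odot> (y \<ominus> x)" if "y \<in> carrier R" for y
    using x that by (simp add: minus_eq smult_r_distr minus_eq_smult smult_smult mult.commute)
  then show ?thesis
    unfolding cstar_quot_simps using x I_smult by (intro quot_union) auto
qed

lemma quot_ring_hom: "\<sigma> \<in> Ring.ring_hom R B"
  using ideal.rcos_ring_hom[OF ideal] unfolding quot_map_def
  by (auto simp: ring_hom_def cstar_quot_simps)

text \<open>K_0 of the quotient is built from its ring structure and star; the norm estimates for
  lifting take place in \<open>R\<close>.\<close>

lemma quot_star_ring: "star_ring B"
proof -
  interpret Q: ring "R Quot I" by (rule ideal.quotient_is_ring[OF ideal])
  have ring: "ring B"
  proof (rule ringI)
    show "abelian_group B"
    proof (rule abelian_groupI)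
      fix X assume "X \<in> carrier B"
      then show "\<exists>Y\<in>carrier B. Y \<oplus>\<^bsub>B\<^esub> X = \<zero>\<^bsub>B\<^esub>"
        using Q.l_neg[of X] Q.a_inv_closed[of X] unfolding cstar_quot_simps by blast
    qed (simp_all add: cstar_quot_simps Q.a_ac)
    show "monoid B"
      by (rule monoidI) (auto simp: cstar_quot_simps Q.m_assoc)
  qed (auto simp: cstar_quot_simps Q.l_distr Q.r_distr)
  have h: "\<sigma> (x \<otimes> y) = \<sigma> x \<otimes>\<^bsub>B\<^esub> \<sigma> y" "\<sigma> (x \<oplus> y) = \<sigma> x \<oplus>\<^bsub>B\<^esub> \<sigma> y" if "x \<in> carrier R" "y \<in> carrier R" for x y
    using quot_ring_hom that by (auto simp: ring_hom_def)
  show ?thesis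
  proof (intro star_ring.intro star_ring_axioms.intro ring)
    fix X assume "X \<in> carrier B"
    then obtain x where x: "x \<in> carrier R" "X = \<sigma> x" using quot_surj by blast
    show "star B X \<in> carrier B" "star B (star B X) = X"
      using x quot_surj by (auto simp: quot_star)
    fix Y assume "Y \<in> carrier B"
    then obtain y where y: "y \<in> carrier R" "Y = \<sigma> y" using quot_surj by blast
    show "star B (X \<oplus>\<^bsub>B\<^esub> Y) = star B X \<oplus>\<^bsub>B\<^esub> star B Y"
      using x y by (simp add: quot_star star_add flip: h)
    show "star B (X \<otimes>\<^bsub>B\<^esub> Y) = star B Y \<otimes>\<^bsub>B\<^esub> star B X"
      using x y by (simp add: quot_star star_mult flip: h)
  qed
qed

lemma quot_star_hom: "star_hom R B \<sigma>"
  by (intro star_hom.intro star_hom_axioms.intro star_ring_axioms quot_star_ring quot_ring_hom)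
    (simp add: quot_star)

lemma quot_projection_lift:
  assumes "p \<in> projections B"
  shows "\<exists>q\<in>projections R. map_mat \<sigma> q = p"
proof -
  interpret B: star_ring B by (rule quot_star_ring)
  interpret S: star_hom R B \<sigma> by (rule quot_star_hom)
  define k where "k = dim_row p"
  have p: "p \<in> amat B k k" "aadj B p = p" "amult B p p = p"
    using B.projectionsD[OF assms] by (auto simp: k_def)
  define x0 where "x0 = Matrix.mat k k (\<lambda>ij. SOME y. y \<in> carrier R \<and> \<sigma> y = p $$ ij)"
  have x0: "x0 $$ (i, j) \<in> carrier R" "\<sigma> (x0 $$ (i, j)) = p $$ (i, j)" if "i < k" "j < k" for i j
  proof -
    have "\<exists>y. y \<in> carrier R \<and> \<sigma> y = p $$ (i, j)"
      using amatD(3)[OF p(1) that] quot_surj by (metis imageE)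
    from someI_ex[OF this] show "x0 $$ (i, j) \<in> carrier R" "\<sigma> (x0 $$ (i, j)) = p $$ (i, j)"
      using that by (simp_all add: x0_def)
  qed
  \<comment> \<open>The self-adjoint part of an arbitrary lift is still a lift, since p is
    self-adjoint.\<close>
  define x where "x = Matrix.mat k k (\<lambda>(i, j). (1/2) \<odot> (x0 $$ (i, j) \<oplus> star R (x0 $$ (j, i))))"
  have xa: "x \<in> amat R k k" using x0 by (auto simp: x_def intro!: amatI)
  have xs: "aadj R x = x"
    using x0 by (intro eq_matI) (auto simp: x_def aadj_index star_smult star_add a_comm)
  have x: "\<sigma> (x $$ (i, j)) = p $$ (i, j)" if ij: "i < k" "j < k" for i j
  proof -
    let ?a = "x0 $$ (i, j)" and ?b = "star R (x0 $$ (j, i))"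
    have ab: "?a \<in> carrier R" "?b \<in> carrier R" using x0 ij by auto
    have "\<sigma> ?b = aadj B p $$ (i, j)"
      using x0 ij amatD[OF p(1)] by (simp add: aadj_index flip: quot_star)
    then have "\<sigma> ?b = \<sigma> ?a" using p(2) x0 ij by simp
    then have "?b \<ominus> ?a \<in> I" using quot_eq_iff ab by simp
    then have "(1/2) \<odot> (?b \<ominus> ?a) \<in> I" by (rule I_smult)
    moreover have "(1/2) \<odot> (?a \<oplus> ?b) \<ominus> ?a = (1/2) \<odot> (?b \<ominus> ?a)"
    proof -
      have "?a = (1/2) \<odot> ?a \<oplus> (1/2) \<odot> ?a" using smult_l_distr[OF ab(1), of "1/2" "1/2"] ab by simp
      then have "(1/2) \<odot> (?a \<oplus> ?b) \<ominus> ?a = ((1/2) \<odot> ?a \<oplus> (1/2) \<odot> ?b) \<ominus> ((1/2) \<odot> ?a \<oplus> (1/2) \<odot> ?a)"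
        using smult_r_distr[OF ab] by simp
      also have "\<dots> = (1/2) \<odot> ?b \<ominus> (1/2) \<odot> ?a"
        using ab by (simp add: a_comm[of "(1/2) \<odot> ?a" "(1/2) \<odot> ?b"] minus_eq minus_add)
          (simp add: a_assoc r_neg1 r_neg2)
      also have "\<dots> = (1/2) \<odot> (?b \<ominus> ?a)"
        using ab by (simp add: minus_eq smult_r_distr minus_eq_smult smult_smult)
      finally show ?thesis .
    qed
    ultimately have "\<sigma> (x $$ (i, j)) = \<sigma> ?a"
      using ab ij by (simp add: x_def quot_eq_iff)
    then show ?thesis using x0 ij by simp
  qed
  have xp: "map_mat \<sigma> x = p" using xa p(1) x by (intro eq_matI) (auto simp: amatD)
  have "amult R x x $$ (i, j) \<ominus> x $$ (i, j) \<in> I" if ij: "i < k" "j < k" for i j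
  proof -
    have xx: "amult R x x \<in> amat R k k" using xa by blast
    have "\<sigma> (amult R x x $$ (i, j)) = map_mat \<sigma> (amult R x x) $$ (i, j)"
      using ij amatD[OF xx] by simp
    also have "\<dots> = p $$ (i, j)" using S.map_mat_amult[OF xa xa] xp p(3) by simp
    finally show ?thesis
      using quot_eq_iff[OF amatD(3)[OF xx ij] amatD(3)[OF xa ij]] x[OF ij] by simp
  qed
  then obtain q where q: "q \<in> amat R k k" "aadj R q = q" "amult R q q = q"
    "\<And>i j. i < k \<Longrightarrow> j < k \<Longrightarrow> q $$ (i, j) \<ominus> x $$ (i, j) \<in> I"
    using mat_projection_lift[OF xa xs] by blast
  have "map_mat \<sigma> q = p"
  proof (rule amat_eqI[OF S.map_mat_closed[OF q(1)] p(1)])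
    fix i j assume ij: "i < k" "j < k"
    then have "\<sigma> (q $$ (i, j)) = \<sigma> (x $$ (i, j))"
      using q(4) quot_eq_iff amatD(3)[OF q(1)] amatD(3)[OF xa] by simp
    then show "map_mat \<sigma> q $$ (i, j) = p $$ (i, j)" using x ij amatD[OF q(1)] by simp
  qed
  then show ?thesis using q projectionsI by blast
qed

lemma K0_quot_surj: "K0_map B \<sigma> ` carrier (K0 R) = carrier (K0 B)"
proof -
  interpret B: star_ring B by (rule quot_star_ring)
  interpret S: star_hom R B \<sigma> by (rule quot_star_hom)
  have "X \<in> K0_map B \<sigma> ` carrier (K0 R)" if X: "X \<in> carrier (K0 B)" for X
  proof -
    obtain p q where pq: "p \<in> projections B" "q \<in> projections B" "X = K0_class B p q"
      using B.K0_carrierE[OF X] .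
    obtain p' where p': "p' \<in> projections R" "map_mat \<sigma> p' = p" using quot_projection_lift[OF pq(1)] by blast
    obtain q' where q': "q' \<in> projections R" "map_mat \<sigma> q' = q" using quot_projection_lift[OF pq(2)] by blast
    have "X = K0_map B \<sigma> (K0_class R p' q')" "K0_class R p' q' \<in> carrier (K0 R)"
      using S.K0_map_class K0_class_in_carrier pq(3) p' q' by auto
    then show ?thesis by blast
  qed
  then show ?thesis using S.K0_map_closed by blast
qed

lemma ideal_trivial_if_K0_inj:
  assumes inj: "inj_on (K0_map B \<sigma>) (carrier (K0 R))"
  shows "I = {\<zero>}"
proof (rule ideal_trivial_if_no_projections)
  interpret S: star_hom R B \<sigma> by (rule quot_star_hom)
  fix e assume e: "e \<in> I" "star R e = e" "e \<otimes> e = e"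
  have ec: "e \<in> carrier R" using e I_carrier by blast
  let ?e = "Matrix.mat 1 1 (\<lambda>_. e)"
  have ep: "?e \<in> projections R"
    using e ec by (intro projectionsI[of _ 1])
      (auto simp: amult_index aadj_index lessThan_Suc finsum_insert finsum_empty intro!: amatI eq_matI)
  have "\<sigma> e = \<sigma> \<zero>" using quot_eq_iff[OF ec zero_closed] e ec by (simp add: minus_eq)
  then have "map_mat \<sigma> ?e = map_mat \<sigma> (zero_proj R)" by (intro eq_matI) (auto simp: zero_proj_def)
  then have "K0_map B \<sigma> (K0_class R ?e (zero_proj R)) = K0_map B \<sigma> (K0_class R (zero_proj R) (zero_proj R))"
    using ep zero_proj_projection by (simp add: S.K0_map_class)
  then have "K0_class R ?e (zero_proj R) = K0_class R (zero_proj R) (zero_proj R)"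
    using inj ep zero_proj_projection K0_class_in_carrier by (meson inj_onD)
  then show "e = \<zero>" using stably_finite[OF ec e(2,3)] by blast
qed

end

theorem theorem7p4:
  fixes A :: "'a cstar"
    and I :: "'a set"
    and \<iota> :: "'a \<Rightarrow> 'a"
    and \<sigma> :: "'a \<Rightarrow> 'a set"
    and \<theta> :: "'a set \<Rightarrow> 'a"
  assumes "farey_stern_brocot A"
    and "cstar_ideal I A"
    and "\<iota> = id"
    and "\<sigma> = quot_map A I"
    and "short_exact I \<iota> A \<sigma> (cstar_quot A I)"
    and "unital_l_group (K0 A)"
    and "unital_l_group (K0 (cstar_quot A I))"
    and "K0_map (cstar_quot A I) \<sigma> \<in> unital_l_hom (K0 A) (K0 (cstar_quot A I))"
    and "\<theta> \<in> cstar_iso (cstar_quot A I) A"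
  shows "\<theta> \<circ> \<sigma> \<in> cstar_auto A"
proof -
  have AF: "unital_AF A" "unital_po_iso (K0 A) M1 \<noteq> {}"
    using assms(1) by (auto simp: farey_stern_brocot_def)
  obtain F where "af_ideal A F I" using unital_AF_imp_af_ideal[OF AF(1) assms(2)] .
  then interpret J: af_ideal A F I .
  let ?B = "cstar_quot A I"
  have \<sigma>: "\<sigma> = quot_map A I" by fact
  obtain \<psi> where \<psi>: "\<psi> \<in> unital_po_iso (K0 A) M1" using AF(2) by blast
  have \<theta>: "\<theta> \<in> Ring.ring_hom ?B A" "\<And>X. X \<in> carrier ?B \<Longrightarrow> \<theta> (star ?B X) = star A (\<theta> X)"
    "\<And>c X. X \<in> carrier ?B \<Longrightarrow> \<theta> (c \<odot>\<^bsub>?B\<^esub> X) = c \<odot>\<^bsub>A\<^esub> \<theta> X" "bij_betw \<theta> (carrier ?B) (carrier A)"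
    using assms(9) by (auto simp: cstar_iso_def cstar_hom_def)
  interpret T: star_hom ?B A \<theta>
    using \<theta> by (intro star_hom.intro star_hom_axioms.intro J.quot_star_ring J.star_ring_axioms)
  interpret S: star_hom A ?B \<sigma> unfolding \<sigma> by (rule J.quot_star_hom)
  \<comment> \<open>The inverse has to be a star homomorphism too, for
    \<open>K0_map A \<theta>\<close> to reflect the order.\<close>
  define \<theta>' where "\<theta>' = inv_into (carrier ?B) \<theta>"
  have \<theta>': "\<theta>' x \<in> carrier ?B" "\<theta> (\<theta>' x) = x" if "x \<in> carrier A" for x
    using \<theta>(4) that by (auto simp: \<theta>'_def bij_betw_def inv_into_into f_inv_into_f)
  have \<theta>'\<theta>: "\<theta>' (\<theta> X) = X" if "X \<in> carrier ?B" for X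
    using \<theta>(4) that by (simp add: \<theta>'_def bij_betw_def)
  have "star_hom A ?B \<theta>'"
  proof (intro star_hom.intro star_hom_axioms.intro J.quot_star_ring J.star_ring_axioms)
    show "\<theta>' \<in> Ring.ring_hom A ?B"
    proof (rule ring_hom_memI)
      fix x y assume xy: "x \<in> carrier A" "y \<in> carrier A"
      show "\<theta>' x \<in> carrier ?B" using \<theta>' xy by blast
      have "x \<otimes>\<^bsub>A\<^esub> y = \<theta> (\<theta>' x \<otimes>\<^bsub>?B\<^esub> \<theta>' y)" "x \<oplus>\<^bsub>A\<^esub> y = \<theta> (\<theta>' x \<oplus>\<^bsub>?B\<^esub> \<theta>' y)"
        using \<theta>' xy by (simp_all add: T.h_mult T.h_add)
      then show "\<theta>' (x \<otimes>\<^bsub>A\<^esub> y) = \<theta>' x \<otimes>\<^bsub>?B\<^esub> \<theta>' y" "\<theta>' (x \<oplus>\<^bsub>A\<^esub> y) = \<theta>' x \<oplus>\<^bsub>?B\<^esub> \<theta>' y"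
        using \<theta>' xy by (simp_all add: \<theta>'\<theta> T.A.m_closed T.A.a_closed)
    next
      show "\<theta>' \<one>\<^bsub>A\<^esub> = \<one>\<^bsub>?B\<^esub>" using \<theta>'\<theta>[OF T.A.one_closed] by simp
    qed
    fix x assume x: "x \<in> carrier A"
    have "star A x = \<theta> (star ?B (\<theta>' x))" using \<theta>' x by (simp add: T.h_star)
    then show "\<theta>' (star A x) = star ?B (\<theta>' x)" using \<theta>' x by (simp add: \<theta>'\<theta>)
  qed
  then have \<tau>: "K0_map A \<theta> \<in> unital_po_iso (K0 ?B) (K0 A)"
    using K0_map_iso[OF T.star_hom_axioms] \<theta>' \<theta>'\<theta> by blast
  have "inj_on (K0_map ?B \<sigma>) (carrier (K0 A))"
    using M1_hopfian[OF assms(6) \<psi> \<tau> assms(8)] J.K0_quot_surj unfolding \<sigma> by blast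
  then have I: "I = {\<zero>\<^bsub>A\<^esub>}" unfolding \<sigma> by (rule J.ideal_trivial_if_K0_inj)
  have "inj_on \<sigma> (carrier A)"
    unfolding \<sigma> by (rule inj_onI) (use J.quot_eq_iff J.minus_eq_zero_iff I in auto)
  then have "bij_betw \<sigma> (carrier A) (carrier ?B)"
    using J.quot_surj by (simp add: bij_betw_def \<sigma>)
  then have "bij_betw (\<theta> \<circ> \<sigma>) (carrier A) (carrier A)" using \<theta>(4) by (rule bij_betw_trans)
  moreover have "\<theta> \<circ> \<sigma> \<in> cstar_hom A A"
    unfolding cstar_hom_def
  proof (intro CollectI conjI ballI allI)
    show "\<theta> \<circ> \<sigma> \<in> Ring.ring_hom A A"
      by (rule ring_hom_memI) (auto simp: S.h_mult S.h_add T.h_mult T.h_add)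
    fix x assume x: "x \<in> carrier A"
    show "(\<theta> \<circ> \<sigma>) (star A x) = star A ((\<theta> \<circ> \<sigma>) x)" using x by (simp add: S.h_star T.h_star)
    show "(\<theta> \<circ> \<sigma>) (c \<odot>\<^bsub>A\<^esub> x) = c \<odot>\<^bsub>A\<^esub> (\<theta> \<circ> \<sigma>) x" for c
      using x \<theta>(3)[OF S.h_closed[OF x]] J.quot_smult[OF x] by (simp add: \<sigma>)
  qed
  ultimately show ?thesis by (simp add: cstar_iso_def)
qed

end
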